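(* Let $n\ge3$ and let $W\in C_b\cap H^1(\mathbb S^{n-1}\times\mathbb S^{n-1})$ be a rotationally symmetric interaction kernel. If there exists $k\in\mathbb N$ with $\hat W_k<0$ and $\hat W_j\ne\hat W_k$ for all $j\in\mathbb N\setminus\{k\}$, then there exist $\delta>0$ and a non-trivial branch (i.e. one not identically equal to $\bar\rho$) of solutions $\rho_{\gamma(t)}\in L_2(\mathbb S^{n-1})$, at parameter value $\gamma(t)$, of the stationary McKean–Vlasov equation $\gamma^{-1}\Delta\rho+\mathrm{div}(\rho\nabla_xW(x,\cdot)*\rho)=0$ on $\mathbb S^{n-1}$, of the form $$\rho_{\gamma(t)}=\bar\rho+f(t)Y_{k,0}+o(f(t)),\qquad \gamma(t)=\gamma_k+\mu(t),\qquad t\in(-\delta,\delta),$$ around the bifurcation point $\gamma_k=-1/\hat W_k$, where $f,\mu$ are continuous functions on $(-\delta,\delta)$ with $f(0)=0$ and $\mu(0)=0$ (and $o(f(t))$ is understood in $L_2(\mathbb S^{n-1})$ as $t\to0$).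
   Context: $\mathbb N=\{1,2,\dots\}$. $\sigma$ is the surface measure on the unit sphere $\mathbb S^{n-1}\subset\mathbb R^n$, $\omega_n=\sigma(\mathbb S^{n-1})$, $\langle f,g\rangle_{L_2}=\omega_n^{-1}\int fg\,d\sigma$, and $\bar\rho=1/\omega_n$ is the uniform state. Rotationally symmetric means $W(x,y)=W(\langle x,y\rangle)$ for a function $W:[-1,1]\to\mathbb R$ (same letter). $(W*\rho)(x)=\int W(\langle x,y\rangle)\rho(y)\,d\sigma(y)$, and $(\nabla_xW(x,\cdot)*\rho)(x)=\int\nabla_xW(x,y)\rho(y)\,d\sigma(y)$. Gegenbauer polynomials: $C_0^\lambda=1$, $C_1^\lambda(t)=2\lambda t$, $(k+2)C_{k+2}^\lambda(t)=2(\lambda+k+1)tC_{k+1}^\lambda(t)-(2\lambda+k)C_k^\lambda(t)$. The spherical harmonics decomposition of $W$ is $$\hat W_k=\frac{\Gamma(\frac n2)}{\sqrt\pi\,\Gamma(\frac{n-1}2)}\int_{-1}^1W(t)\frac{C_k^{\frac{n-2}2}(t)}{C_k^{\frac{n-2}2}(1)}(1-t^2)^{\frac{n-3}2}dt .$$ $Y_{k,0}(x)=A_kC_k^{\frac{n-2}2}(x_n)$ with $A_k>0$ chosen so that $\|Y_{k,0}\|_{L_2}=1$. Solutions are weak solutions: $\rho\in H^1$ is a probability density with $\gamma^{-1}\int g(\nabla\rho,\nabla\phi)d\sigma+\int g(\rho\nabla\phi,\nabla_xW(x,\cdot)*\rho)d\sigma=0$ for all $\phi\in H^1(\mathbb S^{n-1})$,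 with $g$ the round metric. *)

theory Defs
  imports "HOL-Analysis.Analysis"
begin

section \<open>Surface measure and \<open>L\<^sub>2\<close> norm on the unit sphere\<close>

text \<open>
  Polar coordinates: for Borel \<open>A\<close> in the unit sphere, the surface measure of \<open>A\<close> is the dimension
  times the Lebesgue measure of the punctured cone over \<open>A\<close> inside the unit ball. The underlying
  space of this measure is the sphere, so functions on the ambient space enter only through their
  restrictions.
\<close>
definition sphere_measure :: "'a::euclidean_space measure" where
  "sphere_measure =
     scale_measure (of_nat DIM('a))
       (distr (restrict_space lborel (ball 0 1 - {0})) (restrict_space borel (sphere 0 1)) sgn)"

definition sphere_area :: "'a::euclidean_space itself \<Rightarrow> real" where
  "sphere_area _ = measure (sphere_measure :: 'a measure) (sphere 0 1)"

definition uniform_state :: "'a::euclidean_space \<Rightarrow> real" where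
  "uniform_state x = 1 / sphere_area TYPE('a)"

definition L2_norm :: "('a::euclidean_space \<Rightarrow> real) \<Rightarrow> real" where
  "L2_norm u = sqrt (1 / sphere_area TYPE('a) * (\<integral>x. (u x)\<^sup>2 \<partial>sphere_measure))"


section \<open>Sobolev space \<open>H\<^sup>1\<close>\<close>

primrec C_k :: "nat \<Rightarrow> ('a::euclidean_space \<Rightarrow> real) \<Rightarrow> bool" where
  "C_k 0 f \<longleftrightarrow> continuous_on UNIV f"
| "C_k (Suc k) f \<longleftrightarrow> (\<exists>G. (\<forall>x. GDERIV f x :> G x) \<and> (\<forall>b\<in>Basis. C_k k (\<lambda>x. G x \<bullet> b)))"

definition C_infinity :: "('a::euclidean_space \<Rightarrow> real) \<Rightarrow> bool" where
  "C_infinity f \<longleftrightarrow> (\<forall>k. C_k k f)"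

text \<open>
  \<open>H\<^sup>1\<close> of a compact submanifold \<open>X\<close> of a Euclidean space, as the completion of the smooth functions
  in the \<open>H\<^sup>1\<close> norm. Here \<open>M\<close> is the volume measure of \<open>X\<close> and \<open>P x\<close> is the orthogonal projection
  onto the tangent space at \<open>x\<close>. The smooth functions on \<open>X\<close> are the restrictions of smooth
  functions \<open>F\<close> on the ambient space, and the Riemannian gradient of such a restriction is the
  tangential part of the ambient gradient. The weak gradient \<open>v\<close> is determined by \<open>u\<close> up to null
  sets; its values are ambient vectors, so that the Riemannian metric is the ambient inner product.
\<close>
definition has_weak_gradient ::
  "'a::euclidean_space measure \<Rightarrow> ('a \<Rightarrow> 'a \<Rightarrow> 'a) \<Rightarrow> ('a \<Rightarrow> real) \<Rightarrow> ('a \<Rightarrow> 'a) \<Rightarrow> bool" where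
  "has_weak_gradient M P u v \<longleftrightarrow>
     u \<in> borel_measurable M \<and> integrable M (\<lambda>x. (u x)\<^sup>2) \<and>
     v \<in> borel_measurable M \<and> integrable M (\<lambda>x. (norm (v x))\<^sup>2) \<and>
     (\<exists>F G. (\<forall>i. C_infinity (F i)) \<and> (\<forall>i x. GDERIV (F i) x :> G i x) \<and>
        (\<lambda>i::nat. \<integral>x. (F i x - u x)\<^sup>2 \<partial>M) \<longlonglongrightarrow> 0 \<and>
        (\<lambda>i. \<integral>x. (norm (P x (G i x) - v x))\<^sup>2 \<partial>M) \<longlonglongrightarrow> 0)"

definition tangent_proj :: "'a::euclidean_space \<Rightarrow> 'a \<Rightarrow> 'a" where
  "tangent_proj x v = v - (x \<bullet> v) *\<^sub>R x"

definition has_sphere_gradient :: "('a::euclidean_space \<Rightarrow> real) \<Rightarrow> ('a \<Rightarrow> 'a) \<Rightarrow> bool" where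
  "has_sphere_gradient = has_weak_gradient sphere_measure tangent_proj"

text \<open>The first component of a weak gradient of \<open>W\<close> is \<open>\<nabla>\<^sub>x W\<close>, the second one is \<open>\<nabla>\<^sub>y W\<close>.\<close>
definition has_sphere_product_gradient ::
  "('a::euclidean_space \<times> 'a \<Rightarrow> real) \<Rightarrow> ('a \<times> 'a \<Rightarrow> 'a \<times> 'a) \<Rightarrow> bool" where
  "has_sphere_product_gradient =
     has_weak_gradient (sphere_measure \<Otimes>\<^sub>M sphere_measure)
       (\<lambda>(x, y) (a, b). (tangent_proj x a, tangent_proj y b))"

definition H1_sphere_product :: "('a::euclidean_space \<times> 'a \<Rightarrow> real) set" where
  "H1_sphere_product = {W. \<exists>DW. has_sphere_product_gradient W DW}"

definition Cb_sphere_product :: "('a::euclidean_space \<times> 'a \<Rightarrow> real) set" where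
  "Cb_sphere_product = {W. continuous_on (sphere 0 1 \<times> sphere 0 1) W \<and>
                           bounded (W ` (sphere 0 1 \<times> sphere 0 1))}"


section \<open>Interaction kernels and the stationary McKean--Vlasov equation\<close>

definition rotationally_symmetric ::
  "('a::euclidean_space \<times> 'a \<Rightarrow> real) \<Rightarrow> (real \<Rightarrow> real) \<Rightarrow> bool" where
  "rotationally_symmetric W w \<longleftrightarrow>
     (\<forall>x\<in>sphere 0 1. \<forall>y\<in>sphere 0 1. W (x, y) = w (x \<bullet> y))"

text \<open>With \<open>DW\<close> a weak gradient of \<open>W\<close>, this is \<open>(\<nabla>\<^sub>x W(x, \<cdot>) * \<rho>)(x)\<close>.\<close>
definition grad_conv ::
  "('a::euclidean_space \<times> 'a \<Rightarrow> 'a \<times> 'a) \<Rightarrow> ('a \<Rightarrow> real) \<Rightarrow> 'a \<Rightarrow> 'a" where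
  "grad_conv DW \<rho> x = (\<integral>y. \<rho> y *\<^sub>R fst (DW (x, y)) \<partial>sphere_measure)"

text \<open>
  As weak gradients are unique up to null sets, it does not matter which \<open>D\<rho>\<close> and \<open>DW\<close> are used.
  The conditions \<open>\<gamma> \<noteq> 0\<close> and integrability keep the conventions \<open>inverse 0 = 0\<close> and
  ``integral of a non-integrable function is 0'' out of the equation.
\<close>
definition weak_solution ::
  "('a::euclidean_space \<times> 'a \<Rightarrow> real) \<Rightarrow> real \<Rightarrow> ('a \<Rightarrow> real) \<Rightarrow> bool" where
  "weak_solution W \<gamma> \<rho> \<longleftrightarrow>
     \<gamma> \<noteq> 0 \<and>
     (AE x in sphere_measure. 0 \<le> \<rho> x) \<and> (\<integral>x. \<rho> x \<partial>sphere_measure) = 1 \<and>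
     (\<exists>D\<rho> DW. has_sphere_gradient \<rho> D\<rho> \<and> has_sphere_product_gradient W DW \<and>
        (\<forall>\<phi> D\<phi>. has_sphere_gradient \<phi> D\<phi> \<longrightarrow>
           integrable sphere_measure (\<lambda>x. (\<rho> x *\<^sub>R D\<phi> x) \<bullet> grad_conv DW \<rho> x) \<and>
           inverse \<gamma> * (\<integral>x. D\<rho> x \<bullet> D\<phi> x \<partial>sphere_measure)
             + (\<integral>x. (\<rho> x *\<^sub>R D\<phi> x) \<bullet> grad_conv DW \<rho> x \<partial>sphere_measure) = 0))"


section \<open>Gegenbauer polynomials and spherical harmonics\<close>

fun gegenbauer :: "nat \<Rightarrow> real \<Rightarrow> real \<Rightarrow> real" where
  "gegenbauer 0 l t = 1"
| "gegenbauer (Suc 0) l t = 2 * l * t"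
| "gegenbauer (Suc (Suc k)) l t =
     (2 * (l + real k + 1) * t * gegenbauer (Suc k) l t - (2 * l + real k) * gegenbauer k l t)
       / (real k + 2)"

text \<open>\<open>harmonic_coeff n w k\<close> is the coefficient of index \<open>k\<close> of the profile \<open>w\<close> on the unit sphere of
  an \<open>n\<close>-dimensional space.\<close>
definition harmonic_coeff :: "nat \<Rightarrow> (real \<Rightarrow> real) \<Rightarrow> nat \<Rightarrow> real" where
  "harmonic_coeff n w k =
     Gamma (real n / 2) / (sqrt pi * Gamma ((real n - 1) / 2)) *
     (LBINT t:{-1..1}. w t *
        (gegenbauer k ((real n - 2) / 2) t / gegenbauer k ((real n - 2) / 2) 1) *
        (1 - t\<^sup>2) powr ((real n - 3) / 2))"

text \<open>\<open>Y_zonal m k\<close> is \<open>Y\<^sub>k\<^sub>,\<^sub>0\<close> with the coordinate \<open>x $ m\<close> in the role of the last coordinate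
  \<open>x\<^sub>n\<close>; \<open>Y_const k\<close> is the normalising constant \<open>A\<^sub>k\<close>.\<close>
definition Y_const :: "'n::finite \<Rightarrow> nat \<Rightarrow> real" where
  "Y_const m k =
     1 / L2_norm (\<lambda>x::real^'n. gegenbauer k ((real CARD('n) - 2) / 2) (x $ m))"

definition Y_zonal :: "'n::finite \<Rightarrow> nat \<Rightarrow> real^'n \<Rightarrow> real" where
  "Y_zonal m k x = Y_const m k * gegenbauer k ((real CARD('n) - 2) / 2) (x $ m)"


section \<open>Non-trivial branches\<close>

text \<open>
  A branch is a continuous curve in \<open>L\<^sub>2\<close>. Since \<open>\<delta>\<close> can always be decreased, non-triviality is
  required of the restriction of the branch to every neighbourhood of \<open>t = 0\<close>. Functions are
  compared as elements of \<open>L\<^sub>2\<close>, i.e. almost everywhere.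
\<close>
definition nontrivial_branch ::
  "('a::euclidean_space \<times> 'a \<Rightarrow> real) \<Rightarrow> real \<Rightarrow> (real \<Rightarrow> real) \<Rightarrow> (real \<Rightarrow> 'a \<Rightarrow> real) \<Rightarrow> bool" where
  "nontrivial_branch W \<delta> \<gamma> \<rho> \<longleftrightarrow>
     (\<forall>t\<in>{-\<delta><..<\<delta>}. weak_solution W (\<gamma> t) (\<rho> t)) \<and>
     (\<forall>s\<in>{-\<delta><..<\<delta>}. ((\<lambda>t. L2_norm (\<lambda>x. \<rho> t x - \<rho> s x)) \<longlongrightarrow> 0) (at s)) \<and>
     (\<forall>\<epsilon>>0. \<exists>t\<in>{-\<delta><..<\<delta>}. \<bar>t\<bar> < \<epsilon> \<and> \<not> (AE x in sphere_measure. \<rho> t x = uniform_state x))"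

end

theory Submission
  imports Defs "HOL-Computational_Algebra.Polynomial"
begin

text \<open>
  A density of Gibbs form \<open>\<rho> = const * exp (- \<gamma> * (W * \<rho>))\<close> is a stationary state: its gradient is
  \<open>- \<gamma> \<rho> \<nabla>(W * \<rho>)\<close>, so the two terms of the weak equation cancel (\<open>weak_solution_gibbs\<close>). The branch is
  therefore found among the solutions of a fixed point equation for continuous functions, and the
  Sobolev space enters only at the end.

  The fixed point equation is solved among functions of the single coordinate \<open>x \<bullet> e\<close>. As \<open>W\<close> depends on
  \<open>x \<bullet> y\<close> only, convolution with \<open>W\<close> maps such functions to such functions, and there it has the
  Gegenbauer polynomials as eigenfunctions, one for each degree, with eigenvalue proportional to the
  coefficient of \<open>W\<close> of that index (\<open>funk_hecke\<close>). Hence the assumption that no other coefficient equals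
  the \<open>k\<close>-th one says precisely that the linearisation at the uniform state has a one-dimensional
  kernel at \<open>\<gamma> = - 1 / harmonic_coeff n w k\<close>, and a bifurcation theorem of Crandall--Rabinowitz type
  applies (\<open>bifurcation_from_simple_eigenvalue\<close>).

  Two devices keep the analysis elementary. First, the normalising constant of the Gibbs density is
  removed: let \<open>T\<close> be convolution with \<open>(c - w) / area\<close>, where \<open>c\<close> makes \<open>T 1 = 0\<close>. If
  \<open>1 + v = exp (\<lambda> T v)\<close> and \<open>1 + v\<close> has mean \<open>m\<close>, then \<open>(1 + v) / (area m)\<close> is a Gibbs density for the
  parameter \<open>\<gamma> = \<lambda> m\<close>. So it suffices to solve \<open>v = \<lambda> T v + (exp (\<lambda> T v) - 1 - \<lambda> T v)\<close>, whose nonlinear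
  part is quadratic. Secondly, the linearisation is inverted by approximation: a polynomial that
  is uniformly close to the profile \<open>w\<close> splits \<open>T\<close> into an operator of finite rank that is diagonal in
  the Gegenbauer polynomials and an operator of small norm, which a Neumann series inverts
  (\<open>simple_eigenvalue_pseudo_inverse\<close>, \<open>conv_op_poly_finite_rank\<close>).

  The geometry of the sphere is used through the invariance of the surface measure under orthogonal
  maps alone. It yields a two-term recursion for the moments of a coordinate; the moments of the weight
  \<open>(1 - t\<^sup>2) powr (l - 1 / 2)\<close> satisfy the same recursion, and the orthogonality of the Gegenbauer
  polynomials is an algebraic consequence of it.
\<close>

section \<open>Surface measure of the sphere and orthogonal maps\<close>

lemma lborel_distr_translation:
  "distr lborel borel (\<lambda>y. y + c) = (lborel :: 'a::euclidean_space measure)"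
  using lborel_affine[of 1 c] by (simp add: add.commute density_1 cong: distr_cong)

lemma nn_integral_lborel_translation:
  fixes f :: "'a::euclidean_space \<Rightarrow> ennreal"
  assumes [measurable]: "f \<in> borel_measurable borel"
  shows "(\<integral>\<^sup>+y. f (y + c) \<partial>lborel) = (\<integral>\<^sup>+y. f y \<partial>lborel)"
  by (subst (2) lborel_distr_translation[of c, symmetric]) (simp add: nn_integral_distr)

lemma nn_integral_lborel_reflection:
  fixes f :: "'a::euclidean_space \<Rightarrow> ennreal"
  assumes [measurable]: "f \<in> borel_measurable borel"
  shows "(\<integral>\<^sup>+y. f (c - y) \<partial>lborel) = (\<integral>\<^sup>+y. f y \<partial>lborel)"
proof -
  have "(lborel :: 'a measure) = distr lborel borel (\<lambda>x. c - x)"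
    using lborel_affine[of "-1" c] by (simp add: density_1 cong: distr_cong)
  then have "(\<integral>\<^sup>+y. f y \<partial>lborel) = (\<integral>\<^sup>+y. f y \<partial>distr lborel borel (\<lambda>x. c - x))"
    by simp
  also have "\<dots> = (\<integral>\<^sup>+y. f (c - y) \<partial>lborel)"
    by (rule nn_integral_distr) measurable
  finally show ?thesis by simp
qed

text \<open>
  An invariant measure is unique up to a factor: integrating \<open>1\<^sub>A(x) 1\<^sub>B(f y - x)\<close> in both orders, with \<open>B\<close>
  the unit ball, and using translation invariance gives
  \<open>vol A * vol (f -` B) = vol (f -` A) * vol B\<close>. As \<open>f\<close> preserves the ball, the factor is one.
\<close>
lemma lborel_distr_orthogonal_transformation:
  fixes f :: "'a::euclidean_space \<Rightarrow> 'a"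
  assumes f: "orthogonal_transformation f"
  shows "distr lborel borel f = (lborel :: 'a measure)"
proof (rule measure_eqI)
  have lin: "linear f" using f by (rule orthogonal_transformation_linear)
  then have [measurable]: "f \<in> borel_measurable borel"
    by (intro borel_measurable_continuous_onI linear_continuous_on linear_conv_bounded_linear[THEN iffD1])
  show "sets (distr lborel borel f) = sets (lborel :: 'a measure)" by simp
  fix A :: "'a set" assume "A \<in> sets (distr lborel borel f)"
  then have [measurable]: "A \<in> sets borel" by simp
  define B where "B = ball (0::'a) 1"
  have [measurable]: "B \<in> sets borel" by (simp add: B_def)
  have B_sym: "indicator B (a - b) = (indicator B (b - a) :: ennreal)" for a b :: 'a
    by (simp add: B_def indicator_def norm_minus_commute dist_norm)
  have inv: "(\<integral>\<^sup>+y. indicator S (f y - x) \<partial>lborel) = (\<integral>\<^sup>+y. indicator S (f y) \<partial>lborel)"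
    if [measurable]: "S \<in> sets borel" for S :: "'a set" and x
  proof -
    obtain z where z: "x = f z"
      using orthogonal_transformation_surj[OF f] by (metis surjD)
    have "(\<integral>\<^sup>+y. indicator S (f y - x) \<partial>lborel) = (\<integral>\<^sup>+y. indicator S (f (y + (- z))) \<partial>lborel)"
      using linear_diff[OF lin] by (simp add: z)
    also have "\<dots> = (\<integral>\<^sup>+y. indicator S (f y) \<partial>lborel)"
      by (rule nn_integral_lborel_translation) measurable
    finally show ?thesis .
  qed
  have "emeasure lborel A * (\<integral>\<^sup>+y. indicator B (f y) \<partial>lborel)
      = (\<integral>\<^sup>+x. indicator A x * (\<integral>\<^sup>+y. indicator B (f y - x) \<partial>lborel) \<partial>lborel)"
    by (simp add: inv nn_integral_multc)
  also have "\<dots> = (\<integral>\<^sup>+x. (\<integral>\<^sup>+y. indicator A x * indicator B (f y - x) \<partial>lborel) \<partial>lborel)"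
    by (simp add: nn_integral_cmult)
  also have "\<dots> = (\<integral>\<^sup>+y. (\<integral>\<^sup>+x. indicator A x * indicator B (f y - x) \<partial>lborel) \<partial>lborel)"
    by (rule lborel_pair.Fubini') measurable
  also have "\<dots> = (\<integral>\<^sup>+y. (\<integral>\<^sup>+x. indicator A (f y - x) * indicator B x \<partial>lborel) \<partial>lborel)"
  proof (rule nn_integral_cong)
    fix y
    show "(\<integral>\<^sup>+x. indicator A x * indicator B (f y - x) \<partial>lborel)
      = (\<integral>\<^sup>+x. indicator A (f y - x) * indicator B x \<partial>(lborel :: 'a measure))"
      using nn_integral_lborel_reflection[of "\<lambda>x. indicator A x * indicator B (f y - x)" "f y"] by simp
  qed
  also have "\<dots> = (\<integral>\<^sup>+x. (\<integral>\<^sup>+y. indicator A (f y - x) * indicator B x \<partial>lborel) \<partial>lborel)"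
    by (rule lborel_pair.Fubini') measurable
  also have "\<dots> = (\<integral>\<^sup>+x. (\<integral>\<^sup>+y. indicator A (f y - x) \<partial>lborel) * indicator B x \<partial>lborel)"
    by (simp add: nn_integral_multc)
  also have "\<dots> = (\<integral>\<^sup>+y. indicator A (f y) \<partial>lborel) * emeasure lborel B"
    by (simp add: inv nn_integral_cmult)
  also have "(\<lambda>y. indicator B (f y) :: ennreal) = indicator B"
    by (auto simp: B_def indicator_def orthogonal_transformation_norm[OF f])
  finally have "emeasure lborel A * emeasure lborel B
      = (\<integral>\<^sup>+y. indicator A (f y) \<partial>lborel) * emeasure lborel B"
    by simp
  moreover have "emeasure lborel B \<noteq> 0" "emeasure lborel B \<noteq> \<infinity>"
    using emeasure_lborel_ball_finite[of "0::'a" 1]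
    using unit_ball_vol_pos[of "real DIM('a)"]
    by (auto simp: B_def emeasure_ball ennreal_eq_0_iff simp del: unit_ball_vol_pos)
  ultimately have "emeasure lborel A = (\<integral>\<^sup>+y. indicator A (f y) \<partial>lborel)"
    by (metis ennreal_mult_cancel_left infinity_ennreal_def mult.commute)
  also have "\<dots> = emeasure (distr lborel borel f) A"
    by (subst nn_integral_distr[of f lborel borel "indicator A", symmetric]) auto
  finally show "emeasure (distr lborel borel f) A = emeasure lborel A" by simp
qed

lemma space_sphere_measure [simp]: "space sphere_measure = sphere 0 1"
  by (simp add: sphere_measure_def space_scale_measure space_restrict_space)

lemma sets_sphere_measure [simp, measurable_cong]:
  "sets (sphere_measure :: 'a::euclidean_space measure) = sets (restrict_space borel (sphere 0 1))"
  by (simp add: sphere_measure_def)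

lemma sgn_measurable_punctured_ball:
  "sgn \<in> restrict_space lborel (ball 0 1 - {0}) \<rightarrow>\<^sub>M
     restrict_space borel (sphere 0 (1::real) :: 'a::euclidean_space set)"
proof (rule measurable_restrict_space2)
  show "(sgn :: 'a \<Rightarrow> 'a) \<in> space (restrict_space lborel (ball 0 1 - {0})) \<rightarrow> sphere 0 1"
    by (auto simp: space_restrict_space norm_sgn)
  have "(\<lambda>x::'a. inverse (norm x) *\<^sub>R x) \<in> borel_measurable borel" by measurable
  then show "(sgn :: 'a \<Rightarrow> 'a) \<in> borel_measurable (restrict_space lborel (ball 0 1 - {0}))"
    by (intro measurable_restrict_space1) (simp add: sgn_div_norm[abs_def] divide_inverse)
qed

lemma nn_integral_sphere_measure:
  fixes f :: "'a::euclidean_space \<Rightarrow> ennreal"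
  assumes "f \<in> borel_measurable sphere_measure"
  shows "(\<integral>\<^sup>+x. f x \<partial>sphere_measure)
    = of_nat DIM('a) * (\<integral>\<^sup>+x. f (sgn x) * indicator (ball 0 1 - {0}) x \<partial>lborel)"
proof -
  have f: "f \<in> borel_measurable (restrict_space borel (sphere 0 1))"
    using assms by (simp cong: measurable_cong_sets)
  have "(\<integral>\<^sup>+x. f x \<partial>sphere_measure) = of_nat DIM('a) * (\<integral>\<^sup>+x. f (sgn x) \<partial>restrict_space lborel (ball 0 1 - {0}))"
    unfolding sphere_measure_def
    by (subst nn_integral_scale_measure)
       (simp_all add: f nn_integral_distr sgn_measurable_punctured_ball)
  then show ?thesis
    by (simp add: nn_integral_restrict_space)
qed

lemma emeasure_sphere_measure_sphere:
  "emeasure (sphere_measure :: 'a::euclidean_space measure) (sphere 0 1)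
     = of_nat DIM('a) * emeasure lborel (ball (0::'a) 1)"
proof -
  have "emeasure (sphere_measure :: 'a measure) (sphere 0 1)
     = (\<integral>\<^sup>+x. indicator (sphere 0 1) x \<partial>(sphere_measure :: 'a measure))"
    using sets.top[of "sphere_measure :: 'a measure"] by simp
  also have "\<dots> = (\<integral>\<^sup>+x. 1 \<partial>(sphere_measure :: 'a measure))"
    by (rule nn_integral_cong) simp
  also have "\<dots> = of_nat DIM('a) * emeasure lborel (ball 0 1 - {0::'a})"
    by (subst nn_integral_sphere_measure) auto
  also have "emeasure lborel (ball 0 1 - {0::'a}) = emeasure lborel (ball (0::'a) 1)"
    by (rule emeasure_Diff_null_set) auto
  finally show ?thesis .
qed

lemma emeasure_sphere_finite: "emeasure (sphere_measure :: 'a::euclidean_space measure) (sphere 0 1) < \<infinity>"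
  using emeasure_lborel_ball_finite[of "0::'a" 1]
  by (auto simp: emeasure_sphere_measure_sphere ennreal_mult_less_top of_nat_less_top)

lemma finite_measure_sphere_measure: "finite_measure (sphere_measure :: 'a::euclidean_space measure)"
  using emeasure_sphere_finite[where 'a='a] by (intro finite_measureI) (simp add: less_top[symmetric])

interpretation sphere_measure: finite_measure "sphere_measure :: 'a::euclidean_space measure"
  by (rule finite_measure_sphere_measure)

interpretation sphere_pair: pair_sigma_finite
  "sphere_measure :: 'a::euclidean_space measure" "sphere_measure :: 'b::euclidean_space measure"
  ..

lemma sphere_area_pos: "sphere_area TYPE('a::euclidean_space) > 0"
proof -
  have "measure lborel (ball (0::'a) 1) > 0"
    by (simp add: content_ball_pos)
  then show ?thesis
    by (simp add: sphere_area_def measure_def emeasure_sphere_measure_sphere enn2real_mult)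
qed

lemma orthogonal_transformation_measurable_sphere:
  assumes "orthogonal_transformation (f :: 'a::euclidean_space \<Rightarrow> 'a)"
  shows "f \<in> sphere_measure \<rightarrow>\<^sub>M sphere_measure"
proof -
  have "f \<in> borel_measurable borel"
    by (intro borel_measurable_continuous_onI linear_continuous_on
        linear_conv_bounded_linear[THEN iffD1] orthogonal_transformation_linear[OF assms])
  then have "f \<in> restrict_space borel (sphere 0 1) \<rightarrow>\<^sub>M restrict_space borel (sphere 0 1)"
    by (intro measurable_restrict_space3) (auto simp: orthogonal_transformation_norm[OF assms])
  then show ?thesis by (simp cong: measurable_cong_sets)
qed

text \<open>
  An orthogonal map commutes with the radial projection and preserves the punctured ball.
\<close>
lemma distr_sphere_measure_orthogonal:
  fixes f :: "'a::euclidean_space \<Rightarrow> 'a"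
  assumes f: "orthogonal_transformation f"
  shows "distr sphere_measure sphere_measure f = sphere_measure"
proof (rule measure_eqI)
  show "sets (distr sphere_measure sphere_measure f) = sets sphere_measure" by simp
  note mf = orthogonal_transformation_measurable_sphere[OF f]
  note [measurable] = mf
  have [measurable]: "f \<in> borel_measurable borel"
    by (intro borel_measurable_continuous_onI linear_continuous_on
        linear_conv_bounded_linear[THEN iffD1] orthogonal_transformation_linear[OF f])
  fix A :: "'a set" assume "A \<in> sets (distr sphere_measure sphere_measure f)"
  then have A: "A \<in> sets sphere_measure" by simp
  then have Ab [measurable]: "A \<in> sets borel"
    by (auto simp: sets_restrict_space)
  have ms: "(sgn :: 'a \<Rightarrow> 'a) \<in> borel_measurable borel"
  proof -
    have "(\<lambda>x::'a. inverse (norm x) *\<^sub>R x) \<in> borel_measurable borel" by measurable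
    then show ?thesis by (simp add: sgn_div_norm[abs_def] divide_inverse)
  qed
  note [measurable] = this
  have sgn: "f (sgn x) = sgn (f x)" for x
    using orthogonal_transformation_norm[OF f] orthogonal_transformation_scaleR[OF f]
    by (simp add: sgn_div_norm)
  have *: "indicator (ball 0 1 - {0}) x = (indicator (ball 0 1 - {0}) (f x) :: ennreal)" for x
  proof -
    have "norm (f x) = norm x" by (rule orthogonal_transformation_norm[OF f])
    moreover from this have "f x = 0 \<longleftrightarrow> x = 0" by (metis norm_eq_zero)
    ultimately show ?thesis by (auto simp: indicator_def)
  qed
  have "emeasure (distr sphere_measure sphere_measure f) A
    = (\<integral>\<^sup>+x. indicator A (f x) \<partial>sphere_measure)"
    using A by (subst nn_integral_distr[of f sphere_measure sphere_measure "indicator A", symmetric])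
       (simp_all add: mf)
  also have "\<dots> = of_nat DIM('a) * (\<integral>\<^sup>+x. indicator A (sgn (f x)) * indicator (ball 0 1 - {0}) (f x) \<partial>lborel)"
    by (subst nn_integral_sphere_measure)
       (simp_all add: sgn *[symmetric] measurable_compose[OF mf borel_measurable_indicator[OF A]])
  also have "(\<integral>\<^sup>+x. indicator A (sgn (f x)) * indicator (ball 0 1 - {0}) (f x) \<partial>lborel)
     = (\<integral>\<^sup>+x. indicator A (sgn x) * indicator (ball 0 1 - {0}) x \<partial>lborel)"
  proof -
    have "{x \<in> space borel. sgn x \<in> A} \<in> sets (borel :: 'a measure)"
      by measurable
    then have "(\<lambda>x::'a. indicator A (sgn x) :: ennreal) \<in> borel_measurable borel"
      by measurable
    then have m: "(\<lambda>x. indicator A (sgn x) * indicator (ball 0 1 - {0}) x :: ennreal) \<in> borel_measurable lborel"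
      by (simp add: borel_measurable_times_ennreal borel_measurable_indicator)
    have f': "f \<in> lborel \<rightarrow>\<^sub>M borel" by simp
    show ?thesis
      using nn_integral_distr[OF f', of "\<lambda>x. indicator A (sgn x) * indicator (ball 0 1 - {0}) x"] m
      by (simp add: lborel_distr_orthogonal_transformation[OF f])
  qed
  also have "of_nat DIM('a) * \<dots> = emeasure sphere_measure A"
    using nn_integral_sphere_measure[of "indicator A"] A by simp
  finally show "emeasure (distr sphere_measure sphere_measure f) A = emeasure sphere_measure A" .
qed

lemma integral_sphere_orthogonal:
  fixes f :: "'a::euclidean_space \<Rightarrow> 'a" and g :: "'a \<Rightarrow> real"
  assumes f: "orthogonal_transformation f" and g: "g \<in> borel_measurable sphere_measure"
  shows "(\<integral>x. g (f x) \<partial>sphere_measure) = (\<integral>x. g x \<partial>sphere_measure)"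
  by (subst (2) distr_sphere_measure_orthogonal[OF f, symmetric])
     (simp add: integral_distr[OF orthogonal_transformation_measurable_sphere[OF f] g])

lemma borel_measurable_sphere_continuous:
  fixes g :: "'a::euclidean_space \<Rightarrow> 'b::{second_countable_topology, real_normed_vector}"
  assumes "continuous_on (sphere 0 1) g"
  shows "g \<in> borel_measurable sphere_measure"
  using borel_measurable_continuous_on_restrict[OF assms] by (simp cong: measurable_cong_sets)

lemma integrable_sphere_bounded:
  fixes g :: "'a::euclidean_space \<Rightarrow> 'b::{second_countable_topology, banach}"
  assumes "g \<in> borel_measurable sphere_measure" "\<And>x. x \<in> sphere 0 1 \<Longrightarrow> norm (g x) \<le> B"
  shows "integrable sphere_measure g"
  using assms by (intro sphere_measure.integrable_const_bound[where B=B]) auto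

lemma continuous_on_sphere_bounded:
  fixes g :: "'a::euclidean_space \<Rightarrow> 'b::real_normed_vector"
  assumes "continuous_on (sphere 0 1) g"
  obtains B where "\<forall>x\<in>sphere 0 1. norm (g x) \<le> B"
proof -
  have "bounded (g ` sphere 0 1)"
    using assms by (intro compact_imp_bounded compact_continuous_image) auto
  with that show ?thesis unfolding bounded_iff by blast
qed

lemma integrable_sphere_continuous:
  fixes g :: "'a::euclidean_space \<Rightarrow> 'b::{second_countable_topology, banach}"
  assumes "continuous_on (sphere 0 1) g"
  shows "integrable sphere_measure g"
proof -
  obtain B where "\<forall>x\<in>sphere 0 1. norm (g x) \<le> B"
    by (rule continuous_on_sphere_bounded[OF assms])
  then show ?thesis
    using borel_measurable_sphere_continuous[OF assms] by (intro integrable_sphere_bounded[where B=B]) auto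
qed

section \<open>Moments of coordinates on the sphere\<close>

text \<open>
  The reflection in the hyperplane orthogonal to \<open>x - y\<close>. All uses of the
  invariance below rest on such reflections.
\<close>
lemma reflection_swapping:
  fixes x y :: "'a::euclidean_space"
  assumes "norm x = norm y"
  obtains f where "orthogonal_transformation f" "f x = y" "f y = x"
    "\<And>z. z \<bullet> x = z \<bullet> y \<Longrightarrow> f z = z"
proof (cases "x = y")
  case True
  show ?thesis using True by (intro that[of "\<lambda>x. x"]) auto
next
  case False
  define v where "v = x - y"
  have v: "v \<bullet> v \<noteq> 0" using False by (simp add: v_def)
  define f where "f z = z - (2 * (z \<bullet> v) / (v \<bullet> v)) *\<^sub>R v" for z
  have xy: "x \<bullet> x = y \<bullet> y" using assms by (simp add: norm_eq)
  have "linear f"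
    by (rule linearI) (simp_all add: f_def algebra_simps add_divide_distrib)
  moreover have "f a \<bullet> f b = a \<bullet> b" for a b
    using v by (simp add: f_def inner_diff_left inner_diff_right inner_commute field_simps)
  ultimately have "orthogonal_transformation f"
    by (auto simp: orthogonal_transformation_def)
  moreover have vv: "v \<bullet> v = 2 * (x \<bullet> v)" "v \<bullet> v = - 2 * (y \<bullet> v)"
    using xy by (simp_all add: v_def inner_diff_left inner_diff_right inner_commute)
  have "2 * (x \<bullet> v) / (v \<bullet> v) = 1" "2 * (y \<bullet> v) / (v \<bullet> v) = - 1"
    using v vv by (auto simp: divide_eq_eq)
  then have "f x = y" "f y = x"
    unfolding f_def by (simp_all only:) (simp_all add: v_def)
  moreover have "f z = z" if "z \<bullet> x = z \<bullet> y" for z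
    using that by (simp add: f_def v_def inner_diff_right)
  ultimately show ?thesis by (rule that)
qed

lemma reflection_along_unit:
  fixes d :: "'a::euclidean_space"
  assumes "norm d = 1"
  obtains f where "orthogonal_transformation f" "\<And>z. f z \<bullet> d = - (z \<bullet> d)"
    "\<And>z e. e \<bullet> d = 0 \<Longrightarrow> f z \<bullet> e = z \<bullet> e"
proof -
  obtain f where f: "orthogonal_transformation f" "f d = - d" "f (- d) = d"
     "\<And>z. z \<bullet> d = z \<bullet> (- d) \<Longrightarrow> f z = z"
    using reflection_swapping[of d "- d"] by auto
  have inner: "f a \<bullet> f b = a \<bullet> b" for a b using f(1) by (auto simp: orthogonal_transformation_def)
  show ?thesis
  proof (rule that[OF f(1)])
    show "f z \<bullet> d = - (z \<bullet> d)" for z using inner[of z "- d"] by (simp add: f(3))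
    show "f z \<bullet> e = z \<bullet> e" if "e \<bullet> d = 0" for z e
      using inner[of z e] f(4)[of e] that by simp
  qed
qed

lemma integral_sphere_inner_unit:
  fixes u v :: "'a::euclidean_space" and g :: "real \<Rightarrow> real"
  assumes "norm u = 1" "norm v = 1" and g: "continuous_on {-1..1} g"
  shows "(\<integral>x. g (x \<bullet> u) \<partial>sphere_measure) = (\<integral>x. g (x \<bullet> v) \<partial>sphere_measure)"
proof -
  obtain f where f: "orthogonal_transformation f" "f v = u"
    using reflection_swapping[of v u] assms by metis
  have "x \<bullet> u \<in> {-1..1}" if "norm x = 1" for x
    using Cauchy_Schwarz_ineq2[of x u] that assms by auto
  then have "continuous_on (sphere 0 1) (\<lambda>x. g (x \<bullet> u))"
    by (intro continuous_on_compose2[OF g]) (auto intro!: continuous_intros)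
  then have "(\<lambda>x. g (x \<bullet> u)) \<in> borel_measurable sphere_measure"
    by (rule borel_measurable_sphere_continuous)
  note integral_sphere_orthogonal[OF f(1) this]
  moreover have "f x \<bullet> u = x \<bullet> v" for x
    using f by (metis orthogonal_transformation_def)
  ultimately show ?thesis by simp
qed

definition sphere_moment :: "'a::euclidean_space \<Rightarrow> 'a \<Rightarrow> nat \<Rightarrow> nat \<Rightarrow> real" where
  "sphere_moment e d a b = (\<integral>x. (x \<bullet> e) ^ a * (x \<bullet> d) ^ b \<partial>sphere_measure)"

lemma integrable_sphere_moment:
  "integrable sphere_measure (\<lambda>x. (x \<bullet> e) ^ a * (x \<bullet> d) ^ b)"
  by (intro integrable_sphere_continuous continuous_intros)

text \<open>
  The reflection \<open>d \<mapsto> - d\<close> changes the sign of the integrand.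
\<close>
lemma sphere_moment_odd:
  assumes "norm d = 1" "e \<bullet> d = 0" "odd b"
  shows "(\<integral>x. g (x \<bullet> e) * (x \<bullet> d) ^ b \<partial>sphere_measure) = 0"
proof (cases "integrable sphere_measure (\<lambda>x. g (x \<bullet> e) * (x \<bullet> d) ^ b)")
  case True
  obtain f where f: "orthogonal_transformation f" "\<And>z. f z \<bullet> d = - (z \<bullet> d)"
    "\<And>z. f z \<bullet> e = z \<bullet> e"
    using reflection_along_unit[OF assms(1)] assms(2) by metis
  show ?thesis
    using integral_sphere_orthogonal[OF f(1), of "\<lambda>x. g (x \<bullet> e) * (x \<bullet> d) ^ b"] True assms(3)
    by (simp add: f)
qed (simp add: not_integrable_integral_eq)

lemma zonal_moment_odd:
  assumes "norm (e::'a::euclidean_space) = 1" "odd a"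
  shows "(\<integral>x. (x \<bullet> e) ^ a \<partial>sphere_measure) = 0"
  using sphere_moment_odd[of e 0 a "\<lambda>_. 1"] assms by simp

lemma coeff_2_power: "coeff ([:1, 0, 1::real:] ^ j) 2 = real j"
proof (induction j)
  case (Suc j)
  have "coeff ([:1, 0, 1::real:] ^ j) 0 = 1"
    by (simp add: poly_0_coeff_0[symmetric] poly_power)
  with Suc show ?case by (simp add: numeral_2_eq_2)
qed simp

text \<open>
  By invariance the integral of \<open>(x \<bullet> e + b (x \<bullet> d)) ^ (2 i + 2)\<close> is \<open>(1 + b\<^sup>2) ^ (i + 1)\<close> times that for \<open>b = 0\<close>, because
  \<open>e + b d\<close> is a multiple of a unit vector. Both sides are polynomials in \<open>b\<close>; the claim compares the
  coefficients of \<open>b\<^sup>2\<close>.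
\<close>
lemma sphere_moment_2:
  fixes e d :: "'a::euclidean_space"
  assumes "norm e = 1" "norm d = 1" "e \<bullet> d = 0"
  shows "real (2 * i + 1) * sphere_moment e d (2 * i) 2 = (\<integral>x. (x \<bullet> e) ^ (2 * i + 2) \<partial>sphere_measure)"
proof -
  define q where "q = 2 * i + 2"
  define I where "I = (\<integral>x. (x \<bullet> e) ^ q \<partial>sphere_measure)"
  define P where "P = (\<Sum>l\<le>q. monom (real (q choose l) * sphere_moment e d (q - l) l) l)"
  have "poly P b = poly (smult I ([:1, 0, 1:] ^ (i + 1))) b" for b
  proof -
    have n: "norm (e + b *\<^sub>R d) = sqrt (1 + b\<^sup>2)"
    proof -
      have "(e + b *\<^sub>R d) \<bullet> (e + b *\<^sub>R d) = 1 + b\<^sup>2"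
        using assms by (simp add: inner_add_left inner_add_right inner_commute norm_eq_1 power2_eq_square)
      then show ?thesis by (simp add: norm_eq_sqrt_inner)
    qed
    define u where "u = (1 / sqrt (1 + b\<^sup>2)) *\<^sub>R (e + b *\<^sub>R d)"
    have pos: "1 + b\<^sup>2 > 0" by (simp add: add_pos_nonneg)
    have nu: "norm u = 1" using n pos by (simp add: u_def del: real_sqrt_eq_1_iff)
    have eq: "x \<bullet> e + b * (x \<bullet> d) = sqrt (1 + b\<^sup>2) * (x \<bullet> u)" for x
      using pos by (simp add: u_def inner_add_right)
    have "poly P b = (\<Sum>l\<le>q. \<integral>x. real (q choose l) * ((x \<bullet> e) ^ (q - l) * (x \<bullet> d) ^ l) * b ^ l \<partial>sphere_measure)"
      by (simp add: P_def poly_sum poly_monom sphere_moment_def)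
    also have "\<dots> = (\<integral>x. (\<Sum>l\<le>q. real (q choose l) * ((x \<bullet> e) ^ (q - l) * (x \<bullet> d) ^ l) * b ^ l) \<partial>sphere_measure)"
      by (subst Bochner_Integration.integral_sum) (auto intro: integrable_sphere_moment)
    also have "(\<lambda>x. \<Sum>l\<le>q. real (q choose l) * ((x \<bullet> e) ^ (q - l) * (x \<bullet> d) ^ l) * b ^ l)
       = (\<lambda>x. (b * (x \<bullet> d) + (x \<bullet> e)) ^ q)"
      by (subst binomial_ring) (simp add: power_mult_distrib mult_ac)
    also have "\<dots> = (\<lambda>x. (1 + b\<^sup>2) ^ (i + 1) * (x \<bullet> u) ^ q)"
    proof
      fix x
      have "(b * (x \<bullet> d) + (x \<bullet> e)) ^ q = (sqrt (1 + b\<^sup>2)) ^ q * (x \<bullet> u) ^ q"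
        using eq[of x] by (simp add: add.commute power_mult_distrib)
      also have "(sqrt (1 + b\<^sup>2)) ^ q = (1 + b\<^sup>2) ^ (i + 1)"
        using pos by (simp add: q_def power_mult[of _ 2 "Suc i", simplified])
      finally show "(b * (x \<bullet> d) + (x \<bullet> e)) ^ q = (1 + b\<^sup>2) ^ (i + 1) * (x \<bullet> u) ^ q" .
    qed
    also have "(\<integral>x. (1 + b\<^sup>2) ^ (i + 1) * (x \<bullet> u) ^ q \<partial>sphere_measure) = (1 + b\<^sup>2) ^ (i + 1) * I"
      unfolding I_def using integral_sphere_inner_unit[OF nu assms(1), of "\<lambda>t. t ^ q"]
      by (simp add: continuous_intros)
    finally show ?thesis by (simp add: power2_eq_square mult_ac del: power_Suc)
  qed
  then have "P = smult I ([:1, 0, 1:] ^ (i + 1))"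
    by (simp add: poly_eq_poly_eq_iff[symmetric] fun_eq_iff)
  then have "coeff P 2 = I * real (i + 1)"
    by (simp only: coeff_smult coeff_2_power)
  moreover have "coeff P 2 = real (q choose 2) * sphere_moment e d (2 * i) 2"
  proof -
    have "2 \<le> q" "q - 2 = 2 * i" by (simp_all add: q_def)
    then show ?thesis by (simp add: P_def coeff_sum coeff_monom)
  qed
  moreover have "real (q choose 2) = real (i + 1) * real (2 * i + 1)"
    by (simp add: q_def choose_two algebra_simps)
  ultimately have "real (i + 1) * (real (2 * i + 1) * sphere_moment e d (2 * i) 2) = real (i + 1) * I"
    by (simp add: mult_ac)
  then show ?thesis by (simp add: I_def q_def)
qed

text \<open>
  Multiply \<open>(x \<bullet> e) ^ p\<close> by \<open>1 = (\<Sum>d\<in>Basis. (x \<bullet> d)\<^sup>2)\<close> and express each mixed moment by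
  \<open>sphere_moment_2\<close>.
\<close>
lemma zonal_moment_rec:
  fixes e :: "'a::euclidean_space"
  assumes e: "e \<in> Basis"
  shows "real (p + DIM('a)) * (\<integral>x. (x \<bullet> e) ^ (p + 2) \<partial>sphere_measure)
       = real (p + 1) * (\<integral>x. (x \<bullet> e) ^ p \<partial>sphere_measure)"
proof (cases "even p")
  case False
  then show ?thesis
    using zonal_moment_odd[of e p] zonal_moment_odd[of e "p + 2"] e by (simp del: power_add power_Suc)
next
  case True
  then obtain i where i: "p = 2 * i" by (elim evenE)
  let ?I = "\<lambda>p. \<integral>x. (x \<bullet> e) ^ p \<partial>sphere_measure"
  have "real (p + 1) * ?I p = real (p + 1) * (\<integral>x. (\<Sum>d\<in>Basis. (x \<bullet> e) ^ p * (x \<bullet> d) ^ 2) \<partial>sphere_measure)"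
  proof -
    have "?I p = (\<integral>x. (\<Sum>d\<in>Basis. (x \<bullet> e) ^ p * (x \<bullet> d) ^ 2) \<partial>sphere_measure)"
    proof (rule Bochner_Integration.integral_cong[OF refl])
      fix x :: 'a assume "x \<in> space sphere_measure"
      then have "(\<Sum>d\<in>Basis. (x \<bullet> d) ^ 2) = 1"
        using euclidean_inner[of x x] by (simp add: power2_eq_square norm_eq_1)
      then show "(x \<bullet> e) ^ p = (\<Sum>d\<in>Basis. (x \<bullet> e) ^ p * (x \<bullet> d) ^ 2)"
        by (simp add: sum_distrib_left[symmetric])
    qed
    then show ?thesis by simp
  qed
  also have "\<dots> = (\<Sum>d\<in>Basis. real (p + 1) * sphere_moment e d p 2)"
    by (subst Bochner_Integration.integral_sum)
       (auto intro: integrable_sphere_moment simp: sphere_moment_def sum_distrib_left)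
  also have "\<dots> = real (p + 1) * ?I (p + 2) + (\<Sum>d\<in>Basis - {e}. real (p + 1) * sphere_moment e d p 2)"
    by (subst sum.remove[OF finite_Basis e]) (simp add: sphere_moment_def power_add power2_eq_square mult_ac)
  also have "(\<Sum>d\<in>Basis - {e}. real (p + 1) * sphere_moment e d p 2) = (\<Sum>d\<in>Basis - {e}. ?I (p + 2))"
    using e by (intro sum.cong refl) (simp only: i, rule sphere_moment_2, auto simp: inner_Basis)
  also have "\<dots> = real (DIM('a) - 1) * ?I (p + 2)"
    using e by (simp add: card_Diff_singleton)
  also have "real (DIM('a) - 1) = real DIM('a) - 1"
    using DIM_positive[where 'a='a] by (simp add: of_nat_diff Suc_leI)
  finally show ?thesis by (simp add: algebra_simps)
qed

section \<open>Orthogonality of Gegenbauer polynomials\<close>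

text \<open>
  The Gegenbauer polynomials as formal polynomials, which have degrees and coefficients.
\<close>
fun gegenbauer_poly :: "nat \<Rightarrow> real \<Rightarrow> real poly" where
  "gegenbauer_poly 0 l = 1"
| "gegenbauer_poly (Suc 0) l = [:0, 2 * l:]"
| "gegenbauer_poly (Suc (Suc k)) l =
     smult (1 / (real k + 2)) (smult (2 * (l + real k + 1)) (pCons 0 (gegenbauer_poly (Suc k) l))
       - smult (2 * l + real k) (gegenbauer_poly k l))"

lemma poly_gegenbauer_poly: "poly (gegenbauer_poly k l) t = gegenbauer k l t"
  by (induction k l rule: gegenbauer_poly.induct) (auto simp: field_simps)

lemma degree_gegenbauer_poly: "degree (gegenbauer_poly k l) \<le> k"
proof (induction k l rule: gegenbauer_poly.induct)
  case (3 k l)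
  have "degree (pCons 0 (gegenbauer_poly (Suc k) l)) \<le> Suc (Suc k)"
    using 3(1) by (meson degree_pCons_le le_trans Suc_le_mono)
  then show ?case
    using 3(2) by (auto intro!: degree_diff_le order.trans[OF degree_smult_le])
qed auto

lemma lead_coeff_gegenbauer_poly:
  assumes "l > 0"
  shows "coeff (gegenbauer_poly k l) k > 0"
  using assms
proof (induction k l rule: gegenbauer_poly.induct)
  case (3 k l)
  have "coeff (gegenbauer_poly k l) (Suc (Suc k)) = 0"
    by (rule coeff_eq_0) (use degree_gegenbauer_poly[of k l] in simp)
  moreover have "coeff (gegenbauer_poly (Suc k) l) (Suc k) > 0" using 3 by simp
  ultimately show ?case using 3(3) by (simp add: divide_simps add_pos_nonneg)
qed auto

lemma gegenbauer_1_rec: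
  "real (k + 1) * gegenbauer (Suc k) l 1 = (2 * l + real k) * gegenbauer k l 1"
proof (induction k)
  case (Suc k)
  define a b c where "a = gegenbauer k l 1" and "b = gegenbauer (Suc k) l 1"
    and "c = gegenbauer (Suc (Suc k)) l 1"
  have "(real k + 2) * c = 2 * (l + real k + 1) * b - (2 * l + real k) * a"
    by (simp add: a_def b_def c_def)
  also have "(2 * l + real k) * a = real (k + 1) * b"
    using Suc by (simp only: a_def b_def)
  finally have "real (Suc k + 1) * c = (2 * l + real (Suc k)) * b"
    by (simp add: algebra_simps)
  then show ?case by (simp only: b_def c_def)
qed simp

lemma gegenbauer_1_pos: "l > 0 \<Longrightarrow> gegenbauer k l 1 > 0"
proof (induction k)
  case (Suc k)
  have "real (k + 1) * gegenbauer (Suc k) l 1 > 0"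
    unfolding gegenbauer_1_rec using Suc by (simp add: add_pos_nonneg)
  then show ?case by (simp add: zero_less_mult_iff)
qed auto

text \<open>
  Integration over the sphere of functions of one coordinate, and integration over the interval against
  \<open>(1 - t\<^sup>2) powr (l - 1 / 2)\<close>, are both functionals of this kind. The orthogonality theory
  below derives everything from the recursion of the moments.
\<close>
locale gegenbauer_functional =
  fixes l :: real and L :: "real poly \<Rightarrow> real"
  assumes l_pos: "l > 0"
    and L_add: "L (p + q) = L p + L q"
    and L_smult: "L (smult c p) = c * L p"
    and L_odd: "odd a \<Longrightarrow> L (monom 1 a) = 0"
    and L_rec: "(real a + 2 * l + 2) * L (monom 1 (a + 2)) = (real a + 1) * L (monom 1 a)"
    and L_1: "L 1 > 0"
begin

abbreviation "C k \<equiv> gegenbauer_poly k l"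

lemma L_0 [simp]: "L 0 = 0" using L_smult[of 0 0] by simp

lemma L_diff: "L (p - q) = L p - L q"
  using L_add[of p "smult (-1) q"] L_smult[of "-1" q] by simp

lemma L_sum: "L (\<Sum>i\<in>A. f i) = (\<Sum>i\<in>A. L (f i))"
  by (induction A rule: infinite_finite_induct) (auto simp: L_add)

definition M where "M k j = L (C k * monom 1 j)"

lemma M_rec: "(real k + 2) * M (Suc (Suc k)) j = 2 * (l + real k + 1) * M (Suc k) (Suc j) - (2 * l + real k) * M k j"
proof -
  have "pCons 0 (C (Suc k)) * monom 1 j = C (Suc k) * monom 1 (Suc j)"
    by (simp add: monom_Suc)
  then have "C (Suc (Suc k)) * monom 1 j = smult (1 / (real k + 2))
      (smult (2 * (l + real k + 1)) (C (Suc k) * monom 1 (Suc j)) - smult (2 * l + real k) (C k * monom 1 j))"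
    by (simp only: gegenbauer_poly.simps mult_smult_left left_diff_distrib)
  then have "M (Suc (Suc k)) j
      = 1 / (real k + 2) * (2 * (l + real k + 1) * M (Suc k) (Suc j) - (2 * l + real k) * M k j)"
    unfolding M_def by (simp only: L_smult L_diff)
  then show ?thesis by simp
qed

text \<open>
  The numbers \<open>M k j\<close> are moments of \<open>C k\<close>. They vanish unless \<open>j = k + 2 i\<close>, and then they have a closed form
  as a product, as Rodrigues' formula would show. The last two conjuncts are the quotients of this
  closed form for consecutive \<open>i\<close> and for consecutive \<open>k\<close>; together they pass from \<open>k\<close> to \<open>k + 1\<close> by the
  recursion of the polynomials.
\<close>
lemma M_ratios:
  "(\<forall>j. j < k \<or> odd (j + k) \<longrightarrow> M k j = 0) \<and> (\<forall>j. j < Suc k \<or> odd (j + Suc k) \<longrightarrow> M (Suc k) j = 0) \<and>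
   (\<forall>i. M k (k + 2 * i + 2) * (2 * real i + 2) * (2 * real i + 2 * l + 2 * real k + 2)
      = (real k + 2 * real i + 2) * (real k + 2 * real i + 1) * M k (k + 2 * i)) \<and>
   (\<forall>i. M (Suc k) (Suc k + 2 * i) * (real k + 1) * 2 * (real i + real k + l + 1)
      = M k (k + 2 * i) * (2 * l + real k) * (real k + 1 + 2 * real i))"
proof (induction k)
  case 0
  have M0: "M 0 j = L (monom 1 j)" for j by (simp add: M_def)
  have "C (Suc 0) * monom 1 j = smult (2 * l) (monom 1 (Suc j))" for j
    by (simp add: monom_Suc)
  then have M1: "M (Suc 0) j = 2 * l * L (monom 1 (Suc j))" for j
    by (simp add: M_def L_smult)
  have rec: "L (monom 1 (Suc (Suc (2 * i)))) * (2 * real i + 2 * l + 2) = (2 * real i + 1) * L (monom 1 (2 * i))" for i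
    using L_rec[of "2 * i"] by (simp add: mult_ac)
  show ?case
  proof (intro conjI allI impI)
    fix i
    show "M 0 (0 + 2 * i + 2) * (2 * real i + 2) * (2 * real i + 2 * l + 2 * real 0 + 2)
      = (real 0 + 2 * real i + 2) * (real 0 + 2 * real i + 1) * M 0 (0 + 2 * i)"
      using rec[of i] by (simp add: M0 mult.assoc)
    show "M (Suc 0) (Suc 0 + 2 * i) * (real 0 + 1) * 2 * (real i + real 0 + l + 1)
      = M 0 (0 + 2 * i) * (2 * l + real 0) * (real 0 + 1 + 2 * real i)"
      using rec[of i] by (simp add: M0 M1) (simp add: algebra_simps)
  qed (auto simp: M0 M1 L_odd)
next
  case (Suc k)
  define A where "A i = M k (k + 2 * i)" for i
  define B where "B i = M (Suc k) (Suc k + 2 * i)" for i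
  define D where "D i = M (Suc (Suc k)) (Suc (Suc k) + 2 * i)" for i
  have Z0: "j < k \<or> odd (j + k) \<Longrightarrow> M k j = 0" for j using Suc by blast
  have Z1: "j < Suc k \<or> odd (j + Suc k) \<Longrightarrow> M (Suc k) j = 0" for j using Suc by blast
  have a: "A (i + 1) * (2 * real i + 2) * (2 * real i + 2 * l + 2 * real k + 2)
      = (real k + 2 * real i + 2) * (real k + 2 * real i + 1) * A i" for i
    using Suc by (simp add: A_def)
  have b: "B i * (real k + 1) * 2 * (real i + real k + l + 1)
      = A i * (2 * l + real k) * (real k + 1 + 2 * real i)" for i
    using Suc by (simp add: A_def B_def)
  have r: "(real k + 2) * D i = 2 * (l + real k + 1) * B (i + 1) - (2 * l + real k) * A (i + 1)" for i
    using M_rec[of k "Suc (Suc k) + 2 * i"] by (simp add: A_def B_def D_def)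
  have pos: "real i + real k + l + 1 > 0" "2 * real i + 2 * l + 2 * real k + 2 > 0" "real k + 1 > 0"
     "real i + real k + l + 2 > 0" "2 * real i + 2 > 0" "real k + 2 * real i + 2 > 0"
     "real k + 2 * real i + 1 > 0" "real k + 2 > 0" for i using l_pos by auto
  \<comment> \<open>Writing \<open>A i\<close> and \<open>A (i + 1)\<close> as polynomial multiples of one number \<open>x\<close> leaves denominators
    in \<open>k\<close> and \<open>i + l + k + 2\<close> only, which \<open>algebra\<close> can handle after they are cleared.\<close>
  have ex: "\<exists>x. A i = x * (real i + 1) * (real i + l + real k + 1) * 4 \<and>
     A (i + 1) = x * (real k + 2 * real i + 2) * (real k + 2 * real i + 1)" for i
  proof (intro exI conjI)
    let ?x = "A i / ((real i + 1) * (real i + l + real k + 1) * 4)"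
    have "(real i + 1) * (real i + l + real k + 1) * 4 \<noteq> 0" using l_pos by auto
    then show "A i = ?x * (real i + 1) * (real i + l + real k + 1) * 4"
      by (metis (no_types) mult.assoc nonzero_eq_divide_eq)
    have "A (i + 1) = (real k + 2 * real i + 2) * (real k + 2 * real i + 1) * A i
        / ((2 * real i + 2) * (2 * real i + 2 * l + 2 * real k + 2))"
      using a[of i] pos(2)[of i] pos(5)[of i] by (simp add: eq_divide_eq mult.assoc)
    also have "(2 * real i + 2) * (2 * real i + 2 * l + 2 * real k + 2) = (real i + 1) * (real i + l + real k + 1) * 4"
      by (simp add: algebra_simps)
    finally show "A (i + 1) = ?x * (real k + 2 * real i + 2) * (real k + 2 * real i + 1)" by simp
  qed
  have Bi: "B i = A i * (2 * l + real k) * (real k + 1 + 2 * real i) / ((real k + 1) * 2 * (real i + real k + l + 1))" for i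
    using b[of i] pos(1)[of i] pos(3) by (simp add: eq_divide_eq mult.assoc)
  show ?case
  proof (intro conjI allI)
    fix i
    obtain x where x: "A i = x * (real i + 1) * (real i + l + real k + 1) * 4"
      "A (i + 1) = x * (real k + 2 * real i + 2) * (real k + 2 * real i + 1)" using ex by blast
    have nz: "real i + l + real k + 1 \<noteq> 0" "real i + l + real k + 2 \<noteq> 0" "real k + 1 \<noteq> 0" "real k + 2 \<noteq> 0"
      using pos(1)[of i] l_pos by linarith+
    have B0: "B i = x * (real i + 1) * 2 * (2 * l + real k) * (real k + 1 + 2 * real i) / (real k + 1)"
    proof -
      have e: "real i + real k + l + 1 = real i + l + real k + 1" by simp
      show ?thesis unfolding Bi x e using nz(1,3) by (simp add: divide_simps del: of_nat_Suc)
    qed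
    have B1: "B (i + 1) = x * (real k + 2 * real i + 2) * (real k + 2 * real i + 1) * (2 * l + real k)
        * (real k + 3 + 2 * real i) / ((real k + 1) * 2 * (real i + l + real k + 2))"
      unfolding Bi x by (simp add: add_ac)
    show "M (Suc k) (Suc k + 2 * i + 2) * (2 * real i + 2) * (2 * real i + 2 * l + 2 * real (Suc k) + 2)
      = (real (Suc k) + 2 * real i + 2) * (real (Suc k) + 2 * real i + 1) * M (Suc k) (Suc k + 2 * i)"
    proof -
      have e: "2 * real i + 2 * l + 2 * real (Suc k) + 2 = 2 * (real i + l + real k + 2)" by simp
      have "B (i + 1) * (2 * real i + 2) * (2 * (real i + l + real k + 2))
         = (real (Suc k) + 2 * real i + 2) * (real (Suc k) + 2 * real i + 1) * B i"
        unfolding B0 B1 using nz by (simp add: divide_simps) algebra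
      then show ?thesis unfolding e by (simp add: B_def)
    qed
    have "D i = (2 * (l + real k + 1) * B (i + 1) - (2 * l + real k) * A (i + 1)) / (real k + 2)"
      using r[of i] nz by (simp add: eq_divide_eq mult.commute)
    then have "D i * (real k + 2) * 2 * (real i + real k + l + 2)
       = (2 * (l + real k + 1) * B (i + 1) - (2 * l + real k) * A (i + 1)) * 2 * (real i + l + real k + 2)"
      using nz by (simp add: add_ac)
    also have "\<dots> = B i * (2 * l + real k + 1) * (real k + 2 + 2 * real i)"
      unfolding B0 B1 x using nz by (simp add: divide_simps) algebra
    finally show "M (Suc (Suc k)) (Suc (Suc k) + 2 * i) * (real (Suc k) + 1) * 2 * (real i + real (Suc k) + l + 1)
      = M (Suc k) (Suc k + 2 * i) * (2 * l + real (Suc k)) * (real (Suc k) + 1 + 2 * real i)"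
      by (simp add: B_def D_def add_ac)
  next
    fix j
    show "j < Suc k \<or> odd (j + Suc k) \<longrightarrow> M (Suc k) j = 0" using Z1 by blast
    show "j < Suc (Suc k) \<or> odd (j + Suc (Suc k)) \<longrightarrow> M (Suc (Suc k)) j = 0"
    proof
      assume j: "j < Suc (Suc k) \<or> odd (j + Suc (Suc k))"
      have "(real k + 2) * M (Suc (Suc k)) j = 0"
      proof (cases "j = k")
        case True
        have "B 0 * 2 * (l + real k + 1) = A 0 * (2 * l + real k)"
        proof -
          have "(real k + 1) * (B 0 * 2 * (l + real k + 1)) = (real k + 1) * (A 0 * (2 * l + real k))"
            using b[of 0] by (simp add: algebra_simps)
          then show ?thesis using pos(3) by simp
        qed
        then have "2 * (l + real k + 1) * B 0 = (2 * l + real k) * A 0"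
          by (simp only: mult_ac)
        then show ?thesis unfolding M_rec True by (simp add: A_def B_def)
      next
        case False
        then have "Suc j < Suc k \<or> odd (Suc j + Suc k)" "j < k \<or> odd (j + k)"
          using j by presburger+
        then show ?thesis unfolding M_rec using Z0[of j] Z1[of "Suc j"] by simp
      qed
      then show "M (Suc (Suc k)) j = 0" using pos(8) by simp
    qed
  qed
qed

lemma M_less: "j < k \<Longrightarrow> M k j = 0" using M_ratios by blast

lemma M_diag_pos: "M k k > 0"
proof (induction k)
  case 0 then show ?case by (simp add: M_def L_1)
next
  case (Suc k)
  have "M (Suc k) (Suc k) * (real k + 1) * 2 * (real k + l + 1) = M k k * (2 * l + real k) * (real k + 1)"
    using M_ratios[of k, THEN conjunct2, THEN conjunct2, THEN conjunct2, rule_format, of 0] by simp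
  also have "\<dots> > 0" using Suc l_pos by simp
  finally show ?case using l_pos by (simp add: zero_less_mult_iff)
qed

lemma L_C_expand: "degree p \<le> N \<Longrightarrow> L (C k * p) = (\<Sum>i\<le>N. coeff p i * M k i)"
proof -
  assume "degree p \<le> N"
  then have "p = (\<Sum>i\<le>N. monom (coeff p i) i)"
    by (rule poly_as_sum_of_monoms'[symmetric])
  then have "C k * p = (\<Sum>i\<le>N. smult (coeff p i) (C k * monom 1 i))"
    by (metis (no_types, lifting) sum_distrib_left mult_smult_right smult_monom mult.right_neutral sum.cong)
  then show ?thesis by (simp add: L_sum L_smult M_def)
qed

lemma L_C_lower: "degree p < k \<Longrightarrow> L (C k * p) = 0"
  by (subst L_C_expand[OF order_refl]) (auto intro!: sum.neutral simp: M_less)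

definition sqnorm where "sqnorm k = L (C k * C k)"

text \<open>
  Only the leading monomial of the second factor contributes.
\<close>
lemma sqnorm_pos: "sqnorm k > 0"
proof -
  have "sqnorm k = (\<Sum>i\<le>k. coeff (C k) i * M k i)"
    unfolding sqnorm_def by (rule L_C_expand[OF degree_gegenbauer_poly])
  also have "\<dots> = coeff (C k) k * M k k"
    by (subst sum.remove[of _ k]) (auto intro!: sum.neutral simp: M_less)
  finally show ?thesis using lead_coeff_gegenbauer_poly[OF l_pos] M_diag_pos by simp
qed

lemma L_C_orth: "j \<noteq> k \<Longrightarrow> L (C j * C k) = 0"
  using L_C_lower[of "C j" k] L_C_lower[of "C k" j] degree_gegenbauer_poly[of j l] degree_gegenbauer_poly[of k l]
  by (cases "j < k") (auto simp: mult.commute)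

lemma C_spans: "degree p \<le> N \<Longrightarrow> \<exists>c. p = (\<Sum>j\<le>N. smult (c j) (C j))"
proof (induction N arbitrary: p)
  case 0
  then obtain a where "p = [:a:]" by (metis degree_eq_zeroE le_zero_eq)
  then show ?case by (intro exI[of _ "\<lambda>_. a"]) simp
next
  case (Suc N)
  define a where "a = coeff p (Suc N) / coeff (C (Suc N)) (Suc N)"
  define q where "q = p - smult a (C (Suc N))"
  have "degree q \<le> Suc N"
    unfolding q_def using Suc.prems degree_gegenbauer_poly
    by (auto intro!: degree_diff_le order.trans[OF degree_smult_le])
  moreover have "coeff q (Suc N) = 0"
    using lead_coeff_gegenbauer_poly[OF l_pos, of "Suc N"] by (simp add: q_def a_def del: gegenbauer_poly.simps)
  ultimately have "degree q \<le> N"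
    by (metis degree_le le_degree leading_coeff_0_iff le_SucE degree_0 zero_le)
  then obtain c where c: "q = (\<Sum>j\<le>N. smult (c j) (C j))" using Suc.IH by blast
  have "p = (\<Sum>j\<le>Suc N. smult ((c(Suc N := a)) j) (C j))"
  proof -
    have "p = q + smult a (C (Suc N))" by (simp add: q_def)
    also have "q = (\<Sum>j\<le>N. smult ((c(Suc N := a)) j) (C j))" unfolding c by (intro sum.cong) auto
    finally show ?thesis by simp
  qed
  then show ?case by blast
qed

lemma C_expansion:
  assumes "degree p \<le> N"
  shows "p = (\<Sum>j\<le>N. smult (L (C j * p) / sqnorm j) (C j))"
proof -
  obtain c where c: "p = (\<Sum>j\<le>N. smult (c j) (C j))" using C_spans[OF assms] by blast
  have "L (C i * p) = c i * sqnorm i" if "i \<le> N" for i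
  proof -
    have "L (C i * p) = (\<Sum>j\<le>N. c j * L (C i * C j))"
      unfolding c by (simp add: sum_distrib_left L_sum L_smult)
    also have "\<dots> = c i * L (C i * C i)"
      using that by (subst sum.remove[of _ i]) (auto intro!: sum.neutral simp: L_C_orth)
    finally show ?thesis by (simp add: sqnorm_def)
  qed
  then have "(\<Sum>j\<le>N. smult (L (C j * p) / sqnorm j) (C j)) = (\<Sum>j\<le>N. smult (c j) (C j))"
    using sqnorm_pos by (intro sum.cong refl) (simp add: less_imp_neq[symmetric])
  then show ?thesis using c by simp
qed

lemma L_C_pos_index: "k \<ge> 1 \<Longrightarrow> L (C k) = 0"
  using L_C_lower[of 1 k] by simp

end

text \<open>
  The recursion determines all moments from the one of order zero.
\<close>
lemma gegenbauer_functional_unique: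
  assumes "gegenbauer_functional l L" "gegenbauer_functional l L'"
  shows "L p * L' 1 = L' p * L 1"
proof -
  interpret A: gegenbauer_functional l L by fact
  interpret B: gegenbauer_functional l L' by fact
  have mon: "L (monom 1 a) * L' 1 = L' (monom 1 a) * L 1" for a
  proof (induction a rule: less_induct)
    case (less a)
    consider "a = 0" | "a = 1" | b where "a = b + 2"
      by (metis One_nat_def Suc_eq_plus1 add_2_eq_Suc' not0_implies_Suc)
    then show ?case
    proof cases
      case 3
      have nz: "real b + 2 * l + 2 \<noteq> 0" using A.l_pos by linarith
      have "(real b + 2 * l + 2) * (L (monom 1 a) * L' 1) = (real b + 2 * l + 2) * (L' (monom 1 a) * L 1)"
        using A.L_rec[of b] B.L_rec[of b] less[of b] 3 by (simp add: mult.assoc[symmetric] add_ac)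
      then show ?thesis using nz by simp
    qed (auto simp: A.L_odd B.L_odd)
  qed
  have "p = (\<Sum>i\<le>degree p. smult (coeff p i) (monom 1 i))"
    by (simp add: smult_monom poly_as_sum_of_monoms)
  then have "L p = (\<Sum>i\<le>degree p. coeff p i * L (monom 1 i))" "L' p = (\<Sum>i\<le>degree p. coeff p i * L' (monom 1 i))"
    by (metis (no_types, lifting) A.L_sum A.L_smult sum.cong, metis (no_types, lifting) B.L_sum B.L_smult sum.cong)
  then show ?thesis using mon by (simp add: sum_distrib_right mult.assoc)
qed

section \<open>Zonal integrals as weighted integrals over an interval\<close>

lemma weierstrass_poly:
  fixes f :: "real \<Rightarrow> real"
  assumes "continuous_on {-1..1} f" "\<epsilon> > 0"
  obtains p where "\<And>t. t \<in> {-1..1} \<Longrightarrow> \<bar>f t - poly p t\<bar> < \<epsilon>"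
proof -
  obtain g where g: "real_polynomial_function g" "\<And>t. t \<in> {-1..1} \<Longrightarrow> \<bar>f t - g t\<bar> < \<epsilon>"
    using Stone_Weierstrass_real_polynomial_function[of "{-1..1}" f \<epsilon>] assms by auto
  then obtain a n where "g = (\<lambda>x. \<Sum>i\<le>n. a i * x ^ i)"
    by (auto simp: real_polynomial_function_iff_sum)
  then have "g t = poly (\<Sum>i\<le>n. monom (a i) i) t" for t
    by (simp add: poly_sum poly_monom)
  with g that show ?thesis by metis
qed

definition gegenbauer_weight :: "real \<Rightarrow> real \<Rightarrow> real" where
  "gegenbauer_weight l t = (1 - t\<^sup>2) powr (l - 1 / 2)"

definition weight_integral :: "real \<Rightarrow> (real \<Rightarrow> real) \<Rightarrow> real" where
  "weight_integral l f = (LBINT t:{-1..1}. f t * gegenbauer_weight l t)"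

lemma gegenbauer_weight_nonneg: "gegenbauer_weight l t \<ge> 0"
  by (simp add: gegenbauer_weight_def)

lemma gegenbauer_weight_le_1:
  assumes "l \<ge> 1 / 2" "t \<in> {-1..1}"
  shows "gegenbauer_weight l t \<le> 1"
proof -
  have "t\<^sup>2 \<le> 1" using assms(2) abs_square_le_1[of t] by (simp add: abs_le_iff)
  then show ?thesis using assms(1)
    by (auto simp: gegenbauer_weight_def intro!: powr_le1)
qed

lemma set_integrable_gegenbauer_weight:
  assumes l: "l \<ge> 1 / 2" and f: "continuous_on {-1..1} f"
  shows "set_integrable lborel {-1..1} (\<lambda>t. f t * gegenbauer_weight l t)"
proof -
  have "compact (f ` {-1..1})" using f by (intro compact_continuous_image) auto
  then obtain B where B: "\<forall>t\<in>{-1..1}. \<bar>f t\<bar> \<le> B"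
    using compact_imp_bounded bounded_iff by (metis image_eqI real_norm_def)
  have [measurable]: "gegenbauer_weight l \<in> borel_measurable borel"
    unfolding gegenbauer_weight_def[abs_def] by measurable
  have "(\<lambda>t. indicator {-1..1} t *\<^sub>R f t) \<in> borel_measurable borel"
    using f by (intro borel_measurable_continuous_on_indicator) auto
  then have "(\<lambda>t. (indicator {-1..1} t *\<^sub>R f t) * gegenbauer_weight l t) \<in> borel_measurable borel"
    by measurable
  then have m: "(\<lambda>t. (indicator {-1..1} t *\<^sub>R f t) * gegenbauer_weight l t) \<in> borel_measurable lborel"
    by simp
  have "integrable lborel (\<lambda>t. (indicator {-1..1} t *\<^sub>R f t) * gegenbauer_weight l t)"
  proof (rule integrableI_bounded_set[where A="{-1..1}" and B=B, OF _ m])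
    show "AE t in lborel. t \<in> {-1..1} \<longrightarrow> norm (indicator {-1..1} t *\<^sub>R f t * gegenbauer_weight l t) \<le> B"
    proof (intro AE_I2 impI)
      fix t :: real assume t: "t \<in> {-1..1}"
      have "\<bar>f t\<bar> * \<bar>gegenbauer_weight l t\<bar> \<le> B * 1"
        using B t gegenbauer_weight_le_1[OF l t] gegenbauer_weight_nonneg[of l t]
        by (intro mult_mono) (auto intro: order.trans[OF abs_ge_zero])
      then show "norm (indicator {-1..1} t *\<^sub>R f t * gegenbauer_weight l t) \<le> B"
        using t by (simp add: abs_mult)
    qed
  qed (auto simp: indicator_def)
  then show ?thesis
    by (simp add: set_integrable_def mult.assoc)
qed

lemma weight_integral_eq_integral:
  assumes "l \<ge> 1 / 2" "continuous_on {-1..1} f"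
  shows "weight_integral l f = integral {-1..1} (\<lambda>t. f t * gegenbauer_weight l t)"
  unfolding weight_integral_def
  by (rule set_borel_integral_eq_integral(2)[OF set_integrable_gegenbauer_weight[OF assms]])

lemma weight_integral_moment_odd:
  assumes "l \<ge> 1 / 2" "odd a"
  shows "weight_integral l (\<lambda>t. t ^ a) = 0"
proof -
  have w: "gegenbauer_weight l (- t) = gegenbauer_weight l t" for t by (simp add: gegenbauer_weight_def)
  have c: "continuous_on {-1..1} (\<lambda>t::real. t ^ a)" by (intro continuous_intros)
  have "integral {-1..1} (\<lambda>t. t ^ a * gegenbauer_weight l t)
      = integral {-1..1} (\<lambda>t. (- t) ^ a * gegenbauer_weight l (- t))"
    using Henstock_Kurzweil_Integration.integral_reflect_real[of "1::real" "-1" "\<lambda>t. t ^ a * gegenbauer_weight l t"] by simp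
  also have "\<dots> = - integral {-1..1} (\<lambda>t. t ^ a * gegenbauer_weight l t)"
    using assms(2) by (simp add: w)
  finally show ?thesis by (simp add: weight_integral_eq_integral[OF assms(1) c])
qed

text \<open>
  The derivative of \<open>t ^ (a + 1) * (1 - t\<^sup>2) powr (l + 1 / 2)\<close> has integral zero, as this function vanishes at both
  end points.
\<close>
lemma weight_integral_moment_rec:
  assumes l: "l \<ge> 1 / 2"
  shows "(real a + 2 * l + 2) * weight_integral l (\<lambda>t. t ^ (a + 2)) = (real a + 1) * weight_integral l (\<lambda>t. t ^ a)"
proof -
  define F where "F t = t ^ (a + 1) * (1 - t\<^sup>2) powr (l + 1 / 2)" for t :: real
  define F' where "F' t = (real a + 1) * (t ^ a * gegenbauer_weight l t)
      - (real a + 2 * l + 2) * (t ^ (a + 2) * gegenbauer_weight l t)" for t :: real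
  have "(F' has_integral (F 1 - F (- 1))) {-1..1}"
  proof (rule fundamental_theorem_of_calculus_interior)
    show "continuous_on {-1..1} F"
      unfolding F_def using l by (intro continuous_intros continuous_on_powr') (auto simp: abs_square_le_1)
    fix t :: real assume "t \<in> {-1<..<1}"
    then have pos: "1 - t\<^sup>2 > 0" using abs_square_less_1[of t] by auto
    have p1: "(1 - t\<^sup>2) powr (l + 1 / 2) = (1 - t\<^sup>2) * gegenbauer_weight l t"
      using pos powr_mult_base[of "1 - t\<^sup>2" "l - 1 / 2"] by (simp add: gegenbauer_weight_def add.commute)
    have p2: "(1 - t\<^sup>2) powr (l + 1 / 2 - 1) = gegenbauer_weight l t"
      by (simp add: gegenbauer_weight_def)
    have d: "((\<lambda>t. (1 - t\<^sup>2) powr (l + 1 / 2)) has_real_derivative (l + 1 / 2) * (1 - t\<^sup>2) powr (l + 1 / 2 - 1) * (- 2 * t)) (at t)"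
    proof -
      have g: "((\<lambda>t. 1 - t\<^sup>2) has_real_derivative (- 2 * t)) (at t)"
        by (auto intro!: derivative_eq_intros)
      show ?thesis using DERIV_fun_powr[OF g pos, of "l + 1 / 2"] by (simp only: of_nat_1)
    qed
    have "(F has_real_derivative (real (a + 1) * t ^ a * (1 - t\<^sup>2) powr (l + 1 / 2)
         + (l + 1 / 2) * (1 - t\<^sup>2) powr (l + 1 / 2 - 1) * (- 2 * t) * t ^ (a + 1))) (at t)"
      unfolding F_def using DERIV_mult[OF DERIV_pow[of "a + 1" t] d] by (simp add: add.commute)
    also have "real (a + 1) * t ^ a * (1 - t\<^sup>2) powr (l + 1 / 2)
         + (l + 1 / 2) * (1 - t\<^sup>2) powr (l + 1 / 2 - 1) * (- 2 * t) * t ^ (a + 1) = F' t"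
      unfolding p1 p2 F'_def by (simp add: algebra_simps power2_eq_square)
    finally show "(F has_vector_derivative F' t) (at t)"
      by (simp add: has_real_derivative_iff_has_vector_derivative)
  qed simp
  then have "integral {-1..1} F' = 0"
    using l by (simp add: F_def integral_unique)
  moreover have i: "(\<lambda>t. t ^ b * gegenbauer_weight l t) integrable_on {-1..1}" for b
    by (rule set_borel_integral_eq_integral(1)[OF set_integrable_gegenbauer_weight[OF l]]) (intro continuous_intros)
  then have "integral {-1..1} F' = (real a + 1) * integral {-1..1} (\<lambda>t. t ^ a * gegenbauer_weight l t)
      - (real a + 2 * l + 2) * integral {-1..1} (\<lambda>t. t ^ (a + 2) * gegenbauer_weight l t)"
    unfolding F'_def by (intro integral_unique has_integral_diff has_integral_mult_right integrable_integral)
  ultimately show ?thesis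
    by (simp add: weight_integral_eq_integral[OF l] continuous_intros)
qed

text \<open>
  This is the Beta integral that also gives the volumes of balls; it is the reciprocal of the constant in
  the definition of the harmonic coefficients.
\<close>
lemma weight_integral_1:
  assumes "n \<ge> (3::nat)"
  shows "weight_integral ((real n - 2) / 2) (\<lambda>_. 1)
     = sqrt pi * Gamma ((real n - 1) / 2) / Gamma (real n / 2)"
proof -
  let ?w = "\<lambda>t. indicator {-1..1} t * sqrt (1 - t\<^sup>2) ^ (n - 3)"
  have "weight_integral ((real n - 2) / 2) (\<lambda>_. 1) = (\<integral>t. indicator {-1..1} t * gegenbauer_weight ((real n - 2) / 2) t \<partial>lborel)"
    by (simp add: weight_integral_def set_lebesgue_integral_def)
  \<comment> \<open>For \<open>n = 3\<close> the integrands differ at the end points, where \<open>0 powr 0 = 0\<close> but \<open>0 ^ 0 = 1\<close>.\<close>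
  also have "\<dots> = (\<integral>t. ?w t \<partial>lborel)"
  proof (rule integral_cong_AE)
    show "AE t in lborel. indicator {-1..1} t * gegenbauer_weight ((real n - 2) / 2) t = ?w t"
    proof (rule AE_I[of _ _ "{-1, 1}"])
      show "{t \<in> space lborel. indicator {-1..1} t * gegenbauer_weight ((real n - 2) / 2) t \<noteq> ?w t} \<subseteq> {-1, 1}"
      proof (rule subsetI, rule ccontr)
        fix t :: real
        assume t: "t \<in> {t \<in> space lborel. indicator {-1..1} t * gegenbauer_weight ((real n - 2) / 2) t \<noteq> ?w t}"
          and t': "t \<notin> {-1, 1}"
        have "t \<in> {-1..1} \<Longrightarrow> 1 - t\<^sup>2 > 0" using t' abs_square_less_1[of t] by auto
        moreover have "real (n - 3) = real n - 3" using assms by (simp add: of_nat_diff)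
        ultimately have "t \<in> {-1..1} \<Longrightarrow> gegenbauer_weight ((real n - 2) / 2) t = sqrt (1 - t\<^sup>2) ^ (n - 3)"
          by (simp add: gegenbauer_weight_def powr_realpow[symmetric] powr_half_sqrt[symmetric] powr_powr diff_divide_distrib)
        then show False using t by (auto simp: indicator_def)
      qed
    next
      have "finite {-1, 1::real}" by simp
      then show "emeasure lborel {-1, 1::real} = 0" by (rule emeasure_lborel_countable[OF countable_finite])
    qed simp
  qed (simp_all add: gegenbauer_weight_def[abs_def])
  also have "\<dots> = Beta (1 / 2) (real (n - 3) / 2 + 1)"
  proof -
    have "(\<integral>t. ?w t \<partial>lborel) = enn2real (\<integral>\<^sup>+t. ennreal (?w t) \<partial>lborel)"
      by (rule integral_eq_nn_integral) (auto simp: indicator_def abs_square_le_1)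
    also have "(\<integral>\<^sup>+t. ennreal (?w t) \<partial>lborel) = ennreal (Beta (1 / 2) (real (n - 3) / 2 + 1))"
      unfolding emeasure_cball_aux_integral[symmetric]
      by (intro nn_integral_cong) (auto simp: indicator_def)
    finally show ?thesis by (simp add: Beta_def)
  qed
  also have "real (n - 3) / 2 + 1 = (real n - 1) / 2" using assms by (simp add: of_nat_diff field_simps)
  also have "Beta (1 / 2) ((real n - 1) / 2) = sqrt pi * Gamma ((real n - 1) / 2) / Gamma (real n / 2)"
    by (simp add: Beta_def Gamma_one_half_real add_divide_distrib[symmetric])
  finally show ?thesis .
qed

lemma gegenbauer_functional_weight:
  assumes n: "n \<ge> (3::nat)"
  shows "gegenbauer_functional ((real n - 2) / 2) (\<lambda>p. weight_integral ((real n - 2) / 2) (poly p))"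
proof -
  have l: "(real n - 2) / 2 \<ge> 1 / 2" using n by simp
  note int = set_integrable_gegenbauer_weight[OF l, of "poly p" for p, simplified continuous_on_poly]
  show ?thesis
  proof
    show "(real n - 2) / 2 > 0" using n by simp
    show "weight_integral ((real n - 2) / 2) (poly (p + q))
       = weight_integral ((real n - 2) / 2) (poly p) + weight_integral ((real n - 2) / 2) (poly q)" for p q
      using set_integral_add(2)[OF int int, of p q] by (simp add: weight_integral_def algebra_simps continuous_intros)
    show "weight_integral ((real n - 2) / 2) (poly (smult c p)) = c * weight_integral ((real n - 2) / 2) (poly p)" for c p
      unfolding weight_integral_def by (simp add: set_integral_mult_right mult.assoc)
    show "weight_integral ((real n - 2) / 2) (poly (monom 1 a)) = 0" if "odd a" for a
      using weight_integral_moment_odd[OF l that] by (simp add: poly_monom[abs_def])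
    show "(real a + 2 * ((real n - 2) / 2) + 2) * weight_integral ((real n - 2) / 2) (poly (monom 1 (a + 2)))
       = (real a + 1) * weight_integral ((real n - 2) / 2) (poly (monom 1 a))" for a
      using weight_integral_moment_rec[OF l, of a] by (simp only: poly_monom[abs_def] mult_1)
    have "weight_integral ((real n - 2) / 2) (poly 1) = sqrt pi * Gamma ((real n - 1) / 2) / Gamma (real n / 2)"
      using weight_integral_1[OF n] by (simp add: one_poly_eq_simps poly_1[abs_def])
    also have "\<dots> > 0" using n by (intro divide_pos_pos mult_pos_pos Gamma_real_pos) auto
    finally show "weight_integral ((real n - 2) / 2) (poly 1) > 0" .
  qed
qed

definition zonal_integral :: "'a::euclidean_space \<Rightarrow> (real \<Rightarrow> real) \<Rightarrow> real" where
  "zonal_integral e f = (\<integral>x. f (x \<bullet> e) \<partial>sphere_measure)"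

lemma inner_unit_le:
  fixes x :: "'a::euclidean_space"
  assumes "norm x = 1" "norm e = 1"
  shows "x \<bullet> e \<in> {-1..1}"
  using Cauchy_Schwarz_ineq2[of x e] assms by auto

lemma continuous_on_sphere_zonal:
  fixes e :: "'a::euclidean_space" and f :: "real \<Rightarrow> real"
  assumes "continuous_on {-1..1} f" "norm e = 1"
  shows "continuous_on (sphere 0 1) (\<lambda>x. f (x \<bullet> e))"
  by (rule continuous_on_compose2[OF assms(1)])
     (use inner_unit_le[OF _ assms(2)] in \<open>auto intro!: continuous_intros\<close>)

lemma integrable_zonal:
  fixes e :: "'a::euclidean_space" and f :: "real \<Rightarrow> real"
  assumes "continuous_on {-1..1} f" "norm e = 1"
  shows "integrable sphere_measure (\<lambda>x. f (x \<bullet> e))"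
  by (rule integrable_sphere_continuous[OF continuous_on_sphere_zonal[OF assms]])

lemma gegenbauer_functional_sphere:
  fixes e :: "'a::euclidean_space"
  assumes n: "DIM('a) \<ge> 3" and e: "e \<in> Basis"
  shows "gegenbauer_functional ((real DIM('a) - 2) / 2) (\<lambda>p. zonal_integral e (poly p))"
proof
  have int: "integrable sphere_measure (\<lambda>x. poly p (x \<bullet> e))" for p
    by (intro integrable_sphere_continuous continuous_intros)
  show "(real DIM('a) - 2) / 2 > 0" using n by simp
  show "zonal_integral e (poly (p + q)) = zonal_integral e (poly p) + zonal_integral e (poly q)" for p q
    by (simp add: zonal_integral_def int)
  show "zonal_integral e (poly (smult c p)) = c * zonal_integral e (poly p)" for c p
    by (simp add: zonal_integral_def)
  show "zonal_integral e (poly (monom 1 a)) = 0" if "odd a" for a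
    using zonal_moment_odd[of e a] that e by (simp add: zonal_integral_def poly_monom)
  show "(real a + 2 * ((real DIM('a) - 2) / 2) + 2) * zonal_integral e (poly (monom 1 (a + 2)))
       = (real a + 1) * zonal_integral e (poly (monom 1 a))" for a
  proof -
    have "real a + 2 * ((real DIM('a) - 2) / 2) + 2 = real (a + DIM('a))" by (simp add: field_simps)
    then show ?thesis
      using zonal_moment_rec[OF e, of a] by (simp only: zonal_integral_def poly_monom mult_1 of_nat_add of_nat_1)
  qed
  show "zonal_integral e (poly 1) > 0"
    using sphere_area_pos[where 'a='a] by (simp add: zonal_integral_def sphere_area_def)
qed

lemma abs_integral_sphere_le:
  fixes g :: "'a::euclidean_space \<Rightarrow> real"
  assumes "\<And>x. x \<in> sphere 0 1 \<Longrightarrow> \<bar>g x\<bar> \<le> B" "0 \<le> B"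
  shows "\<bar>(\<integral>x. g x \<partial>sphere_measure)\<bar> \<le> B * sphere_area TYPE('a)"
proof (cases "integrable sphere_measure g")
  case True
  have "\<bar>(\<integral>x. g x \<partial>sphere_measure)\<bar> \<le> (\<integral>x. \<bar>g x\<bar> \<partial>sphere_measure)"
    by (rule integral_abs_bound)
  also have "\<dots> \<le> (\<integral>x. B \<partial>(sphere_measure :: 'a measure))"
    using assms True by (intro integral_mono) auto
  finally show ?thesis by (simp add: sphere_area_def mult.commute)
next
  case False
  then show ?thesis using assms(2) sphere_area_pos[where 'a='a] by (simp add: not_integrable_integral_eq)
qed

text \<open>
  For polynomials this is the uniqueness of the moment functional; the general case follows by uniform
  approximation.
\<close>
lemma zonal_integral_eq_weight_integral:
  fixes e :: "'a::euclidean_space"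
  assumes n: "DIM('a) \<ge> 3" and e: "e \<in> Basis" and f: "continuous_on {-1..1} f"
  shows "zonal_integral e f / sphere_area TYPE('a)
     = Gamma (real DIM('a) / 2) / (sqrt pi * Gamma ((real DIM('a) - 1) / 2))
         * weight_integral ((real DIM('a) - 2) / 2) f"
proof -
  let ?l = "(real DIM('a) - 2) / 2"
  let ?A = "sphere_area TYPE('a)" and ?J = "weight_integral ?l (\<lambda>_. 1)"
  have l: "?l \<ge> 1 / 2" using n by simp
  have ne: "norm e = 1" using e by simp
  have A: "?A > 0" by (rule sphere_area_pos)
  have J: "?J = sqrt pi * Gamma ((real DIM('a) - 1) / 2) / Gamma (real DIM('a) / 2)"
    by (rule weight_integral_1[OF n])
  have Jpos: "?J > 0" unfolding J using n by (intro divide_pos_pos mult_pos_pos Gamma_real_pos) auto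
  have z1: "zonal_integral e (\<lambda>_. 1) = ?A" by (simp add: zonal_integral_def sphere_area_def)
  have poly: "zonal_integral e (poly p) * ?J = weight_integral ?l (poly p) * ?A" for p
    using gegenbauer_functional_unique[OF gegenbauer_functional_sphere[OF n e] gegenbauer_functional_weight[OF n], of p]
      z1 by (simp add: poly_1[abs_def])
  have "\<bar>zonal_integral e f * ?J - weight_integral ?l f * ?A\<bar> \<le> \<epsilon>" if "\<epsilon> > 0" for \<epsilon>
  proof -
    define \<eta> where "\<eta> = \<epsilon> / (2 * ?A * ?J)"
    have \<eta>: "\<eta> > 0" using that A Jpos by (simp add: \<eta>_def)
    obtain p where p: "\<And>t. t \<in> {-1..1} \<Longrightarrow> \<bar>f t - poly p t\<bar> < \<eta>"
      using weierstrass_poly[OF f \<eta>] by blast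
    have cp: "continuous_on {-1..1} (poly p)" by (intro continuous_intros)
    have 1: "\<bar>zonal_integral e f - zonal_integral e (poly p)\<bar> \<le> \<eta> * ?A"
    proof -
      have "zonal_integral e f - zonal_integral e (poly p) = (\<integral>x. f (x \<bullet> e) - poly p (x \<bullet> e) \<partial>sphere_measure)"
        unfolding zonal_integral_def
        by (rule Bochner_Integration.integral_diff[symmetric, OF integrable_zonal[OF f ne] integrable_zonal[OF cp ne]])
      also have "\<bar>\<dots>\<bar> \<le> \<eta> * ?A"
        using p \<eta> inner_unit_le[OF _ ne] by (intro abs_integral_sphere_le less_imp_le) auto
      finally show ?thesis .
    qed
    have 2: "\<bar>weight_integral ?l f - weight_integral ?l (poly p)\<bar> \<le> \<eta> * ?J"
    proof -
      note i = set_integrable_gegenbauer_weight[OF l]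
      have i1: "set_integrable lborel {-1..1} (\<lambda>t. \<bar>f t * gegenbauer_weight ?l t - poly p t * gegenbauer_weight ?l t\<bar>)"
        by (rule set_integrable_abs[OF set_integral_diff(1)[OF i[OF f] i[OF cp]]])
      have i2: "set_integrable lborel {-1..1} (\<lambda>t. \<eta> * gegenbauer_weight ?l t)"
        by (rule i) (rule continuous_on_const)
      have le: "\<bar>f t * gegenbauer_weight ?l t - poly p t * gegenbauer_weight ?l t\<bar> \<le> \<eta> * gegenbauer_weight ?l t"
        if "t \<in> {-1..1}" for t
      proof -
        have "\<bar>f t * gegenbauer_weight ?l t - poly p t * gegenbauer_weight ?l t\<bar>
            = \<bar>f t - poly p t\<bar> * \<bar>gegenbauer_weight ?l t\<bar>"
          by (metis abs_mult left_diff_distrib)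
        also have "\<dots> \<le> \<eta> * gegenbauer_weight ?l t"
          unfolding abs_of_nonneg[OF gegenbauer_weight_nonneg]
          by (rule mult_right_mono[OF less_imp_le[OF p[OF that]] gegenbauer_weight_nonneg])
        finally show ?thesis .
      qed
      have diff: "weight_integral ?l f - weight_integral ?l (poly p)
         = (LBINT t:{-1..1}. f t * gegenbauer_weight ?l t - poly p t * gegenbauer_weight ?l t)"
        unfolding weight_integral_def by (rule set_integral_diff(2)[symmetric, OF i[OF f] i[OF cp]])
      have "\<bar>weight_integral ?l f - weight_integral ?l (poly p)\<bar>
          \<le> (LBINT t:{-1..1}. \<bar>f t * gegenbauer_weight ?l t - poly p t * gegenbauer_weight ?l t\<bar>)"
        unfolding diff
        using set_integral_norm_bound[OF set_integral_diff(1)[OF i[OF f] i[OF cp]]] by simp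
      also have "\<dots> \<le> (LBINT t:{-1..1}. \<eta> * gegenbauer_weight ?l t)"
        by (rule set_integral_mono[OF i1 i2 le])
      also have "\<dots> = \<eta> * ?J" unfolding weight_integral_def by simp
      finally show ?thesis .
    qed
    have "\<bar>zonal_integral e f * ?J - weight_integral ?l f * ?A\<bar>
       = \<bar>(zonal_integral e f - zonal_integral e (poly p)) * ?J - (weight_integral ?l f - weight_integral ?l (poly p)) * ?A\<bar>"
      using poly[of p] by (simp add: algebra_simps)
    also have "\<dots> \<le> (\<eta> * ?A) * ?J + (\<eta> * ?J) * ?A"
      using mult_right_mono[OF 1, of ?J] mult_right_mono[OF 2, of ?A] A Jpos
      by (intro order.trans[OF abs_triangle_ineq4] add_mono) (simp_all add: abs_mult)
    also have "\<dots> = \<epsilon>" using A Jpos by (simp add: \<eta>_def field_simps)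
    finally show ?thesis .
  qed
  then have "\<bar>zonal_integral e f * ?J - weight_integral ?l f * ?A\<bar> \<le> 0"
    by (rule field_le_epsilon[of _ 0, simplified])
  then have "zonal_integral e f * ?J = weight_integral ?l f * ?A" by simp
  then have "zonal_integral e f / ?A = weight_integral ?l f / ?J"
    using A Jpos by (simp add: frac_eq_eq mult.commute)
  then show ?thesis unfolding J by (simp add: mult.commute)
qed

lemma harmonic_coeff_eq_zonal_integral:
  fixes e :: "'a::euclidean_space"
  assumes n: "DIM('a) \<ge> 3" and e: "e \<in> Basis" and w: "continuous_on {-1..1} w"
  shows "harmonic_coeff DIM('a) w k * gegenbauer k ((real DIM('a) - 2) / 2) 1 * sphere_area TYPE('a)
     = zonal_integral e (\<lambda>t. w t * gegenbauer k ((real DIM('a) - 2) / 2) t)"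
proof -
  let ?l = "(real DIM('a) - 2) / 2"
  have c: "continuous_on {-1..1} (\<lambda>t. w t * gegenbauer k ?l t)"
    by (subst poly_gegenbauer_poly[symmetric]) (intro continuous_intros w)
  have g: "gegenbauer k ?l 1 > 0" using n by (intro gegenbauer_1_pos) simp
  have expo: "?l - 1 / 2 = (real DIM('a) - 3) / 2" by (simp add: field_simps)
  have "weight_integral ?l (\<lambda>t. w t * gegenbauer k ?l t) = (LBINT t:{-1..1}. w t *
        (gegenbauer k ?l t / gegenbauer k ?l 1) * (1 - t\<^sup>2) powr ((real DIM('a) - 3) / 2)) * gegenbauer k ?l 1"
    unfolding weight_integral_def gegenbauer_weight_def expo using g
    by (subst set_integral_mult_left[symmetric]) (simp add: field_simps)
  then have "harmonic_coeff DIM('a) w k * gegenbauer k ?l 1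
     = Gamma (real DIM('a) / 2) / (sqrt pi * Gamma ((real DIM('a) - 1) / 2)) * weight_integral ?l (\<lambda>t. w t * gegenbauer k ?l t)"
    unfolding harmonic_coeff_def by simp
  also have "\<dots> = zonal_integral e (\<lambda>t. w t * gegenbauer k ?l t) / sphere_area TYPE('a)"
    by (rule zonal_integral_eq_weight_integral[OF n e c, symmetric])
  finally show ?thesis using sphere_area_pos[where 'a='a] by simp
qed

section \<open>Bifurcation from a simple eigenvalue\<close>

lemma neumann_solution:
  fixes R :: "'e::banach \<Rightarrow> 'e"
  assumes R: "bounded_linear R" and small: "\<And>x. norm (R x) \<le> norm x / 2"
  obtains X where "bounded_linear X" "\<And>g. X g = R (X g) + g"
proof -
  interpret R: bounded_linear R by fact
  have ex: "\<exists>!x. R x + g = x" for g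
  proof (rule banach_fix_type[of "1 / 2"])
    show "\<forall>x y. dist (R x + g) (R y + g) \<le> 1 / 2 * dist x y"
      using small by (simp add: dist_norm R.diff[symmetric])
  qed auto
  define X where "X g = (THE x. R x + g = x)" for g
  have X: "R (X g) + g = X g" for g unfolding X_def by (rule theI'[OF ex])
  have uniq: "x = X g" if "R x + g = x" for x g using ex[of g] X[of g] that by blast
  have "bounded_linear X"
  proof (rule bounded_linear_intro)
    show "X (a + b) = X a + X b" for a b
    proof (rule uniq[symmetric])
      have "R (X a + X b) + (a + b) = (R (X a) + a) + (R (X b) + b)" by (simp add: R.add)
      then show "R (X a + X b) + (a + b) = X a + X b" by (simp only: X)
    qed
    show "X (r *\<^sub>R a) = r *\<^sub>R X a" for r a
      using X[of a] by (intro uniq[symmetric]) (metis R.scaleR scaleR_add_right)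
    show "norm (X a) \<le> norm a * 2" for a
      using norm_triangle_ineq[of "R (X a)" a] small[of "X a"] by (simp add: X)
  qed
  with X that show ?thesis by metis
qed

text \<open>
  On the span of the finitely many \<open>\<phi> j\<close> the operator \<open>1 - \<kappa> T\<close> is diagonal and is inverted by division,
  except in the direction \<open>\<phi> k\<close>. On the common kernel of the functionals \<open>\<psi> j\<close> the operators \<open>T\<close> and \<open>R\<close> agree, and
  there \<open>1 - \<kappa> R\<close> is inverted by a Neumann series; this kernel is invariant because each \<open>\<psi> j\<close> is an
  eigenfunctional of \<open>R\<close>.
\<close>
lemma simple_eigenvalue_pseudo_inverse:
  fixes T R :: "'e::banach \<Rightarrow> 'e" and \<phi> :: "nat \<Rightarrow> 'e" and \<psi> :: "nat \<Rightarrow> 'e \<Rightarrow> real"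
  assumes T: "bounded_linear T" and R: "bounded_linear R"
    and \<psi>: "\<And>j. bounded_linear (\<psi> j)"
    and dual: "\<And>i j. \<psi> i (\<phi> j) = (if i = j then 1 else 0)"
    and split: "\<And>x. T x = R x + (\<Sum>j\<le>N. (a j * \<psi> j x) *\<^sub>R \<phi> j)"
    and small: "\<And>x. norm (\<kappa> *\<^sub>R R x) \<le> norm x / 2"
    and commute: "\<And>j x. \<psi> j (R x) = r j * \<psi> j x"
    and eigen: "\<And>j. T (\<phi> j) = \<tau> j *\<^sub>R \<phi> j"
    and k: "k \<le> N" and simple: "\<And>j. j \<noteq> k \<Longrightarrow> \<kappa> * \<tau> j \<noteq> 1"
  obtains S where "bounded_linear S" "\<And>f. \<psi> k (S f) = 0"
    "\<And>f. S f - \<kappa> *\<^sub>R T (S f) = f - \<psi> k f *\<^sub>R \<phi> k"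
proof -
  interpret T: bounded_linear T by fact
  interpret R: bounded_linear R by fact
  interpret psi: bounded_linear "\<psi> j" for j by fact
  have "bounded_linear (\<lambda>x. \<kappa> *\<^sub>R R x)" by (rule bounded_linear_scaleR_right[THEN bounded_linear_compose, OF R])
  from neumann_solution[OF this small] obtain X where X: "bounded_linear X" "\<And>g. X g = \<kappa> *\<^sub>R R (X g) + g"
    by blast
  interpret X: bounded_linear X by fact
  have r: "\<bar>\<kappa> * r j\<bar> \<le> 1 / 2" if "j \<le> N" for j
  proof -
    have "R (\<phi> j) = T (\<phi> j) - a j *\<^sub>R \<phi> j"
    proof -
      have "(\<Sum>i\<le>N. (a i * \<psi> i (\<phi> j)) *\<^sub>R \<phi> i) = (\<Sum>i\<le>N. if i = j then a j *\<^sub>R \<phi> j else 0)"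
        by (intro sum.cong) (auto simp: dual)
      then show ?thesis using that split[of "\<phi> j"] by simp
    qed
    then have Rphi: "R (\<phi> j) = (\<tau> j - a j) *\<^sub>R \<phi> j" by (simp add: eigen scaleR_diff_left)
    then have "r j = \<tau> j - a j" using commute[of j "\<phi> j"] by (simp add: dual psi.scaleR)
    then have "\<bar>\<kappa> * r j\<bar> * norm (\<phi> j) \<le> (1 / 2) * norm (\<phi> j)"
      using small[of "\<phi> j"] by (simp add: Rphi abs_mult)
    moreover have "\<phi> j \<noteq> 0" using dual[of j j] psi.zero[of j] by auto
    ultimately show ?thesis by (simp add: mult_le_cancel_right)
  qed
  define P where "P f = (\<Sum>j\<le>N. \<psi> j f *\<^sub>R \<phi> j)" for f
  define Q where "Q f = (\<Sum>j\<in>{..N} - {k}. (\<psi> j f / (1 - \<kappa> * \<tau> j)) *\<^sub>R \<phi> j)" for f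
  have Plin: "bounded_linear P"
    unfolding P_def by (intro bounded_linear_sum bounded_linear_compose[OF bounded_linear_scaleR_left \<psi>])
  have Qlin: "bounded_linear Q"
    unfolding Q_def divide_inverse mult.commute[of _ "inverse _"]
    by (intro bounded_linear_sum bounded_linear_compose[OF bounded_linear_scaleR_left]
        bounded_linear_compose[OF bounded_linear_mult_right \<psi>])
  have psiP: "\<psi> i (P f) = \<psi> i f" if "i \<le> N" for i f
  proof -
    have "\<psi> i (P f) = (\<Sum>j\<le>N. if j = i then \<psi> i f else 0)"
      unfolding P_def psi.sum by (intro sum.cong) (auto simp: psi.scaleR dual)
    then show ?thesis using that by simp
  qed
  have psiX: "\<psi> i (X (f - P f)) = 0" if "i \<le> N" for i f
  proof -
    define y where "y = \<psi> i (X (f - P f))"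
    have "y = \<psi> i (\<kappa> *\<^sub>R R (X (f - P f)) + (f - P f))" unfolding y_def by (subst X(2)) simp
    also have "\<dots> = (\<kappa> * r i) * y"
      using psiP[OF that] by (simp add: psi.add psi.diff psi.scaleR commute y_def)
    finally have "y = (\<kappa> * r i) * y" .
    then have "(1 - \<kappa> * r i) * y = 0" by (simp add: algebra_simps)
    then show ?thesis using r[OF that] by (auto simp: y_def)
  qed
  define S where "S f = Q f + X (f - P f)" for f
  show ?thesis
  proof (rule that)
    show "bounded_linear S"
      unfolding S_def by (intro bounded_linear_add Qlin bounded_linear_compose[OF X(1)]
          bounded_linear_sub bounded_linear_ident Plin)
    have "\<psi> k (Q f) = 0" for f
      unfolding Q_def psi.sum by (intro sum.neutral) (auto simp: psi.scaleR dual)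
    then show "\<psi> k (S f) = 0" for f using psiX[OF k, of f] by (simp add: S_def psi.add)
    fix f
    have "Q f - \<kappa> *\<^sub>R T (Q f) = (\<Sum>j\<in>{..N} - {k}. \<psi> j f *\<^sub>R \<phi> j)"
    proof -
      have "Q f - \<kappa> *\<^sub>R T (Q f) = (\<Sum>j\<in>{..N} - {k}. (\<psi> j f / (1 - \<kappa> * \<tau> j)) *\<^sub>R \<phi> j
          - \<kappa> *\<^sub>R (\<psi> j f / (1 - \<kappa> * \<tau> j)) *\<^sub>R \<tau> j *\<^sub>R \<phi> j)"
        unfolding Q_def T.sum scaleR_sum_right sum_subtractf by (simp add: T.scaleR eigen)
      also have "\<dots> = (\<Sum>j\<in>{..N} - {k}. \<psi> j f *\<^sub>R \<phi> j)"
      proof (intro sum.cong refl)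
        fix j assume "j \<in> {..N} - {k}"
        then have nz: "1 - \<kappa> * \<tau> j \<noteq> 0" using simple[of j] by auto
        have "(\<psi> j f / (1 - \<kappa> * \<tau> j)) *\<^sub>R \<phi> j - \<kappa> *\<^sub>R (\<psi> j f / (1 - \<kappa> * \<tau> j)) *\<^sub>R \<tau> j *\<^sub>R \<phi> j
            = ((1 - \<kappa> * \<tau> j) * (\<psi> j f / (1 - \<kappa> * \<tau> j))) *\<^sub>R \<phi> j"
        proof -
          have "c - \<kappa> * (c * \<tau> j) = (1 - \<kappa> * \<tau> j) * c" for c by (simp add: algebra_simps)
          then show ?thesis by (simp only: scaleR_scaleR scaleR_diff_left[symmetric])
        qed
        then show "(\<psi> j f / (1 - \<kappa> * \<tau> j)) *\<^sub>R \<phi> j - \<kappa> *\<^sub>R (\<psi> j f / (1 - \<kappa> * \<tau> j)) *\<^sub>R \<tau> j *\<^sub>R \<phi> j = \<psi> j f *\<^sub>R \<phi> j"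
          using nz by simp
      qed
      finally show ?thesis .
    qed
    moreover have "X (f - P f) - \<kappa> *\<^sub>R T (X (f - P f)) = f - P f"
    proof -
      have "T (X (f - P f)) = R (X (f - P f))" using split[of "X (f - P f)"] psiX by simp
      then show ?thesis using X(2)[of "f - P f"] by (simp add: algebra_simps)
    qed
    moreover have "P f = \<psi> k f *\<^sub>R \<phi> k + (\<Sum>j\<in>{..N} - {k}. \<psi> j f *\<^sub>R \<phi> j)"
      unfolding P_def using k by (subst sum.remove[of _ k]) auto
    moreover have "S f - \<kappa> *\<^sub>R T (S f) = (Q f - \<kappa> *\<^sub>R T (Q f)) + (X (f - P f) - \<kappa> *\<^sub>R T (X (f - P f)))"
      unfolding S_def T.add scaleR_add_right by simp
    ultimately show "S f - \<kappa> *\<^sub>R T (S f) = f - \<psi> k f *\<^sub>R \<phi> k"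
      by simp
  qed
qed

text \<open>
  A uniform contraction constant gives \<open>dist (p s) (p t) \<le> 2 * dist (\<Phi> s (p t)) (\<Phi> t (p t))\<close>, so continuity in the
  parameter at a fixed point suffices.
\<close>
lemma contraction_family_fixed_points:
  fixes \<Phi> :: "'s::metric_space \<Rightarrow> 'x::complete_space \<Rightarrow> 'x"
  assumes D: "closed D" "D \<noteq> {}"
    and self: "\<And>s x. s \<in> I \<Longrightarrow> x \<in> D \<Longrightarrow> \<Phi> s x \<in> D"
    and lip: "\<And>s x y. s \<in> I \<Longrightarrow> x \<in> D \<Longrightarrow> y \<in> D \<Longrightarrow> dist (\<Phi> s x) (\<Phi> s y) \<le> dist x y / 2"
    and cont: "\<And>x. x \<in> D \<Longrightarrow> continuous_on I (\<lambda>s. \<Phi> s x)"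
  obtains p where "continuous_on I p" "\<And>s. s \<in> I \<Longrightarrow> p s \<in> D" "\<And>s. s \<in> I \<Longrightarrow> \<Phi> s (p s) = p s"
    "\<And>s x. s \<in> I \<Longrightarrow> x \<in> D \<Longrightarrow> \<Phi> s x = x \<Longrightarrow> x = p s"
proof -
  have ex: "\<exists>!x\<in>D. \<Phi> s x = x" if "s \<in> I" for s
    using D self[OF that] lip[OF that]
    by (intro Banach_fix[where c="1 / 2"]) (auto simp: complete_eq_closed)
  then obtain p where p: "\<And>s. s \<in> I \<Longrightarrow> p s \<in> D \<and> \<Phi> s (p s) = p s" by metis
  have "continuous_on I p"
    unfolding continuous_on_def
  proof
    fix s0 assume s0: "s0 \<in> I"
    have "((\<lambda>s. dist (\<Phi> s (p s0)) (\<Phi> s0 (p s0))) \<longlongrightarrow> 0) (at s0 within I)"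
    proof (rule tendsto_dist_iff[THEN iffD1])
      show "((\<lambda>s. \<Phi> s (p s0)) \<longlongrightarrow> \<Phi> s0 (p s0)) (at s0 within I)"
        using cont[of "p s0"] p[OF s0] s0 by (auto simp: continuous_on_def)
    qed
    then have lim: "((\<lambda>s. 2 * dist (\<Phi> s (p s0)) (\<Phi> s0 (p s0))) \<longlongrightarrow> 0) (at s0 within I)"
      using tendsto_mult_right_zero by blast
    have "((\<lambda>s. dist (p s) (p s0)) \<longlongrightarrow> 0) (at s0 within I)"
    proof (rule tendsto_sandwich[OF _ _ tendsto_const lim])
      show "\<forall>\<^sub>F s in at s0 within I. dist (p s) (p s0) \<le> 2 * dist (\<Phi> s (p s0)) (\<Phi> s0 (p s0))"
        unfolding eventually_at_filter
      proof (intro always_eventually allI impI)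
        fix s assume s: "s \<in> I"
        have "dist (p s) (p s0) = dist (\<Phi> s (p s)) (\<Phi> s0 (p s0))" using p s s0 by simp
        also have "\<dots> \<le> dist (\<Phi> s (p s)) (\<Phi> s (p s0)) + dist (\<Phi> s (p s0)) (\<Phi> s0 (p s0))"
          by (rule dist_triangle)
        also have "dist (\<Phi> s (p s)) (\<Phi> s (p s0)) \<le> dist (p s) (p s0) / 2"
          using lip s p s0 by blast
        finally show "dist (p s) (p s0) \<le> 2 * dist (\<Phi> s (p s0)) (\<Phi> s0 (p s0))" by simp
      qed
    qed auto
    then show "(p \<longlongrightarrow> p s0) (at s0 within I)" by (rule tendsto_dist_iff[THEN iffD2])
  qed
  then show ?thesis
  proof (rule that)
    show "\<And>s. s \<in> I \<Longrightarrow> p s \<in> D" "\<And>s. s \<in> I \<Longrightarrow> \<Phi> s (p s) = p s" using p by auto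
    show "x = p s" if "s \<in> I" "x \<in> D" "\<Phi> s x = x" for s x using ex[OF that(1)] p[OF that(1)] that by auto
  qed
qed

text \<open>
  Insert \<open>s (e + z)\<close> with \<open>\<psi> z = 0\<close> for the solution and divide by \<open>s\<close>: with \<open>R = \<Psi> (s a) / s\<close> and
  \<open>a = (\<kappa> + \<mu>) T (e + z)\<close> the equation becomes \<open>e + z = a + R\<close>. Applying \<open>\<psi>\<close> gives \<open>\<mu> = - \<kappa> \<psi> R\<close>, and applying the
  pseudo-inverse \<open>S\<close> of \<open>1 - \<kappa> T\<close> gives \<open>z = S (\<mu> T z + R)\<close>. As \<open>\<Psi>\<close> is quadratically small, \<open>R\<close> is of order \<open>s\<close>, and the
  right hand sides form a contraction of a small ball in the pairs \<open>(\<mu>, z)\<close> when \<open>s\<close> is small.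
\<close>
theorem bifurcation_from_simple_eigenvalue:
  fixes T S \<Psi> :: "'e::banach \<Rightarrow> 'e" and \<psi> :: "'e \<Rightarrow> real" and e :: 'e
  assumes T: "bounded_linear T" and S: "bounded_linear S" and \<psi>: "bounded_linear \<psi>"
    and \<psi>e: "\<psi> e = 1" and Te: "\<kappa> *\<^sub>R T e = e" and \<psi>T: "\<And>x. \<kappa> * \<psi> (T x) = \<psi> x"
    and \<psi>S: "\<And>f. \<psi> (S f) = 0"
    and inverse: "\<And>f. S f - \<kappa> *\<^sub>R T (S f) = f - \<psi> f *\<^sub>R e"
    and \<Psi>0: "\<Psi> 0 = 0" and C: "C \<ge> 0"
    and lip: "\<And>r x y. 0 \<le> r \<Longrightarrow> r \<le> 1 \<Longrightarrow> norm x \<le> r \<Longrightarrow> norm y \<le> r \<Longrightarrow> norm (\<Psi> x - \<Psi> y) \<le> C * r * norm (x - y)"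
  obtains \<delta> :: real and \<mu> :: "real \<Rightarrow> real" and z :: "real \<Rightarrow> 'e"
  where "\<delta> > 0" "continuous_on {-\<delta><..<\<delta>} \<mu>" "continuous_on {-\<delta><..<\<delta>} z" "\<mu> 0 = 0" "z 0 = 0"
    "\<And>s. s \<in> {-\<delta><..<\<delta>} \<Longrightarrow> \<psi> (z s) = 0"
    "\<And>s. s \<in> {-\<delta><..<\<delta>} \<Longrightarrow>
       s *\<^sub>R (e + z s) = (\<kappa> + \<mu> s) *\<^sub>R T (s *\<^sub>R (e + z s)) + \<Psi> ((\<kappa> + \<mu> s) *\<^sub>R T (s *\<^sub>R (e + z s)))"
proof -
  interpret T: bounded_linear T by fact
  interpret S: bounded_linear S by fact
  interpret psi: bounded_linear \<psi> by fact
  obtain t where t: "t > 0" "\<And>x. norm (T x) \<le> norm x * t" using T.pos_bounded by blast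
  obtain u where u: "u > 0" "\<And>x. norm (S x) \<le> norm x * u" using S.pos_bounded by blast
  obtain v where v: "v > 0" "\<And>x. norm (\<psi> x) \<le> norm x * v" using psi.pos_bounded by blast
  define A where "A = (\<bar>\<kappa>\<bar> + 1) * (t * (norm e + 1))"
  define B where "B = t * (norm e + 1) + (\<bar>\<kappa>\<bar> + 1) * t"
  have A: "A \<ge> 0" and B: "B \<ge> 0" using t by (simp_all add: A_def B_def)
  \<comment> \<open>The radius \<open>\<eta>\<close> makes the bilinear term \<open>\<mu> T z\<close> contract, and \<open>\<delta>\<close> makes the terms with \<open>R\<close> contract;
    \<open>M\<close> dominates all constants that occur with a factor \<open>s\<close>.\<close>
  define \<eta> where "\<eta> = min 1 (1 / (32 * u * t))"
  have \<eta>: "\<eta> > 0" "\<eta> \<le> 1" "u * t * \<eta> \<le> 1 / 32"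
  proof -
    have "u * t * \<eta> \<le> u * t * (1 / (32 * u * t))" using t u by (intro mult_left_mono) (auto simp: \<eta>_def)
    then show "u * t * \<eta> \<le> 1 / 32" using t u by simp
  qed (use t u in \<open>auto simp: \<eta>_def\<close>)
  define K where "K = \<bar>\<kappa>\<bar> * v + u"
  have K: "K \<ge> 0" using u v by (simp add: K_def)
  define M where "M = A + K * C * A * B + K * C * A * A"
  have M: "M \<ge> 0" using A B C K by (simp add: M_def)
  define \<delta> where "\<delta> = \<eta> / (32 * (1 + M))"
  have \<delta>: "\<delta> > 0" using \<eta> M by (simp add: \<delta>_def)
  have "M * \<delta> \<le> \<eta> / 32"
  proof -
    have "M * \<delta> = (\<eta> / 32) * (M / (1 + M))" by (simp add: \<delta>_def)
    also have "\<dots> \<le> (\<eta> / 32) * 1" using M \<eta> by (intro mult_left_mono) auto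
    finally show ?thesis by simp
  qed
  then have small: "c * \<bar>s\<bar> \<le> \<eta> / 32" if "\<bar>s\<bar> < \<delta>" "0 \<le> c" "c \<le> M" for s c
    using mult_mono[of c M "\<bar>s\<bar>" \<delta>] that M by linarith
  have AM: "A \<le> M" "K * C * A * B \<le> M" "K * C * A * A \<le> M" using A B C K by (simp_all add: M_def)
  define I where "I = {-\<delta><..<\<delta>}"
  define D where "D = cball (0::real) \<eta> \<times> cball (0::'e) \<eta>"
  define a where "a \<mu> z = (\<kappa> + \<mu>) *\<^sub>R T (e + z)" for \<mu> z
  \<comment> \<open>For \<open>s = 0\<close> the convention \<open>1 / 0 = 0\<close> makes \<open>R\<close> vanish, which is its limit for \<open>s \<rightarrow> 0\<close>.\<close>
  define R where "R s x = (1 / s) *\<^sub>R \<Psi> (s *\<^sub>R x)" for s :: real and x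
  define \<Phi> where "\<Phi> s p = (- \<kappa> * \<psi> (R s (a (fst p) (snd p))),
      S (fst p *\<^sub>R T (snd p) + R s (a (fst p) (snd p))))" for s p
  have aA: "norm (a \<mu> z) \<le> A" if "\<bar>\<mu>\<bar> \<le> \<eta>" "norm z \<le> \<eta>" for \<mu> z
  proof -
    have "norm (T (e + z)) \<le> t * (norm e + 1)"
      using t(2)[of "e + z"] norm_triangle_ineq[of e z] that \<eta> t(1)
      by (metis (no_types, opaque_lifting) add_left_mono mult.commute mult_left_mono less_imp_le order_trans)
    then show ?thesis unfolding a_def A_def norm_scaleR
      using that \<eta> by (intro mult_mono) auto
  qed
  have aB: "norm (a \<mu> z - a \<mu>' z') \<le> B * (\<bar>\<mu> - \<mu>'\<bar> + norm (z - z'))"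
    if "\<bar>\<mu>'\<bar> \<le> \<eta>" "norm z \<le> \<eta>" for \<mu> z \<mu>' z'
  proof -
    have eq: "a \<mu> z - a \<mu>' z' = (\<mu> - \<mu>') *\<^sub>R T (e + z) + (\<kappa> + \<mu>') *\<^sub>R T (z - z')"
      by (simp add: a_def T.add T.diff algebra_simps)
    have "norm (T (e + z)) \<le> t * (norm e + 1)"
      using t(2)[of "e + z"] norm_triangle_ineq[of e z] that \<eta> t(1)
      by (metis (no_types, opaque_lifting) add_left_mono mult.commute mult_left_mono less_imp_le order_trans)
    then have 1: "norm ((\<mu> - \<mu>') *\<^sub>R T (e + z)) \<le> \<bar>\<mu> - \<mu>'\<bar> * (t * (norm e + 1))"
      by (simp add: mult_left_mono)
    have "\<bar>\<kappa> + \<mu>'\<bar> \<le> \<bar>\<kappa>\<bar> + 1" using that \<eta> by linarith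
    then have 2: "norm ((\<kappa> + \<mu>') *\<^sub>R T (z - z')) \<le> (\<bar>\<kappa>\<bar> + 1) * (norm (z - z') * t)"
      unfolding norm_scaleR by (intro mult_mono t(2)) auto
    have "norm (a \<mu> z - a \<mu>' z') \<le> \<bar>\<mu> - \<mu>'\<bar> * (t * (norm e + 1)) + (\<bar>\<kappa>\<bar> + 1) * (norm (z - z') * t)"
      unfolding eq using norm_triangle_le[OF add_mono[OF 1 2]] .
    also have "\<dots> \<le> B * (\<bar>\<mu> - \<mu>'\<bar> + norm (z - z'))"
    proof -
      have "0 \<le> (\<bar>\<kappa>\<bar> + 1) * t * \<bar>\<mu> - \<mu>'\<bar> + t * (norm e + 1) * norm (z - z')"
        using t by simp
      then show ?thesis by (simp add: B_def algebra_simps)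
    qed
    finally show ?thesis .
  qed
  have R_lip: "norm (R s x - R s y) \<le> C * A * \<bar>s\<bar> * norm (x - y)" if "\<bar>s\<bar> < \<delta>" "norm x \<le> A" "norm y \<le> A" for s x y
  proof (cases "s = 0")
    case False
    have "norm (R s x - R s y) = (1 / \<bar>s\<bar>) * norm (\<Psi> (s *\<^sub>R x) - \<Psi> (s *\<^sub>R y))"
      by (simp add: R_def scaleR_diff_right[symmetric])
    also have "\<dots> \<le> (1 / \<bar>s\<bar>) * (C * (A * \<bar>s\<bar>) * norm (s *\<^sub>R x - s *\<^sub>R y))"
    proof (intro mult_left_mono lip)
      show "A * \<bar>s\<bar> \<le> 1" using small[OF that(1) A AM(1)] \<eta> by simp
      show "norm (s *\<^sub>R x) \<le> A * \<bar>s\<bar>" "norm (s *\<^sub>R y) \<le> A * \<bar>s\<bar>"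
        using mult_right_mono[OF that(2), of "\<bar>s\<bar>"] mult_right_mono[OF that(3), of "\<bar>s\<bar>"]
        by (simp_all add: mult.commute)
    qed (use A in auto)
    also have "\<dots> = C * A * \<bar>s\<bar> * norm (x - y)"
      using False by (simp add: scaleR_diff_right[symmetric])
    finally show ?thesis .
  qed (simp add: R_def)
  have R_0: "R s 0 = 0" for s by (simp add: R_def \<Psi>0)
  have R_bound: "norm (R s x) \<le> C * A * \<bar>s\<bar> * A" if "\<bar>s\<bar> < \<delta>" "norm x \<le> A" for s x
  proof -
    have "norm (R s x) \<le> C * A * \<bar>s\<bar> * norm x" using R_lip[OF that, of 0] A by (simp add: R_0)
    also have "\<dots> \<le> C * A * \<bar>s\<bar> * A" using that A C by (intro mult_left_mono) auto
    finally show ?thesis .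
  qed
  have kpsi: "\<bar>\<kappa> * \<psi> x\<bar> \<le> K * norm x" for x
  proof -
    have "\<bar>\<kappa> * \<psi> x\<bar> \<le> \<bar>\<kappa>\<bar> * (norm x * v)" using v(2)[of x] by (simp add: abs_mult mult_left_mono)
    also have "\<dots> \<le> K * norm x" using u by (simp add: K_def algebra_simps)
    finally show ?thesis .
  qed
  have Sb: "norm (S x) \<le> K * norm x" for x
  proof -
    have "norm (S x) \<le> u * norm x" using u(2)[of x] by (simp add: mult.commute)
    also have "\<dots> \<le> K * norm x" using v by (intro mult_right_mono) (auto simp: K_def)
    finally show ?thesis .
  qed
  have self: "\<Phi> s p \<in> D" if s: "s \<in> I" and p: "p \<in> D" for s p
  proof -
    obtain \<mu> z where [simp]: "p = (\<mu>, z)" by (cases p)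
    have s': "\<bar>s\<bar> < \<delta>" and b: "\<bar>\<mu>\<bar> \<le> \<eta>" "norm z \<le> \<eta>" using s p by (auto simp: I_def D_def)
    have R1: "K * norm (R s (a \<mu> z)) \<le> \<eta> / 32"
    proof -
      have "K * norm (R s (a \<mu> z)) \<le> K * (C * A * \<bar>s\<bar> * A)"
        by (rule mult_left_mono[OF R_bound[OF s' aA[OF b]] K])
      also have "\<dots> = K * C * A * A * \<bar>s\<bar>" by (simp add: mult_ac)
      also have "\<dots> \<le> \<eta> / 32" by (rule small[OF s' _ AM(3)]) (use K C A in simp)
      finally show ?thesis .
    qed
    have "\<bar>- \<kappa> * \<psi> (R s (a \<mu> z))\<bar> \<le> \<eta>" using kpsi[of "R s (a \<mu> z)"] R1 \<eta> by simp
    moreover have "norm (S (\<mu> *\<^sub>R T z + R s (a \<mu> z))) \<le> \<eta>"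
    proof -
      have "norm (S (\<mu> *\<^sub>R T z)) \<le> norm (\<mu> *\<^sub>R T z) * u" by (rule u(2))
      also have "\<dots> \<le> (\<eta> * (\<eta> * t)) * u"
        unfolding norm_scaleR using b \<eta> t u
        by (intro mult_right_mono mult_mono order.trans[OF t(2)]) auto
      also have "\<dots> = \<eta> * (u * t * \<eta>)" by (simp add: mult_ac)
      also have "\<dots> \<le> \<eta> * (1 / 32)" using \<eta> by (intro mult_left_mono) auto
      finally have "norm (S (\<mu> *\<^sub>R T z)) \<le> \<eta> / 32" by simp
      moreover have "norm (S (R s (a \<mu> z))) \<le> \<eta> / 32" using Sb[of "R s (a \<mu> z)"] R1 by linarith
      ultimately show ?thesis
        unfolding S.add using norm_triangle_ineq[of "S (\<mu> *\<^sub>R T z)" "S (R s (a \<mu> z))"] \<eta> by linarith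
    qed
    ultimately show ?thesis by (simp add: \<Phi>_def D_def)
  qed
  have contr: "dist (\<Phi> s p) (\<Phi> s q) \<le> dist p q / 2" if s: "s \<in> I" and p: "p \<in> D" and q: "q \<in> D" for s p q
  proof -
    obtain \<mu> z where [simp]: "p = (\<mu>, z)" by (cases p)
    obtain \<mu>' z' where [simp]: "q = (\<mu>', z')" by (cases q)
    have s': "\<bar>s\<bar> < \<delta>" and b: "\<bar>\<mu>\<bar> \<le> \<eta>" "norm z \<le> \<eta>" and b': "\<bar>\<mu>'\<bar> \<le> \<eta>" "norm z' \<le> \<eta>"
      using s p q by (auto simp: I_def D_def)
    \<comment> \<open>The estimates use the sum norm of the pair, which is at most twice the norm of the product.\<close>
    define E where "E = \<bar>\<mu> - \<mu>'\<bar> + norm (z - z')"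
    have E: "E \<ge> 0" by (simp add: E_def)
    have Ed: "E \<le> 2 * dist p q"
      using dist_fst_le[of p q] dist_snd_le[of p q] by (simp add: E_def dist_norm)
    define \<Delta> where "\<Delta> = R s (a \<mu> z) - R s (a \<mu>' z')"
    have \<Delta>: "K * norm \<Delta> \<le> E / 32"
    proof -
      have "norm \<Delta> \<le> C * A * \<bar>s\<bar> * norm (a \<mu> z - a \<mu>' z')"
        unfolding \<Delta>_def by (rule R_lip[OF s' aA[OF b] aA[OF b']])
      also have "\<dots> \<le> C * A * \<bar>s\<bar> * (B * E)"
        unfolding E_def using C A by (intro mult_left_mono aB b b') auto
      finally have "K * norm \<Delta> \<le> K * (C * A * \<bar>s\<bar> * (B * E))" by (rule mult_left_mono[OF _ K])
      also have "\<dots> = (K * C * A * B * \<bar>s\<bar>) * E" by (simp add: mult_ac)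
      also have "\<dots> \<le> (1 / 32) * E"
      proof (rule mult_right_mono[OF _ E])
        have "K * C * A * B * \<bar>s\<bar> \<le> \<eta> / 32" by (rule small[OF s' _ AM(2)]) (use K C A B in simp)
        then show "K * C * A * B * \<bar>s\<bar> \<le> 1 / 32" using \<eta> by simp
      qed
      finally show ?thesis by simp
    qed
    have 1: "\<bar>fst (\<Phi> s p) - fst (\<Phi> s q)\<bar> \<le> E / 32"
    proof -
      have "fst (\<Phi> s p) - fst (\<Phi> s q) = - (\<kappa> * \<psi> \<Delta>)"
        by (simp add: \<Phi>_def \<Delta>_def psi.diff algebra_simps)
      then show ?thesis using kpsi[of \<Delta>] \<Delta> by simp
    qed
    have 2: "norm (snd (\<Phi> s p) - snd (\<Phi> s q)) \<le> E / 16"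
    proof -
      have eq: "snd (\<Phi> s p) - snd (\<Phi> s q) = S ((\<mu> - \<mu>') *\<^sub>R T z + \<mu>' *\<^sub>R T (z - z')) + S \<Delta>"
        by (simp add: \<Phi>_def \<Delta>_def S.diff[symmetric] S.add[symmetric] T.diff algebra_simps)
      have n1: "norm ((\<mu> - \<mu>') *\<^sub>R T z) \<le> \<bar>\<mu> - \<mu>'\<bar> * (\<eta> * t)"
        unfolding norm_scaleR using b t by (intro mult_left_mono order.trans[OF t(2)] mult_right_mono) auto
      have n2: "norm (\<mu>' *\<^sub>R T (z - z')) \<le> \<eta> * (norm (z - z') * t)"
        unfolding norm_scaleR using b' t \<eta> by (intro mult_mono t(2)) auto
      have "norm ((\<mu> - \<mu>') *\<^sub>R T z + \<mu>' *\<^sub>R T (z - z')) \<le> \<eta> * t * E"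
        using norm_triangle_le[OF add_mono[OF n1 n2]] by (simp add: E_def algebra_simps)
      then have "norm (S ((\<mu> - \<mu>') *\<^sub>R T z + \<mu>' *\<^sub>R T (z - z'))) \<le> \<eta> * t * E * u"
        using u by (meson mult_right_mono less_imp_le order_trans)
      also have "\<dots> = (u * t * \<eta>) * E" by (simp add: mult_ac)
      also have "\<dots> \<le> (1 / 32) * E" using \<eta>(3) E by (intro mult_right_mono)
      finally have "norm (S ((\<mu> - \<mu>') *\<^sub>R T z + \<mu>' *\<^sub>R T (z - z'))) \<le> E / 32" by simp
      moreover have "norm (S \<Delta>) \<le> E / 32" using Sb[of \<Delta>] \<Delta> by linarith
      ultimately show ?thesis unfolding eq
        using norm_triangle_ineq[of "S ((\<mu> - \<mu>') *\<^sub>R T z + \<mu>' *\<^sub>R T (z - z'))" "S \<Delta>"] by linarith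
    qed
    have "dist (\<Phi> s p) (\<Phi> s q) = norm (fst (\<Phi> s p) - fst (\<Phi> s q), snd (\<Phi> s p) - snd (\<Phi> s q))"
      by (simp add: dist_norm minus_prod_def)
    also have "\<dots> \<le> \<bar>fst (\<Phi> s p) - fst (\<Phi> s q)\<bar> + norm (snd (\<Phi> s p) - snd (\<Phi> s q))"
      using norm_Pair_le[of "fst (\<Phi> s p) - fst (\<Phi> s q)" "snd (\<Phi> s p) - snd (\<Phi> s q)"] by simp
    also have "\<dots> \<le> E / 4" using 1 2 E by linarith
    also have "\<dots> \<le> dist p q / 2" using Ed by linarith
    finally show ?thesis .
  qed
  have R_cont: "continuous_on I (\<lambda>s. R s x)" if x: "norm x \<le> A" for x
  proof (rule continuous_at_imp_continuous_on, rule ballI)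
    fix s0 assume s0: "s0 \<in> I"
    have "open I" by (simp add: I_def)
    show "isCont (\<lambda>s. R s x) s0"
    proof (cases "s0 = 0")
      case True
      have "((\<lambda>s. R s x) \<longlongrightarrow> 0) (at 0)"
      proof (rule Lim_null_comparison)
        have "\<forall>\<^sub>F s in at 0. s \<in> I" using \<open>open I\<close> s0 True by (auto intro: eventually_at_in_open')
        then show "\<forall>\<^sub>F s in at 0. norm (R s x) \<le> C * A * \<bar>s\<bar> * A"
          by eventually_elim (use R_bound x in \<open>auto simp: I_def\<close>)
        have "((\<lambda>s::real. C * A * \<bar>s\<bar> * A) \<longlongrightarrow> C * A * \<bar>0\<bar> * A) (at 0)" by (intro tendsto_intros)
        then show "((\<lambda>s::real. C * A * \<bar>s\<bar> * A) \<longlongrightarrow> 0) (at 0)" by simp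
      qed
      then show ?thesis using True by (simp add: isCont_def R_def)
    next
      case False
      have \<Psi>_cont: "continuous_on (cball 0 1) \<Psi>"
        unfolding continuous_on_iff
      proof (intro ballI allI impI)
        fix x :: 'e and \<epsilon> assume x: "x \<in> cball 0 1" and \<epsilon>: "\<epsilon> > (0::real)"
        show "\<exists>d>0. \<forall>y\<in>cball 0 1. dist y x < d \<longrightarrow> dist (\<Psi> y) (\<Psi> x) < \<epsilon>"
        proof (intro exI[of _ "\<epsilon> / (C + 1)"] conjI ballI impI)
          fix y :: 'e assume y: "y \<in> cball 0 1" "dist y x < \<epsilon> / (C + 1)"
          have "dist (\<Psi> y) (\<Psi> x) \<le> C * dist y x"
            using lip[of 1 y x] x y(1) by (simp add: dist_norm)
          also have "\<dots> \<le> (C + 1) * dist y x" by (simp add: distrib_right)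
          also have "\<dots> < \<epsilon>" using y(2) C by (simp add: pos_less_divide_eq mult.commute)
          finally show "dist (\<Psi> y) (\<Psi> x) < \<epsilon>" .
        qed (use \<epsilon> C in simp)
      qed
      have in_ball: "s *\<^sub>R x \<in> cball 0 1" if "s \<in> I" for s
      proof -
        have "\<bar>s\<bar> * norm x \<le> A * \<bar>s\<bar>" using mult_right_mono[OF x, of "\<bar>s\<bar>"] by (simp add: mult.commute)
        moreover have "\<bar>s\<bar> < \<delta>" using that by (auto simp: I_def)
        ultimately show ?thesis using small[of s A] A AM(1) \<eta> by simp
      qed
      have "continuous_on (I - {0}) (\<lambda>s. \<Psi> (s *\<^sub>R x))"
        by (rule continuous_on_compose2[OF \<Psi>_cont])
           (use in_ball in \<open>auto intro!: continuous_on_scaleR continuous_on_id continuous_on_const simp del: mem_cball_0\<close>)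
      then have "continuous_on (I - {0}) (\<lambda>s. R s x)"
        unfolding R_def by (intro continuous_on_scaleR continuous_on_divide continuous_on_const continuous_on_id) auto
      moreover have "open (I - {0})" "s0 \<in> I - {0}" using \<open>open I\<close> s0 False by (auto intro: open_Diff)
      ultimately show ?thesis by (simp add: continuous_on_eq_continuous_at)
    qed
  qed
  have cont: "continuous_on I (\<lambda>s. \<Phi> s p)" if p: "p \<in> D" for p
  proof -
    have "norm (a (fst p) (snd p)) \<le> A" using p by (intro aA) (auto simp: D_def)
    note Rc = R_cont[OF this]
    show ?thesis unfolding \<Phi>_def
      by (intro continuous_intros psi.continuous_on S.continuous_on Rc)
  qed
  have D_closed: "closed D" and D_nonempty: "D \<noteq> {}"
    using \<eta> by (auto simp: D_def intro!: closed_Times)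
  obtain p where p: "continuous_on I p" "\<And>s. s \<in> I \<Longrightarrow> p s \<in> D" "\<And>s. s \<in> I \<Longrightarrow> \<Phi> s (p s) = p s"
    "\<And>s x. s \<in> I \<Longrightarrow> x \<in> D \<Longrightarrow> \<Phi> s x = x \<Longrightarrow> x = p s"
    by (rule contraction_family_fixed_points[OF D_closed D_nonempty self contr cont]) (assumption | blast)+
  have "0 \<in> I" using \<delta> by (simp add: I_def)
  then have "(0, 0) = p 0"
    using \<eta> by (intro p(4)) (auto simp: D_def \<Phi>_def R_def T.zero S.zero psi.zero)
  show ?thesis
  proof (rule that[of \<delta> "\<lambda>s. fst (p s)" "\<lambda>s. snd (p s)"])
    show "continuous_on {-\<delta><..<\<delta>} (\<lambda>s. fst (p s))" "continuous_on {-\<delta><..<\<delta>} (\<lambda>s. snd (p s))"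
      using p(1) unfolding I_def by (auto intro: continuous_intros)
    show "fst (p 0) = 0" "snd (p 0) = 0" using \<open>(0, 0) = p 0\<close> by (metis fst_conv, metis snd_conv)
    fix s assume "s \<in> {-\<delta><..<\<delta>}"
    then have s: "s \<in> I" by (simp add: I_def)
    define \<mu> z where "\<mu> = fst (p s)" and "z = snd (p s)"
    define \<rho> where "\<rho> = R s (a \<mu> z)"
    have \<mu>: "\<mu> = - \<kappa> * \<psi> \<rho>" and z: "z = S (\<mu> *\<^sub>R T z + \<rho>)"
      using p(3)[OF s] by (auto simp: \<Phi>_def \<mu>_def z_def \<rho>_def prod_eq_iff)
    show psiz: "\<psi> (snd (p s)) = 0" using z \<psi>S by (metis z_def)
    have \<kappa>0: "\<kappa> \<noteq> 0" using Te \<psi>e psi.zero by auto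
    have "z - \<kappa> *\<^sub>R T z = (\<mu> *\<^sub>R T z + \<rho>) - \<psi> (\<mu> *\<^sub>R T z + \<rho>) *\<^sub>R e"
      using inverse[of "\<mu> *\<^sub>R T z + \<rho>"] by (simp add: z[symmetric])
    moreover have "\<psi> (\<mu> *\<^sub>R T z + \<rho>) = - \<mu> / \<kappa>"
    proof -
      have "\<psi> (T z) = 0" using \<psi>T[of z] psiz \<kappa>0 by (simp add: z_def)
      moreover have "\<psi> (\<mu> *\<^sub>R T z + \<rho>) = \<mu> * \<psi> (T z) + \<psi> \<rho>"
        by (simp only: psi.add psi.scaleR real_scaleR_def)
      moreover have "\<psi> \<rho> = - \<mu> / \<kappa>" using \<mu> \<kappa>0 by simp
      ultimately show ?thesis by simp
    qed
    moreover have "(\<mu> / \<kappa>) *\<^sub>R e = \<mu> *\<^sub>R T e"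
    proof -
      have "(\<mu> / \<kappa>) *\<^sub>R e = (\<mu> / \<kappa>) *\<^sub>R (\<kappa> *\<^sub>R T e)" by (simp only: Te)
      then show ?thesis using \<kappa>0 by simp
    qed
    ultimately have "e + z = (\<kappa> + \<mu>) *\<^sub>R T (e + z) + \<rho>"
      using Te by (simp add: T.add algebra_simps)
    then have main: "s *\<^sub>R (e + z) = s *\<^sub>R a \<mu> z + s *\<^sub>R \<rho>"
      by (metis scaleR_add_right a_def)
    have psi_s: "s *\<^sub>R \<rho> = \<Psi> (s *\<^sub>R a \<mu> z)"
      by (cases "s = 0") (simp_all add: \<rho>_def R_def \<Psi>0)
    have arg: "(\<kappa> + \<mu>) *\<^sub>R T (s *\<^sub>R (e + z)) = s *\<^sub>R a \<mu> z"
      by (simp add: T.scaleR a_def mult.commute)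
    show "s *\<^sub>R (e + snd (p s)) = (\<kappa> + fst (p s)) *\<^sub>R T (s *\<^sub>R (e + snd (p s)))
        + \<Psi> ((\<kappa> + fst (p s)) *\<^sub>R T (s *\<^sub>R (e + snd (p s))))"
      using main unfolding \<mu>_def[symmetric] z_def[symmetric] arg psi_s .
  qed (use \<delta> in auto)
qed

section \<open>Convolution with zonal functions and the Funk--Hecke formula\<close>

text \<open>
  Dominated convergence along sequences; a convergent sequence with its limit is compact, which gives the
  bound.
\<close>
lemma continuous_on_sphere_parametric_integral:
  fixes g :: "'b::euclidean_space \<Rightarrow> 'a::euclidean_space \<Rightarrow> real"
  assumes g: "continuous_on (K \<times> sphere 0 1) (\<lambda>(s, y). g s y)"
  shows "continuous_on K (\<lambda>s. \<integral>y. g s y \<partial>sphere_measure)"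
proof (rule continuous_on_sequentiallyI)
  fix u :: "nat \<Rightarrow> 'b" and a assume u: "\<forall>n. u n \<in> K" "a \<in> K" "u \<longlonglongrightarrow> a"
  have "compact (insert a (range u) \<times> sphere (0::'a) 1)"
    by (intro compact_Times compact_sequence_with_limit u compact_sphere)
  then have "compact ((\<lambda>(s, y). g s y) ` (insert a (range u) \<times> sphere 0 1))"
    using u by (intro compact_continuous_image continuous_on_subset[OF g]) auto
  then have "bounded ((\<lambda>(s, y). g s y) ` (insert a (range u) \<times> sphere 0 1))"
    by (rule compact_imp_bounded)
  then obtain B where B0: "\<And>p. p \<in> insert a (range u) \<times> sphere 0 1 \<Longrightarrow> norm ((\<lambda>(s, y). g s y) p) \<le> B"
    unfolding bounded_iff by blast
  have B: "norm (g s y) \<le> B" if "s \<in> insert a (range u)" "y \<in> sphere 0 1" for s y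
    using B0[of "(s, y)"] that by simp
  have gs: "continuous_on (sphere 0 1) (g s)" if "s \<in> K" for s
  proof -
    have "continuous_on (sphere 0 1) (\<lambda>y. (\<lambda>(s, y). g s y) (s, y))"
      by (rule continuous_on_compose2[OF g]) (use that in \<open>auto intro!: continuous_on_Pair continuous_on_const continuous_on_id\<close>)
    then show ?thesis by simp
  qed
  show "(\<lambda>n. \<integral>y. g (u n) y \<partial>sphere_measure) \<longlonglongrightarrow> (\<integral>y. g a y \<partial>sphere_measure)"
  proof (rule integral_dominated_convergence[where w="\<lambda>_. B"])
    show "AE y in sphere_measure. (\<lambda>n. g (u n) y) \<longlonglongrightarrow> g a y"
    proof (intro AE_I2)
      fix y :: 'a assume y: "y \<in> space sphere_measure"
      have "(\<lambda>n. (u n, y)) \<longlonglongrightarrow> (a, y)" using u by (intro tendsto_intros)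
      from continuous_on_tendsto_compose[OF g this]
      have "(\<lambda>n. (\<lambda>(s, y). g s y) (u n, y)) \<longlonglongrightarrow> (\<lambda>(s, y). g s y) (a, y)"
        using u y by simp
      then show "(\<lambda>n. g (u n) y) \<longlonglongrightarrow> g a y" by simp
    qed
  qed (use B u gs in \<open>auto intro: borel_measurable_sphere_continuous\<close>)
qed

text \<open>
  Continuous functions on the product of two spheres are measurable for the product measure.
\<close>
lemma sets_sphere_pair:
  "sets (sphere_measure \<Otimes>\<^sub>M sphere_measure :: ('a::euclidean_space \<times> 'b::euclidean_space) measure)
    = sets (restrict_space borel (sphere 0 1 \<times> sphere 0 1))"
proof -
  have "sets (sphere_measure \<Otimes>\<^sub>M sphere_measure :: ('a \<times> 'b) measure)
      = sets (restrict_space borel (sphere (0::'a) 1) \<Otimes>\<^sub>M restrict_space borel (sphere (0::'b) 1))"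
    by (rule sets_pair_measure_cong) simp_all
  also have "\<dots> = sets (restrict_space (borel \<Otimes>\<^sub>M borel) (sphere (0::'a) 1 \<times> sphere (0::'b) 1))"
  proof -
    let ?A = "restrict_space borel (sphere (0::'a) 1)" and ?B = "restrict_space borel (sphere (0::'b) 1)"
    have "(\<lambda>x. x) \<in> ?A \<Otimes>\<^sub>M ?B \<rightarrow>\<^sub>M restrict_space (borel \<Otimes>\<^sub>M borel) (sphere 0 1 \<times> sphere 0 1)"
    proof (rule measurable_restrict_space2)
      have "fst \<in> ?A \<Otimes>\<^sub>M ?B \<rightarrow>\<^sub>M borel" "snd \<in> ?A \<Otimes>\<^sub>M ?B \<rightarrow>\<^sub>M borel"
        by (auto intro: measurable_compose[OF measurable_fst measurable_restrict_space1] measurable_compose[OF measurable_snd measurable_restrict_space1])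
      then have "(\<lambda>x. (fst x, snd x)) \<in> ?A \<Otimes>\<^sub>M ?B \<rightarrow>\<^sub>M borel \<Otimes>\<^sub>M borel" by (rule measurable_Pair)
      then show "(\<lambda>x. x) \<in> ?A \<Otimes>\<^sub>M ?B \<rightarrow>\<^sub>M borel \<Otimes>\<^sub>M borel" by simp
    qed (auto simp: space_pair_measure space_restrict_space)
    moreover have "(\<lambda>x. x) \<in> restrict_space (borel \<Otimes>\<^sub>M borel) (sphere 0 1 \<times> sphere 0 1) \<rightarrow>\<^sub>M ?A \<Otimes>\<^sub>M ?B"
    proof -
      let ?R = "restrict_space (borel \<Otimes>\<^sub>M borel) (sphere (0::'a) 1 \<times> sphere (0::'b) 1)"
      have "fst \<in> ?R \<rightarrow>\<^sub>M ?A"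
        by (rule measurable_restrict_space2) (auto simp: space_restrict_space intro: measurable_restrict_space1)
      moreover have "snd \<in> ?R \<rightarrow>\<^sub>M ?B"
        by (rule measurable_restrict_space2) (auto simp: space_restrict_space intro: measurable_restrict_space1)
      ultimately have "(\<lambda>x. (fst x, snd x)) \<in> ?R \<rightarrow>\<^sub>M ?A \<Otimes>\<^sub>M ?B" by (rule measurable_Pair)
      then show ?thesis by simp
    qed
    moreover have sp: "space (?A \<Otimes>\<^sub>M ?B) = sphere 0 1 \<times> sphere 0 1"
      "space (restrict_space (borel \<Otimes>\<^sub>M borel) (sphere (0::'a) 1 \<times> sphere (0::'b) 1)) = sphere 0 1 \<times> sphere 0 1"
      by (auto simp: space_pair_measure space_restrict_space)
    ultimately show ?thesis
    proof (intro subset_antisym subsetI)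
      fix X assume m: "(\<lambda>x. x) \<in> restrict_space (borel \<Otimes>\<^sub>M borel) (sphere 0 1 \<times> sphere 0 1) \<rightarrow>\<^sub>M ?A \<Otimes>\<^sub>M ?B"
        and X: "X \<in> sets (?A \<Otimes>\<^sub>M ?B)"
      have "X \<subseteq> sphere 0 1 \<times> sphere 0 1" using sets.sets_into_space[OF X] sp by simp
      then show "X \<in> sets (restrict_space (borel \<Otimes>\<^sub>M borel) (sphere (0::'a) 1 \<times> sphere (0::'b) 1))"
        using measurable_sets[OF m X] sp(2) by (simp add: Int_absorb2)
    next
      fix X assume m: "(\<lambda>x. x) \<in> ?A \<Otimes>\<^sub>M ?B \<rightarrow>\<^sub>M restrict_space (borel \<Otimes>\<^sub>M borel) (sphere 0 1 \<times> sphere 0 1)"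
        and X: "X \<in> sets (restrict_space (borel \<Otimes>\<^sub>M borel) (sphere (0::'a) 1 \<times> sphere (0::'b) 1))"
      have "X \<subseteq> sphere 0 1 \<times> sphere 0 1" using sets.sets_into_space[OF X] sp by simp
      then show "X \<in> sets (?A \<Otimes>\<^sub>M ?B)"
        using measurable_sets[OF m X] sp(1) by (simp add: Int_absorb2)
    qed
  qed
  finally show ?thesis by (simp add: borel_prod)
qed

lemma finite_measure_sphere_pair:
  "finite_measure (sphere_measure \<Otimes>\<^sub>M sphere_measure :: ('a::euclidean_space \<times> 'b::euclidean_space) measure)"
proof (rule finite_measureI)
  have "emeasure (sphere_measure \<Otimes>\<^sub>M sphere_measure) (sphere (0::'a) 1 \<times> sphere (0::'b) 1)
     = emeasure (sphere_measure :: 'a measure) (sphere 0 1) * emeasure (sphere_measure :: 'b measure) (sphere 0 1)"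
    using sets.top[of "sphere_measure :: 'a measure"] sets.top[of "sphere_measure :: 'b measure"]
    by (intro sphere_measure.emeasure_pair_measure_Times) simp_all
  also have "\<dots> < \<infinity>"
    using emeasure_sphere_finite[where 'a='a] emeasure_sphere_finite[where 'a='b]
    by (simp add: ennreal_mult_less_top)
  finally show "emeasure (sphere_measure \<Otimes>\<^sub>M sphere_measure :: ('a \<times> 'b) measure) (space (sphere_measure \<Otimes>\<^sub>M sphere_measure)) \<noteq> \<infinity>"
    by (simp add: space_pair_measure less_top[symmetric])
qed

lemma borel_measurable_sphere_pair_continuous:
  fixes g :: "'a::euclidean_space \<times> 'b::euclidean_space \<Rightarrow> 'c::{second_countable_topology, real_normed_vector}"
  assumes "continuous_on (sphere 0 1 \<times> sphere 0 1) g"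
  shows "g \<in> borel_measurable (sphere_measure \<Otimes>\<^sub>M sphere_measure)"
  using borel_measurable_continuous_on_restrict[OF assms]
  by (subst measurable_cong_sets[OF sets_sphere_pair refl])

lemma integrable_sphere_pair_continuous:
  fixes g :: "'a::euclidean_space \<times> 'b::euclidean_space \<Rightarrow> 'c::{second_countable_topology, banach}"
  assumes g: "continuous_on (sphere 0 1 \<times> sphere 0 1) g"
  shows "integrable (sphere_measure \<Otimes>\<^sub>M sphere_measure) g"
proof -
  have "compact (g ` (sphere 0 1 \<times> sphere 0 1))"
    by (intro compact_continuous_image g compact_Times compact_sphere)
  then have "bounded (g ` (sphere 0 1 \<times> sphere 0 1))"
    by (rule compact_imp_bounded)
  then obtain B where B: "\<And>x. x \<in> sphere 0 1 \<times> sphere 0 1 \<Longrightarrow> norm (g x) \<le> B"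
    unfolding bounded_iff by blast
  interpret finite_measure "sphere_measure \<Otimes>\<^sub>M sphere_measure :: ('a \<times> 'b) measure"
    by (rule finite_measure_sphere_pair)
  show ?thesis
    using B by (intro integrable_const_bound[where B=B] borel_measurable_sphere_pair_continuous[OF g] AE_I2)
      (auto simp: space_pair_measure)
qed

text \<open>
  The vector \<open>e\<close> is the pole; \<open>d\<close> serves to pick one point on each circle of latitude. The numbers \<open>lam\<close> and \<open>area\<close>
  are parameters because constants that depend on the type \<open>'a\<close> alone would need a type argument.
\<close>
locale zonal_frame =
  fixes e d :: "'a::euclidean_space" and lam area :: real
  assumes lam_def: "lam = (real DIM('a) - 2) / 2" and area_def: "area = sphere_area TYPE('a)"
    and e: "e \<in> Basis" and d: "d \<in> Basis" and ed: "e \<noteq> d" and dim: "DIM('a) \<ge> 3"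
begin

lemma norm_e [simp]: "norm e = 1" and norm_d [simp]: "norm d = 1" and inner_ed [simp]: "e \<bullet> d = 0"
  and inner_de [simp]: "d \<bullet> e = 0" and inner_ee [simp]: "e \<bullet> e = 1" and inner_dd [simp]: "d \<bullet> d = 1"
  using e d ed by (auto simp: inner_Basis)

lemma lam_pos: "lam > 0" using dim by (simp add: lam_def)

lemma area_pos: "area > 0" by (simp add: area_def sphere_area_pos)

definition meridian :: "real \<Rightarrow> 'a" where
  "meridian s = s *\<^sub>R e + sqrt (1 - s\<^sup>2) *\<^sub>R d"

lemma meridian_inner [simp]: "meridian s \<bullet> e = s" "y \<bullet> meridian s = s * (y \<bullet> e) + sqrt (1 - s\<^sup>2) * (y \<bullet> d)"
  by (simp_all add: meridian_def inner_add_left inner_add_right)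

lemma norm_meridian [simp]: "s \<in> {-1..1} \<Longrightarrow> norm (meridian s) = 1"
proof -
  assume "s \<in> {-1..1}"
  then have "s\<^sup>2 \<le> 1" using abs_square_le_1[of s] by (simp add: abs_le_iff)
  then have "meridian s \<bullet> meridian s = 1"
    by (simp add: meridian_def inner_add_left inner_add_right power2_eq_square[symmetric])
  then show ?thesis by (simp add: norm_eq_1)
qed

lemma meridian_1 [simp]: "meridian 1 = e" by (simp add: meridian_def)

lemma continuous_on_meridian: "continuous_on S meridian"
  unfolding meridian_def[abs_def] by (intro continuous_intros)

text \<open>
  The convolution of the kernel \<open>h (x \<bullet> y)\<close> with the function \<open>U (y \<bullet> e)\<close>, evaluated on the meridian through \<open>e\<close>
  and \<open>d\<close>. By \<open>zonal_conv_eq\<close> its value at any point depends on the latitude only.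
\<close>
definition zonal_conv :: "(real \<Rightarrow> real) \<Rightarrow> (real \<Rightarrow> real) \<Rightarrow> real \<Rightarrow> real" where
  "zonal_conv h U s = (\<integral>y. h (meridian s \<bullet> y) * U (y \<bullet> e) \<partial>sphere_measure)"

lemma continuous_kernel:
  fixes h U :: "real \<Rightarrow> real"
  assumes h: "continuous_on {-1..1} h" and U: "continuous_on {-1..1} U" and x: "norm (x::'a) = 1"
  shows "continuous_on (sphere 0 1) (\<lambda>y. h (x \<bullet> y) * U (y \<bullet> e))"
  using continuous_on_sphere_zonal[OF h x] continuous_on_sphere_zonal[OF U norm_e]
  by (intro continuous_on_mult) (simp_all add: inner_commute)

text \<open>
  The reflection that swaps \<open>x\<close> with the point of the meridian at the same latitude fixes the pole.
\<close>
lemma zonal_conv_eq: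
  fixes h U :: "real \<Rightarrow> real"
  assumes h: "continuous_on {-1..1} h" and U: "continuous_on {-1..1} U" and x: "norm (x::'a) = 1"
  shows "(\<integral>y. h (x \<bullet> y) * U (y \<bullet> e) \<partial>sphere_measure) = zonal_conv h U (x \<bullet> e)"
proof -
  have s: "x \<bullet> e \<in> {-1..1}" by (rule inner_unit_le[OF x norm_e])
  obtain f where f: "orthogonal_transformation f" "f x = meridian (x \<bullet> e)" "f (meridian (x \<bullet> e)) = x"
    "\<And>z. z \<bullet> x = z \<bullet> meridian (x \<bullet> e) \<Longrightarrow> f z = z"
    using reflection_swapping[of x "meridian (x \<bullet> e)"] x norm_meridian[OF s] by auto
  have inner: "f a \<bullet> f b = a \<bullet> b" for a b using f(1) by (auto simp: orthogonal_transformation_def)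
  have fe: "f e = e" by (rule f(4)) (simp add: inner_commute)
  have "(\<integral>y. h (meridian (x \<bullet> e) \<bullet> f y) * U (f y \<bullet> e) \<partial>sphere_measure) = zonal_conv h U (x \<bullet> e)"
    unfolding zonal_conv_def
    by (rule integral_sphere_orthogonal[OF f(1)])
       (rule borel_measurable_sphere_continuous[OF continuous_kernel[OF h U norm_meridian[OF s]]])
  moreover have "meridian (x \<bullet> e) \<bullet> f y = x \<bullet> y" "f y \<bullet> e = y \<bullet> e" for y
    using inner[of x y] inner[of y e] by (simp_all add: f(2) fe)
  ultimately show ?thesis by simp
qed

text \<open>
  The reflection that swaps the pole with \<open>meridian s\<close> moves the dependence on \<open>s\<close> from the kernel \<open>h\<close>, which is merely
  continuous, into the power \<open>(s (y \<bullet> e) + sqrt (1 - s\<^sup>2) (y \<bullet> d)) ^ q\<close>. In its expansion the odd powers of the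
  square root are multiplied by zero.
\<close>
lemma zonal_conv_monom:
  assumes h: "continuous_on {-1..1} h"
  shows "\<exists>P. degree P \<le> q \<and> (\<forall>s\<in>{-1..1}. zonal_conv h (\<lambda>t. t ^ q) s = poly P s)"
proof -
  define c where "c b = (\<integral>y. h (y \<bullet> e) * (y \<bullet> e) ^ b * (y \<bullet> d) ^ (q - b) \<partial>sphere_measure)" for b
  define P where "P = (\<Sum>b\<le>q. if even (q - b) then
      smult (real (q choose b) * c b) ([:0, 1:] ^ b * [:1, 0, -1:] ^ ((q - b) div 2)) else 0)"
  have "degree P \<le> q"
    unfolding P_def
  proof (rule degree_sum_le)
    fix b assume "b \<in> {..q}"
    then have "degree ([:0, 1:] ^ b * [:1, 0, -1::real:] ^ ((q - b) div 2)) \<le> b * 1 + 2 * ((q - b) div 2)"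
      by (intro order.trans[OF degree_mult_le] add_mono order.trans[OF degree_power_le]) auto
    also have "\<dots> \<le> q" using \<open>b \<in> {..q}\<close> by simp
    finally show "degree (if even (q - b) then
      smult (real (q choose b) * c b) ([:0, 1:] ^ b * [:1, 0, -1:] ^ ((q - b) div 2)) else 0) \<le> q"
      by (auto intro: order.trans[OF degree_smult_le])
  qed simp
  moreover have "zonal_conv h (\<lambda>t. t ^ q) s = poly P s" if s: "s \<in> {-1..1}" for s
  proof -
    obtain f where f: "orthogonal_transformation f" "f e = meridian s" "f (meridian s) = e"
      using reflection_swapping[of e "meridian s"] norm_meridian[OF s] norm_e by metis
    have inner: "f a \<bullet> f b = a \<bullet> b" for a b using f(1) by (auto simp: orthogonal_transformation_def)
    have t: "meridian s \<bullet> f y = y \<bullet> e" "f y \<bullet> e = y \<bullet> meridian s" for y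
      using inner[of e y] inner[of y "meridian s"] by (simp_all only: f(2,3) inner_commute)
    have s1: "0 \<le> 1 - s\<^sup>2" using s abs_square_le_1[of s] by (simp add: abs_le_iff)
    have int: "integrable sphere_measure (\<lambda>y. h (y \<bullet> e) * (y \<bullet> e) ^ b * (y \<bullet> d) ^ m)" for b m
      by (intro integrable_sphere_continuous continuous_on_mult continuous_on_sphere_zonal[OF h norm_e]
          continuous_on_power continuous_on_inner continuous_on_id continuous_on_const)
    have "zonal_conv h (\<lambda>t. t ^ q) s = (\<integral>y. h (meridian s \<bullet> f y) * (f y \<bullet> e) ^ q \<partial>sphere_measure)"
      unfolding zonal_conv_def
      by (rule integral_sphere_orthogonal[OF f(1), symmetric])
         (rule borel_measurable_sphere_continuous[OF continuous_kernel[OF h _ norm_meridian[OF s]]],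
          intro continuous_intros)
    also have "\<dots> = (\<integral>y. h (y \<bullet> e) * (s * (y \<bullet> e) + sqrt (1 - s\<^sup>2) * (y \<bullet> d)) ^ q \<partial>sphere_measure)"
      unfolding t by simp
    also have "\<dots> = (\<integral>y. (\<Sum>b\<le>q. real (q choose b) * s ^ b * sqrt (1 - s\<^sup>2) ^ (q - b) *
         (h (y \<bullet> e) * (y \<bullet> e) ^ b * (y \<bullet> d) ^ (q - b))) \<partial>sphere_measure)"
      by (subst binomial_ring) (simp add: power_mult_distrib sum_distrib_left mult_ac)
    also have "\<dots> = (\<Sum>b\<le>q. real (q choose b) * s ^ b * sqrt (1 - s\<^sup>2) ^ (q - b) * c b)"
      by (subst Bochner_Integration.integral_sum) (auto intro: int simp: c_def)
    also have "\<dots> = poly P s"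
      unfolding P_def poly_sum
    proof (rule sum.cong[OF refl])
      fix b
      show "real (q choose b) * s ^ b * sqrt (1 - s\<^sup>2) ^ (q - b) * c b = poly (if even (q - b) then
        smult (real (q choose b) * c b) ([:0, 1:] ^ b * [:1, 0, -1:] ^ ((q - b) div 2)) else 0) s"
      proof (cases "even (q - b)")
        case True
        then obtain m where m: "q - b = 2 * m" by (elim evenE)
        have "sqrt (1 - s\<^sup>2) ^ (q - b) = (1 - s\<^sup>2) ^ m" using s1 by (simp add: m power_mult)
        moreover have "poly [:1, 0, -1:] s = 1 - s\<^sup>2" by (simp add: power2_eq_square)
        ultimately show ?thesis using m by (simp add: poly_power)
      next
        case False
        then have "c b = 0" unfolding c_def
          using sphere_moment_odd[of d e "q - b" "\<lambda>t. h t * t ^ b"] by simp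
        then show ?thesis using False by simp
      qed
    qed
    finally show ?thesis .
  qed
  ultimately show ?thesis by blast
qed

lemma zonal_conv_linear:
  fixes h U V :: "real \<Rightarrow> real"
  assumes h: "continuous_on {-1..1} h" and U: "continuous_on {-1..1} U" and V: "continuous_on {-1..1} V"
    and s: "s \<in> {-1..1}"
  shows "zonal_conv h (\<lambda>t. a * U t + b * V t) s = a * zonal_conv h U s + b * zonal_conv h V s"
proof -
  note int = integrable_sphere_continuous[OF continuous_kernel[OF h _ norm_meridian[OF s]]]
  have "zonal_conv h (\<lambda>t. a * U t + b * V t) s = (\<integral>y. a * (h (meridian s \<bullet> y) * U (y \<bullet> e)) +
      b * (h (meridian s \<bullet> y) * V (y \<bullet> e)) \<partial>sphere_measure)"
    unfolding zonal_conv_def by (simp add: algebra_simps)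
  also have "\<dots> = a * zonal_conv h U s + b * zonal_conv h V s"
    unfolding zonal_conv_def
    by (subst Bochner_Integration.integral_add)
       (auto intro!: integrable_mult_right int U V)
  finally show ?thesis .
qed

lemma zonal_conv_poly:
  assumes h: "continuous_on {-1..1} h" and "degree p \<le> q"
  shows "\<exists>P. degree P \<le> q \<and> (\<forall>s\<in>{-1..1}. zonal_conv h (poly p) s = poly P s)"
  using assms(2)
proof (induction q arbitrary: p)
  case 0
  then obtain a where p: "p = [:a:]" by (metis degree_eq_zeroE le_zero_eq)
  obtain P where P: "degree P \<le> 0" "\<forall>s\<in>{-1..1}. zonal_conv h (\<lambda>t. t ^ 0) s = poly P s"
    using zonal_conv_monom[OF h, of 0] by blast
  have "zonal_conv h (poly p) s = poly (smult a P) s" if "s \<in> {-1..1}" for s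
  proof -
    have "poly p = (\<lambda>t. a * 1 + 0 * 0)" by (simp add: p fun_eq_iff)
    then show ?thesis
      using zonal_conv_linear[OF h continuous_on_const continuous_on_const that, of a 1 0 0] P(2) that
      by simp
  qed
  then show ?case using P(1) by (intro exI[of _ "smult a P"]) auto
next
  case (Suc q)
  define a where "a = coeff p (Suc q)"
  define r where "r = p - monom a (Suc q)"
  have "degree r \<le> Suc q" unfolding r_def using Suc.prems by (intro degree_diff_le) (auto intro: order.trans[OF degree_monom_le])
  moreover have "coeff r (Suc q) = 0" by (simp add: r_def a_def)
  ultimately have "degree r \<le> q" by (metis degree_le le_degree leading_coeff_0_iff le_SucE degree_0 zero_le)
  then obtain P where P: "degree P \<le> q" "\<forall>s\<in>{-1..1}. zonal_conv h (poly r) s = poly P s"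
    using Suc.IH by blast
  obtain P' where P': "degree P' \<le> Suc q" "\<forall>s\<in>{-1..1}. zonal_conv h (\<lambda>t. t ^ Suc q) s = poly P' s"
    using zonal_conv_monom[OF h, of "Suc q"] by blast
  have "zonal_conv h (poly p) s = poly (P + smult a P') s" if s: "s \<in> {-1..1}" for s
  proof -
    have "poly p = (\<lambda>t. 1 * poly r t + a * t ^ Suc q)" by (simp add: r_def poly_monom fun_eq_iff)
    then have "zonal_conv h (poly p) s = 1 * zonal_conv h (poly r) s + a * zonal_conv h (\<lambda>t. t ^ Suc q) s"
      using zonal_conv_linear[OF h _ _ s, of "poly r" "\<lambda>t. t ^ Suc q" 1 a] by (simp add: continuous_intros del: power_Suc)
    then show ?thesis using P(2) P'(2) s by simp
  qed
  moreover have "degree (P + smult a P') \<le> Suc q"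
    using P(1) P'(1) by (intro degree_add_le) (auto intro: order.trans[OF degree_smult_le])
  ultimately show ?case by blast
qed

lemma continuous_on_zonal_conv:
  assumes h: "continuous_on {-1..1} h" and U: "continuous_on {-1..1} U"
  shows "continuous_on {-1..1} (zonal_conv h U)"
  unfolding zonal_conv_def[abs_def]
proof (rule continuous_on_sphere_parametric_integral)
  have "continuous_on ({-1..1} \<times> sphere 0 1) (\<lambda>p. h (meridian (fst p) \<bullet> snd p) * U (snd p \<bullet> e))"
  proof (intro continuous_on_mult)
    show "continuous_on ({-1..1} \<times> sphere 0 1) (\<lambda>p. h (meridian (fst p) \<bullet> snd p))"
    proof (rule continuous_on_compose2[OF h])
      show "continuous_on ({-1..1} \<times> sphere 0 1) (\<lambda>p. meridian (fst p) \<bullet> snd p)"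
        by (intro continuous_on_inner continuous_on_compose2[OF continuous_on_meridian[of UNIV]]
            continuous_on_fst continuous_on_snd continuous_on_id) auto
      show "(\<lambda>p. meridian (fst p) \<bullet> snd p) ` ({-1..1} \<times> sphere 0 1) \<subseteq> {-1..1}"
      proof (rule image_subsetI)
        fix p :: "real \<times> 'a" assume "p \<in> {-1..1} \<times> sphere 0 1"
        then have "norm (meridian (fst p)) = 1" "norm (snd p) = 1" by (auto intro: norm_meridian)
        then show "meridian (fst p) \<bullet> snd p \<in> {-1..1}" by (rule inner_unit_le)
      qed
    qed
    show "continuous_on ({-1..1::real} \<times> sphere 0 1) (\<lambda>p. U (snd p \<bullet> e))"
    proof (rule continuous_on_compose2[OF U])
      show "continuous_on ({-1..1::real} \<times> sphere (0::'a) 1) (\<lambda>p. snd p \<bullet> e)"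
        by (intro continuous_on_inner continuous_on_snd continuous_on_id continuous_on_const)
      show "(\<lambda>p. snd p \<bullet> e) ` ({-1..1::real} \<times> sphere 0 1) \<subseteq> {-1..1}"
        using inner_unit_le[OF _ norm_e] by auto
    qed
  qed
  then show "continuous_on ({-1..1} \<times> sphere 0 1) (\<lambda>(s, y). h (meridian s \<bullet> y) * U (y \<bullet> e))"
    by (simp add: case_prod_unfold)
qed

text \<open>
  Fubini's theorem for the symmetric kernel \<open>h (x \<bullet> y)\<close>.
\<close>
lemma zonal_conv_symmetric:
  assumes h: "continuous_on {-1..1} h" and U: "continuous_on {-1..1} U" and V: "continuous_on {-1..1} V"
  shows "zonal_integral e (\<lambda>t. zonal_conv h U t * V t) = zonal_integral e (\<lambda>t. zonal_conv h V t * U t)"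
proof -
  have eq: "zonal_integral e (\<lambda>t. zonal_conv h U t * V t)
     = (\<integral>x. (\<integral>y. h (x \<bullet> y) * U (y \<bullet> e) * V (x \<bullet> e) \<partial>sphere_measure) \<partial>sphere_measure)"
    if U: "continuous_on {-1..1} U" for U V
    unfolding zonal_integral_def
  proof (intro Bochner_Integration.integral_cong refl)
    fix x :: 'a assume "x \<in> space sphere_measure"
    then show "zonal_conv h U (x \<bullet> e) * V (x \<bullet> e) = (\<integral>y. h (x \<bullet> y) * U (y \<bullet> e) * V (x \<bullet> e) \<partial>sphere_measure)"
      using zonal_conv_eq[OF h U, of x] by simp
  qed
  have "continuous_on (sphere (0::'a) 1 \<times> sphere (0::'a) 1) (\<lambda>p. h (fst p \<bullet> snd p) * U (snd p \<bullet> e) * V (fst p \<bullet> e))"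
  proof (intro continuous_on_mult)
    show "continuous_on (sphere (0::'a) 1 \<times> sphere 0 1) (\<lambda>p. h (fst p \<bullet> snd p))"
    proof (rule continuous_on_compose2[OF h])
      show "continuous_on (sphere (0::'a) 1 \<times> sphere 0 1) (\<lambda>p. fst p \<bullet> snd p)"
        by (intro continuous_on_inner continuous_on_fst continuous_on_snd continuous_on_id)
      show "(\<lambda>p. fst p \<bullet> snd p) ` (sphere (0::'a) 1 \<times> sphere 0 1) \<subseteq> {-1..1}"
      proof (rule image_subsetI)
        fix p :: "'a \<times> 'a" assume "p \<in> sphere 0 1 \<times> sphere 0 1"
        then show "fst p \<bullet> snd p \<in> {-1..1}" by (intro inner_unit_le) auto
      qed
    qed
    show "continuous_on (sphere (0::'a) 1 \<times> sphere (0::'a) 1) (\<lambda>p. U (snd p \<bullet> e))"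
      by (rule continuous_on_compose2[OF U])
         (use inner_unit_le[OF _ norm_e] in \<open>auto intro!: continuous_on_inner continuous_on_snd continuous_on_id\<close>)
    show "continuous_on (sphere (0::'a) 1 \<times> sphere (0::'a) 1) (\<lambda>p. V (fst p \<bullet> e))"
      by (rule continuous_on_compose2[OF V])
         (use inner_unit_le[OF _ norm_e] in \<open>auto intro!: continuous_on_inner continuous_on_fst continuous_on_id\<close>)
  qed
  from integrable_sphere_pair_continuous[OF this]
  have "integrable (sphere_measure \<Otimes>\<^sub>M sphere_measure) (case_prod (\<lambda>x y. h (x \<bullet> y) * U (y \<bullet> e) * V (x \<bullet> e)))"
    by (simp add: case_prod_unfold)
  from sphere_pair.Fubini_integral[OF this]
  have "(\<integral>x. (\<integral>y. h (x \<bullet> y) * U (y \<bullet> e) * V (x \<bullet> e) \<partial>sphere_measure) \<partial>sphere_measure)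
     = (\<integral>y. (\<integral>x. h (x \<bullet> y) * U (y \<bullet> e) * V (x \<bullet> e) \<partial>sphere_measure) \<partial>sphere_measure)" by simp
  also have "\<dots> = (\<integral>y. (\<integral>x. h (y \<bullet> x) * V (x \<bullet> e) * U (y \<bullet> e) \<partial>sphere_measure) \<partial>sphere_measure)"
    by (simp add: inner_commute mult_ac)
  finally show ?thesis using eq[OF U, of V] eq[OF V, of U] by simp
qed

sublocale gegenbauer_functional lam "\<lambda>p. zonal_integral e (poly p)"
  unfolding lam_def by (rule gegenbauer_functional_sphere[OF dim e])

text \<open>
  The value at the pole of the convolution of \<open>h\<close> with \<open>C k\<close>, relative to the value of \<open>C k\<close> there.
\<close>
definition kernel_eigenvalue :: "(real \<Rightarrow> real) \<Rightarrow> nat \<Rightarrow> real" where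
  "kernel_eigenvalue h k = zonal_integral e (\<lambda>t. h t * poly (C k) t) / poly (C k) 1"

lemma C_1_pos: "poly (C k) 1 > 0"
  using gegenbauer_1_pos[OF lam_pos, of k] by (simp add: poly_gegenbauer_poly)

text \<open>
  Convolution does not raise degrees and is symmetric. So the image of \<open>C k\<close> is a polynomial of degree at most \<open>k\<close>
  that is orthogonal to \<open>C j\<close> for all \<open>j < k\<close>, hence a multiple of \<open>C k\<close>; the factor is read off at the pole.
\<close>
theorem funk_hecke:
  assumes h: "continuous_on {-1..1} h" and s: "s \<in> {-1..1}"
  shows "zonal_conv h (poly (C k)) s = kernel_eigenvalue h k * poly (C k) s"
proof -
  obtain P where P: "degree P \<le> k" "\<And>s. s \<in> {-1..1} \<Longrightarrow> zonal_conv h (poly (C k)) s = poly P s"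
    using zonal_conv_poly[OF h degree_gegenbauer_poly[of k lam]] by blast
  have cong: "zonal_integral e f = zonal_integral e g" if "\<And>t. t \<in> {-1..1} \<Longrightarrow> f t = g t" for f g
    unfolding zonal_integral_def
    by (intro Bochner_Integration.integral_cong refl that inner_unit_le) auto
  have orth: "zonal_integral e (poly (C j * P)) = 0" if "j < k" for j
  proof -
    obtain Q where Q: "degree Q \<le> j" "\<And>s. s \<in> {-1..1} \<Longrightarrow> zonal_conv h (poly (C j)) s = poly Q s"
      using zonal_conv_poly[OF h degree_gegenbauer_poly[of j lam]] by blast
    have "zonal_integral e (poly (C j * P)) = zonal_integral e (\<lambda>t. zonal_conv h (poly (C k)) t * poly (C j) t)"
      by (rule cong) (simp add: P(2))
    also have "\<dots> = zonal_integral e (\<lambda>t. zonal_conv h (poly (C j)) t * poly (C k) t)"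
      by (rule zonal_conv_symmetric[OF h]) (intro continuous_intros)+
    also have "\<dots> = zonal_integral e (poly (C k * Q))" by (rule cong) (simp add: Q(2))
    also have "\<dots> = 0" by (rule L_C_lower) (use Q(1) that in simp)
    finally show ?thesis .
  qed
  define a where "a = zonal_integral e (poly (C k * P)) / sqnorm k"
  have coef: "smult (zonal_integral e (poly (C j * P)) / sqnorm j) (C j) = (if j = k then smult a (C k) else 0)"
    if "j \<in> {..k}" for j using that orth[of j] by (auto simp: a_def)
  have "P = (\<Sum>j\<le>k. if j = k then smult a (C k) else 0)"
    using C_expansion[OF P(1)] sum.cong[OF refl coef, of "{..k}"] by simp
  then have Pa: "P = smult a (C k)" by simp
  have "zonal_conv h (poly (C k)) 1 = zonal_integral e (\<lambda>t. h t * poly (C k) t)"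
    by (simp add: zonal_conv_def zonal_integral_def inner_commute)
  moreover have "zonal_conv h (poly (C k)) 1 = a * poly (C k) 1" using P(2)[of 1] Pa by simp
  ultimately have "a = kernel_eigenvalue h k"
    using C_1_pos[of k] by (simp add: kernel_eigenvalue_def eq_divide_eq)
  then show ?thesis using P(2)[OF s] Pa by simp
qed

end

section \<open>The branch of zonal fixed points\<close>

instance bcontfun :: (metric_space, banach) banach ..

definition clamp1 :: "real \<Rightarrow> real" where "clamp1 t = max (-1) (min 1 t)"

lemma clamp1_mem [simp]: "clamp1 t \<in> {-1..1}" and clamp1_id [simp]: "t \<in> {-1..1} \<Longrightarrow> clamp1 t = t"
  by (auto simp: clamp1_def)

lemma clamp1_ge [simp]: "- 1 \<le> clamp1 t" and clamp1_le [simp]: "clamp1 t \<le> 1"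
  by (auto simp: clamp1_def)

lemma continuous_on_clamp1: "continuous_on S clamp1"
  unfolding clamp1_def[abs_def] by (intro continuous_intros)

text \<open>
  Profiles live on the interval, but the Banach space \<open>real \<Rightarrow>\<^sub>C real\<close> consists of functions on the whole line;
  they are extended by constants.
\<close>
definition clamped :: "(real \<Rightarrow> real) \<Rightarrow> real \<Rightarrow>\<^sub>C real" where
  "clamped f = Bcontfun (\<lambda>t. f (clamp1 t))"

lemma continuous_interval_bounded:
  assumes "continuous_on {-1..1::real} (f :: real \<Rightarrow> real)"
  obtains B where "B > 0" "\<And>t. t \<in> {-1..1} \<Longrightarrow> \<bar>f t\<bar> \<le> B"
proof -
  have "bounded (f ` {-1..1})"
    using assms by (intro compact_imp_bounded compact_continuous_image) auto
  then obtain B where "B > 0" "\<And>y. y \<in> f ` {-1..1} \<Longrightarrow> norm y \<le> B"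
    unfolding bounded_pos by blast
  with that show ?thesis by auto
qed

lemma clamped_apply [simp]:
  assumes f: "continuous_on {-1..1} f"
  shows "apply_bcontfun (clamped f) t = f (clamp1 t)"
proof -
  obtain B where B: "\<And>t. t \<in> {-1..1} \<Longrightarrow> \<bar>f t\<bar> \<le> B"
    using continuous_interval_bounded[OF f] by blast
  have "continuous_on UNIV (\<lambda>t. f (clamp1 t))"
    by (rule continuous_on_compose2[OF f continuous_on_clamp1]) (use clamp1_mem in blast)
  then have "(\<lambda>t. f (clamp1 t)) \<in> bcontfun"
    by (rule bcontfun_normI[where b=B]) (use B clamp1_mem in auto)
  then show ?thesis by (simp add: clamped_def Bcontfun_inverse)
qed

lemma bcontfun_le_norm: "\<bar>apply_bcontfun U t\<bar> \<le> norm U" for U :: "real \<Rightarrow>\<^sub>C real"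
  using norm_bounded[of U t] by simp

lemma abs_exp_minus_1_le: "\<bar>exp x - 1\<bar> \<le> 3 * \<bar>x\<bar>" if "\<bar>x\<bar> \<le> 1" for x :: real
proof -
  have "norm (exp x - exp 0) \<le> 3 * norm (x - 0)"
  proof (rule field_differentiable_bound[where S="cball 0 1" and f'=exp])
    fix z :: real assume "z \<in> cball 0 1"
    then have "exp z \<le> exp 1" by simp
    from order_trans[OF this exp_le] show "norm (exp z) \<le> 3" by simp
  qed (use that in \<open>auto intro!: derivative_eq_intros\<close>)
  then show ?thesis by simp
qed

text \<open>
  The derivative of the remainder is \<open>exp z - 1\<close>.
\<close>
lemma exp_remainder_lipschitz:
  fixes x y r :: real
  assumes "r \<le> 1" "\<bar>x\<bar> \<le> r" "\<bar>y\<bar> \<le> r"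
  shows "\<bar>(exp x - 1 - x) - (exp y - 1 - y)\<bar> \<le> 3 * r * \<bar>x - y\<bar>"
proof -
  have "norm ((exp x - 1 - x) - (exp y - 1 - y)) \<le> 3 * r * norm (x - y)"
  proof (rule field_differentiable_bound[where S="cball 0 r" and f'="\<lambda>z. exp z - 1"])
    fix z :: real assume "z \<in> cball 0 r"
    then show "norm (exp z - 1) \<le> 3 * r"
      using abs_exp_minus_1_le[of z] assms(1) by auto
  qed (use assms in \<open>auto intro!: derivative_eq_intros\<close>)
  then show ?thesis by simp
qed

definition exp_remainder :: "(real \<Rightarrow>\<^sub>C real) \<Rightarrow> real \<Rightarrow>\<^sub>C real" where
  "exp_remainder a = Bcontfun (\<lambda>t. exp (a t) - 1 - a t)"

lemma exp_remainder_apply [simp]: "apply_bcontfun (exp_remainder a) t = exp (a t) - 1 - a t"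
proof -
  have "\<bar>exp (a t) - 1 - a t\<bar> \<le> exp (norm a) + 1 + norm a" for t
  proof -
    have "exp (a t) \<le> exp (norm a)" using bcontfun_le_norm[of a t] by simp
    then show ?thesis using bcontfun_le_norm[of a t] exp_gt_zero[of "a t"] by linarith
  qed
  then have "(\<lambda>t. exp (a t) - 1 - a t) \<in> bcontfun"
    by (intro bcontfun_normI[where b="exp (norm a) + 1 + norm a"] continuous_intros) auto
  then show ?thesis by (simp add: exp_remainder_def Bcontfun_inverse)
qed

lemma norm_exp_remainder_diff_le:
  assumes "r \<le> 1" "norm a \<le> r" "norm b \<le> r"
  shows "norm (exp_remainder a - exp_remainder b) \<le> 3 * r * norm (a - b)"
proof (rule norm_bound)
  fix t
  have r: "0 \<le> r" using assms(2) norm_ge_zero[of a] by linarith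
  have "\<bar>apply_bcontfun (exp_remainder a - exp_remainder b) t\<bar> \<le> 3 * r * \<bar>a t - b t\<bar>"
    using exp_remainder_lipschitz[of r "a t" "b t"] assms bcontfun_le_norm[of a t] bcontfun_le_norm[of b t] by simp
  also have "\<bar>a t - b t\<bar> \<le> norm (a - b)" using bcontfun_le_norm[of "a - b" t] by simp
  finally show "norm (apply_bcontfun (exp_remainder a - exp_remainder b) t) \<le> 3 * r * norm (a - b)"
    using r by (simp add: mult_left_mono)
qed

context zonal_frame
begin

lemma zonal_integral_cong:
  "(\<And>t. t \<in> {-1..1} \<Longrightarrow> f t = g t) \<Longrightarrow> zonal_integral e f = zonal_integral e g"
  unfolding zonal_integral_def
  by (intro Bochner_Integration.integral_cong refl) (use inner_unit_le[OF _ norm_e] in simp)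

lemma zonal_conv_cong:
  "(\<And>t. t \<in> {-1..1} \<Longrightarrow> U t = V t) \<Longrightarrow> zonal_conv h U s = zonal_conv h V s"
  unfolding zonal_conv_def
  by (intro Bochner_Integration.integral_cong refl) (use inner_unit_le[OF _ norm_e] in simp)

lemma abs_zonal_integral_le:
  assumes "\<And>t. t \<in> {-1..1} \<Longrightarrow> \<bar>f t\<bar> \<le> B" "0 \<le> B"
  shows "\<bar>zonal_integral e f\<bar> \<le> B * area"
  unfolding zonal_integral_def area_def
  using assms inner_unit_le[OF _ norm_e] by (intro abs_integral_sphere_le) auto

definition conv_op :: "(real \<Rightarrow> real) \<Rightarrow> (real \<Rightarrow>\<^sub>C real) \<Rightarrow> real \<Rightarrow>\<^sub>C real" where
  "conv_op h U = clamped (zonal_conv h (apply_bcontfun U))"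

lemma conv_op_apply [simp]:
  "continuous_on {-1..1} h \<Longrightarrow> apply_bcontfun (conv_op h U) t = zonal_conv h (apply_bcontfun U) (clamp1 t)"
  unfolding conv_op_def by (intro clamped_apply continuous_on_zonal_conv) auto

lemma abs_zonal_conv_le:
  assumes h: "\<And>t. t \<in> {-1..1} \<Longrightarrow> \<bar>h t\<bar> \<le> B" and B: "0 \<le> B" and s: "s \<in> {-1..1}"
  shows "\<bar>zonal_conv h (apply_bcontfun U) s\<bar> \<le> B * area * norm U"
proof -
  have "\<bar>zonal_conv h (apply_bcontfun U) s\<bar> \<le> (B * norm U) * area"
    unfolding zonal_conv_def area_def
  proof (rule abs_integral_sphere_le)
    fix y :: 'a assume "y \<in> sphere 0 1"
    then have "\<bar>h (meridian s \<bullet> y)\<bar> \<le> B" using s by (intro h inner_unit_le) auto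
    then show "\<bar>h (meridian s \<bullet> y) * apply_bcontfun U (y \<bullet> e)\<bar> \<le> B * norm U"
      unfolding abs_mult using B bcontfun_le_norm by (intro mult_mono) auto
  qed (use B in simp)
  then show ?thesis by (simp add: mult_ac)
qed

lemma norm_conv_op_le:
  assumes "continuous_on {-1..1} h" "\<And>t. t \<in> {-1..1} \<Longrightarrow> \<bar>h t\<bar> \<le> B" "0 \<le> B"
  shows "norm (conv_op h U) \<le> B * area * norm U"
  using assms abs_zonal_conv_le[of h B] by (intro norm_bound) simp

lemma bounded_linear_conv_op:
  assumes h: "continuous_on {-1..1} h"
  shows "bounded_linear (conv_op h)"
proof -
  obtain B where B: "B > 0" "\<And>t. t \<in> {-1..1} \<Longrightarrow> \<bar>h t\<bar> \<le> B"
    using continuous_interval_bounded[OF h] by blast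
  show ?thesis
  proof (rule bounded_linear_intro)
    show "conv_op h (U + V) = conv_op h U + conv_op h V" for U V
      using zonal_conv_linear[OF h, of "apply_bcontfun U" "apply_bcontfun V" _ 1 1] h
      by (intro bcontfun_eqI) simp
    show "conv_op h (r *\<^sub>R U) = r *\<^sub>R conv_op h U" for r U
      using zonal_conv_linear[OF h, of "apply_bcontfun U" "apply_bcontfun U" _ r 0] h
      by (intro bcontfun_eqI) simp
    show "norm (conv_op h U) \<le> norm U * (B * area)" for U
      using norm_conv_op_le[OF h B(2), of U] B(1) by (simp add: mult_ac)
  qed
qed

definition gegenbauer_fun :: "nat \<Rightarrow> real \<Rightarrow>\<^sub>C real" where
  "gegenbauer_fun j = clamped (poly (C j))"

lemma gegenbauer_fun_apply [simp]: "apply_bcontfun (gegenbauer_fun j) t = poly (C j) (clamp1 t)"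
  unfolding gegenbauer_fun_def by (intro clamped_apply continuous_intros)

definition gegenbauer_coef :: "nat \<Rightarrow> (real \<Rightarrow>\<^sub>C real) \<Rightarrow> real" where
  "gegenbauer_coef j U = zonal_integral e (\<lambda>t. apply_bcontfun U t * poly (C j) t) / sqnorm j"

lemma integrable_zonal_product:
  fixes f :: "real \<Rightarrow> real"
  assumes "continuous_on {-1..1} f"
  shows "integrable sphere_measure (\<lambda>x. apply_bcontfun U (x \<bullet> e) * f (x \<bullet> e))"
  using integrable_zonal[of "\<lambda>t. apply_bcontfun U t * f t" e] assms by (simp add: continuous_on_mult)

lemma bounded_linear_gegenbauer_coef: "bounded_linear (gegenbauer_coef j)"
proof -
  have c: "continuous_on {-1..1} (poly (C j))" by (intro continuous_intros)
  obtain B where B: "B > 0" "\<And>t. t \<in> {-1..1} \<Longrightarrow> \<bar>poly (C j) t\<bar> \<le> B"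
    using continuous_interval_bounded[OF c] by blast
  note i = integrable_zonal_product[OF c]
  show ?thesis
  proof (rule bounded_linear_intro)
    show "gegenbauer_coef j (U + V) = gegenbauer_coef j U + gegenbauer_coef j V" for U V
      using i[of U] i[of V] by (simp add: gegenbauer_coef_def zonal_integral_def distrib_right add_divide_distrib)
    show "gegenbauer_coef j (r *\<^sub>R U) = r *\<^sub>R gegenbauer_coef j U" for r U
      by (simp add: gegenbauer_coef_def zonal_integral_def mult.assoc)
    fix U
    have "\<bar>zonal_integral e (\<lambda>t. apply_bcontfun U t * poly (C j) t)\<bar> \<le> (norm U * B) * area"
      using B bcontfun_le_norm[of U]
      by (intro abs_zonal_integral_le) (auto simp: abs_mult intro!: mult_mono)
    then have "\<bar>gegenbauer_coef j U\<bar> \<le> (norm U * B) * area / sqnorm j"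
      using sqnorm_pos[of j] by (simp add: gegenbauer_coef_def divide_right_mono)
    then show "norm (gegenbauer_coef j U) \<le> norm U * (B * area / sqnorm j)"
      by (simp add: mult.assoc)
  qed
qed

lemma gegenbauer_coef_fun: "gegenbauer_coef i (gegenbauer_fun j) = (if i = j then 1 else 0)"
proof -
  have "zonal_integral e (\<lambda>t. apply_bcontfun (gegenbauer_fun j) t * poly (C i) t) = zonal_integral e (poly (C j * C i))"
    by (rule zonal_integral_cong) simp
  then show ?thesis
    using L_C_orth[of j i] sqnorm_pos[of i] by (auto simp: gegenbauer_coef_def sqnorm_def)
qed

text \<open>
  Symmetry of the convolution moves the operator to the eigenfunction \<open>C j\<close>.
\<close>
lemma gegenbauer_coef_conv_op:
  assumes h: "continuous_on {-1..1} h"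
  shows "gegenbauer_coef j (conv_op h U) = kernel_eigenvalue h j * gegenbauer_coef j U"
proof -
  have "zonal_integral e (\<lambda>t. apply_bcontfun (conv_op h U) t * poly (C j) t)
      = zonal_integral e (\<lambda>t. zonal_conv h (apply_bcontfun U) t * poly (C j) t)"
    by (rule zonal_integral_cong) (simp add: h)
  also have "\<dots> = zonal_integral e (\<lambda>t. zonal_conv h (poly (C j)) t * apply_bcontfun U t)"
    by (rule zonal_conv_symmetric[OF h]) (intro continuous_intros | simp)+
  also have "\<dots> = zonal_integral e (\<lambda>t. kernel_eigenvalue h j * (apply_bcontfun U t * poly (C j) t))"
    by (rule zonal_integral_cong) (simp add: funk_hecke[OF h])
  also have "\<dots> = kernel_eigenvalue h j * zonal_integral e (\<lambda>t. apply_bcontfun U t * poly (C j) t)"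
    by (simp add: zonal_integral_def)
  finally show ?thesis by (simp add: gegenbauer_coef_def)
qed

lemma conv_op_gegenbauer_fun:
  assumes h: "continuous_on {-1..1} h"
  shows "conv_op h (gegenbauer_fun j) = kernel_eigenvalue h j *\<^sub>R gegenbauer_fun j"
proof (rule bcontfun_eqI)
  fix t
  have "zonal_conv h (apply_bcontfun (gegenbauer_fun j)) (clamp1 t) = zonal_conv h (poly (C j)) (clamp1 t)"
    by (rule zonal_conv_cong) simp
  then show "apply_bcontfun (conv_op h (gegenbauer_fun j)) t = apply_bcontfun (kernel_eigenvalue h j *\<^sub>R gegenbauer_fun j) t"
    by (simp add: h funk_hecke[OF h])
qed

text \<open>
  On polynomials this is the expansion in eigenfunctions, since the eigenvalues of a polynomial kernel vanish
  beyond its degree. Both sides depend continuously on \<open>U\<close>, and polynomials are dense.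
\<close>
lemma conv_op_poly_finite_rank:
  assumes p: "degree p \<le> N"
  shows "conv_op (poly p) U = (\<Sum>j\<le>N. (kernel_eigenvalue (poly p) j * gegenbauer_coef j U) *\<^sub>R gegenbauer_fun j)"
proof -
  have cp: "continuous_on {-1..1} (poly p)" by (intro continuous_intros)
  define F where "F U = (\<Sum>j\<le>N. (kernel_eigenvalue (poly p) j * gegenbauer_coef j U) *\<^sub>R gegenbauer_fun j)" for U
  define D where "D U = conv_op (poly p) U - F U" for U
  have "bounded_linear D"
    unfolding D_def F_def
    by (intro bounded_linear_sub bounded_linear_conv_op cp bounded_linear_sum
        bounded_linear_compose[OF bounded_linear_scaleR_left]
        bounded_linear_compose[OF bounded_linear_mult_right bounded_linear_gegenbauer_coef])
  then interpret D: bounded_linear D .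
  have ev0: "kernel_eigenvalue (poly p) j = 0" if "j > N" for j
  proof -
    have "zonal_integral e (poly (C j * p)) = 0" using L_C_lower[of p j] p that by simp
    moreover have "poly (C j * p) = (\<lambda>t. poly p t * poly (C j) t)" by (simp add: fun_eq_iff)
    ultimately show ?thesis by (simp add: kernel_eigenvalue_def)
  qed
  have DC: "D (gegenbauer_fun j) = 0" for j
  proof -
    have "F (gegenbauer_fun j) = (\<Sum>i\<le>N. if i = j then kernel_eigenvalue (poly p) j *\<^sub>R gegenbauer_fun j else 0)"
      unfolding F_def by (intro sum.cong) (auto simp: gegenbauer_coef_fun)
    also have "\<dots> = kernel_eigenvalue (poly p) j *\<^sub>R gegenbauer_fun j" using ev0[of j] by simp
    finally show ?thesis by (simp add: D_def conv_op_gegenbauer_fun[OF cp])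
  qed
  have Dpoly: "D (clamped (poly q)) = 0" for q
  proof -
    obtain c where c: "q = (\<Sum>j\<le>degree q. smult (c j) (C j))" using C_spans[OF order_refl] by blast
    have "clamped (poly q) = (\<Sum>j\<le>degree q. c j *\<^sub>R gegenbauer_fun j)"
    proof (rule bcontfun_eqI)
      fix t
      have "apply_bcontfun (\<Sum>j\<in>A. c j *\<^sub>R gegenbauer_fun j) t = (\<Sum>j\<in>A. c j * poly (C j) (clamp1 t))" if "finite A" for A
        using that by (induction A rule: finite_induct) simp_all
      moreover have "poly q (clamp1 t) = (\<Sum>j\<le>degree q. c j * poly (C j) (clamp1 t))"
        by (subst c) (simp add: poly_sum)
      ultimately show "apply_bcontfun (clamped (poly q)) t = apply_bcontfun (\<Sum>j\<le>degree q. c j *\<^sub>R gegenbauer_fun j) t"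
        by (simp add: continuous_intros)
    qed
    then show ?thesis by (simp add: D.sum D.scaleR DC)
  qed
  have Dclamp: "D U = D (clamped (apply_bcontfun U))"
  proof -
    have "conv_op (poly p) U = conv_op (poly p) (clamped (apply_bcontfun U))"
    proof (rule bcontfun_eqI)
      fix t
      have "zonal_conv (poly p) (apply_bcontfun U) (clamp1 t)
          = zonal_conv (poly p) (apply_bcontfun (clamped (apply_bcontfun U))) (clamp1 t)"
        by (rule zonal_conv_cong) simp
      then show "apply_bcontfun (conv_op (poly p) U) t = apply_bcontfun (conv_op (poly p) (clamped (apply_bcontfun U))) t"
        by (simp only: conv_op_apply[OF cp])
    qed
    moreover have "gegenbauer_coef j U = gegenbauer_coef j (clamped (apply_bcontfun U))" for j
    proof -
      have "zonal_integral e (\<lambda>t. apply_bcontfun U t * poly (C j) t)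
          = zonal_integral e (\<lambda>t. apply_bcontfun (clamped (apply_bcontfun U)) t * poly (C j) t)"
        by (rule zonal_integral_cong) simp
      then show ?thesis by (simp only: gegenbauer_coef_def)
    qed
    ultimately show ?thesis by (simp add: D_def F_def)
  qed
  obtain K where K: "K > 0" "\<And>V. norm (D V) \<le> norm V * K" using D.pos_bounded by blast
  have "norm (D U) \<le> 0 + \<epsilon>" if \<epsilon>: "\<epsilon> > 0" for \<epsilon>
  proof -
    obtain q where q: "\<And>t. t \<in> {-1..1} \<Longrightarrow> \<bar>apply_bcontfun U t - poly q t\<bar> < \<epsilon> / K"
      using weierstrass_poly[OF continuous_on_apply_bcontfun divide_pos_pos[OF \<epsilon> K(1)]] by blast
    have "norm (clamped (apply_bcontfun U) - clamped (poly q)) \<le> \<epsilon> / K"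
      using less_imp_le[OF q] by (intro norm_bound) (simp add: continuous_intros)
    then have "norm (D (clamped (apply_bcontfun U) - clamped (poly q))) \<le> (\<epsilon> / K) * K"
      using K by (meson order.trans mult_right_mono less_imp_le)
    then show ?thesis using K by (simp add: D.diff Dpoly Dclamp[symmetric])
  qed
  then have "norm (D U) \<le> 0" by (rule field_le_epsilon)
  then show ?thesis by (simp add: D_def F_def)
qed

text \<open>
  The kernel is split into a polynomial and a remainder so small that \<open>\<kappa>\<close> times its convolution has norm at most
  one half.
\<close>
lemma zonal_bifurcation:
  assumes h: "continuous_on {-1..1} h"
    and eig: "\<kappa> * kernel_eigenvalue h k = 1"
    and simple: "\<forall>j. j \<noteq> k \<longrightarrow> kernel_eigenvalue h j \<noteq> kernel_eigenvalue h k"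
  obtains \<delta> :: real and \<mu> :: "real \<Rightarrow> real" and z :: "real \<Rightarrow> real \<Rightarrow>\<^sub>C real"
  where "\<delta> > 0" "continuous_on {-\<delta><..<\<delta>} \<mu>" "continuous_on {-\<delta><..<\<delta>} z" "\<mu> 0 = 0" "z 0 = 0"
    "\<And>s. s \<in> {-\<delta><..<\<delta>} \<Longrightarrow> gegenbauer_coef k (z s) = 0"
    "\<And>s t. s \<in> {-\<delta><..<\<delta>} \<Longrightarrow> t \<in> {-1..1} \<Longrightarrow> 1 + s * (poly (C k) t + z s t)
       = exp ((\<kappa> + \<mu> s) * zonal_conv h (\<lambda>t. s * (poly (C k) t + z s t)) t)"
proof -
  have \<kappa>0: "\<kappa> \<noteq> 0" using eig by auto
  define \<epsilon> where "\<epsilon> = 1 / (2 * \<bar>\<kappa>\<bar> * area)"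
  have \<epsilon>: "\<epsilon> > 0" using \<kappa>0 area_pos by (simp add: \<epsilon>_def)
  obtain p where p: "\<And>t. t \<in> {-1..1} \<Longrightarrow> \<bar>h t - poly p t\<bar> < \<epsilon>" using weierstrass_poly[OF h \<epsilon>] by blast
  define N where "N = max (degree p) k"
  define r where "r t = h t - poly p t" for t
  have cp: "continuous_on {-1..1} (poly p)" by (intro continuous_intros)
  have cr: "continuous_on {-1..1} r" unfolding r_def by (intro continuous_intros h)
  have small: "norm (\<kappa> *\<^sub>R conv_op r x) \<le> norm x / 2" for x
  proof -
    have "norm (conv_op r x) \<le> \<epsilon> * area * norm x"
      using p \<epsilon> by (intro norm_conv_op_le cr) (auto simp: r_def less_imp_le)
    then have "norm (\<kappa> *\<^sub>R conv_op r x) \<le> \<bar>\<kappa>\<bar> * (\<epsilon> * area * norm x)"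
      by (simp add: mult_left_mono)
    also have "\<dots> = norm x / 2" using \<kappa>0 area_pos by (simp add: \<epsilon>_def)
    finally show ?thesis .
  qed
  have split: "conv_op h x = conv_op r x + (\<Sum>j\<le>N. (kernel_eigenvalue (poly p) j * gegenbauer_coef j x) *\<^sub>R gegenbauer_fun j)" for x
  proof -
    have "conv_op h x = conv_op r x + conv_op (poly p) x"
    proof (rule bcontfun_eqI)
      fix t
      let ?s = "clamp1 t"
      note int = integrable_sphere_continuous[OF continuous_kernel[OF _ _ norm_meridian[OF clamp1_mem]]]
      have "zonal_conv h x ?s = (\<integral>y. r (meridian ?s \<bullet> y) * apply_bcontfun x (y \<bullet> e)
            + poly p (meridian ?s \<bullet> y) * apply_bcontfun x (y \<bullet> e) \<partial>sphere_measure)"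
        unfolding zonal_conv_def by (simp add: r_def algebra_simps)
      also have "\<dots> = zonal_conv r x ?s + zonal_conv (poly p) x ?s"
        unfolding zonal_conv_def by (rule Bochner_Integration.integral_add) (rule int, auto intro: cr cp)+
      finally show "apply_bcontfun (conv_op h x) t = apply_bcontfun (conv_op r x + conv_op (poly p) x) t"
        by (simp add: h cr cp)
    qed
    then show ?thesis using conv_op_poly_finite_rank[of p N x] by (simp add: N_def)
  qed
  have "\<kappa> * kernel_eigenvalue h j \<noteq> 1" if "j \<noteq> k" for j
    using simple[rule_format, OF that] eig \<kappa>0 by (metis mult_left_cancel)
  note nonresonant = this
  obtain S where S: "bounded_linear S" "\<And>f. gegenbauer_coef k (S f) = 0"
    "\<And>f. S f - \<kappa> *\<^sub>R conv_op h (S f) = f - gegenbauer_coef k f *\<^sub>R gegenbauer_fun k"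
  proof (rule simple_eigenvalue_pseudo_inverse[where T="conv_op h" and R="conv_op r" and \<psi>=gegenbauer_coef
        and \<phi>=gegenbauer_fun and N=N and \<kappa>=\<kappa> and k=k and a="kernel_eigenvalue (poly p)"
        and r="kernel_eigenvalue r" and \<tau>="kernel_eigenvalue h",
        OF bounded_linear_conv_op[OF h] bounded_linear_conv_op[OF cr] bounded_linear_gegenbauer_coef
          gegenbauer_coef_fun split small gegenbauer_coef_conv_op[OF cr] conv_op_gegenbauer_fun[OF h] _ nonresonant])
    show "k \<le> N" by (simp add: N_def)
  qed (assumption | rule that)+
  obtain \<delta> \<mu> z where *: "\<delta> > 0" "continuous_on {-\<delta><..<\<delta>} \<mu>" "continuous_on {-\<delta><..<\<delta>} z" "\<mu> 0 = 0" "z 0 = 0"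
    "\<And>s. s \<in> {-\<delta><..<\<delta>} \<Longrightarrow> gegenbauer_coef k (z s) = 0"
    "\<And>s. s \<in> {-\<delta><..<\<delta>} \<Longrightarrow>
       s *\<^sub>R (gegenbauer_fun k + z s) = (\<kappa> + \<mu> s) *\<^sub>R conv_op h (s *\<^sub>R (gegenbauer_fun k + z s))
         + exp_remainder ((\<kappa> + \<mu> s) *\<^sub>R conv_op h (s *\<^sub>R (gegenbauer_fun k + z s)))"
  proof (rule bifurcation_from_simple_eigenvalue[OF bounded_linear_conv_op[OF h] S(1) bounded_linear_gegenbauer_coef, of k "gegenbauer_fun k" \<kappa> exp_remainder 3])
    show "gegenbauer_coef k (gegenbauer_fun k) = 1" by (simp add: gegenbauer_coef_fun)
    show "\<kappa> *\<^sub>R conv_op h (gegenbauer_fun k) = gegenbauer_fun k"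
      by (simp add: conv_op_gegenbauer_fun[OF h] eig)
    show "\<kappa> * gegenbauer_coef k (conv_op h x) = gegenbauer_coef k x" for x
      by (simp add: gegenbauer_coef_conv_op[OF h] mult.assoc[symmetric] eig)
    show "exp_remainder 0 = 0" by (rule bcontfun_eqI) simp
  qed (use S norm_exp_remainder_diff_le in auto)
  show ?thesis
  proof (rule that[OF *(1-6)])
    fix s t :: real assume s: "s \<in> {-\<delta><..<\<delta>}" and t: "t \<in> {-1..1}"
    define V where "V = s *\<^sub>R (gegenbauer_fun k + z s)"
    define a where "a = (\<kappa> + \<mu> s) *\<^sub>R conv_op h V"
    have "apply_bcontfun V t = apply_bcontfun (a + exp_remainder a) t"
      using *(7)[OF s] by (simp only: V_def a_def)
    then have "1 + apply_bcontfun V t = exp (a t)" by simp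
    moreover have "a t = (\<kappa> + \<mu> s) * zonal_conv h (apply_bcontfun V) t"
      using t by (simp add: a_def h)
    moreover have "zonal_conv h (apply_bcontfun V) t = zonal_conv h (\<lambda>t. s * (poly (C k) t + z s t)) t"
      by (rule zonal_conv_cong) (simp add: V_def)
    ultimately show "1 + s * (poly (C k) t + z s t) = exp ((\<kappa> + \<mu> s) * zonal_conv h (\<lambda>t. s * (poly (C k) t + z s t)) t)"
      using t by (simp add: V_def)
  qed
qed

end

section \<open>Smooth functions and parametric integrals\<close>

lemma GDERIV_unique:
  assumes "GDERIV f x :> a" "GDERIV f x :> b"
  shows "a = b"
proof -
  have "(\<lambda>h. h \<bullet> a) = (\<lambda>h. h \<bullet> b)"
    using assms unfolding gderiv_def by (rule has_derivative_unique)
  then have "(a - b) \<bullet> a = (a - b) \<bullet> b" by (rule fun_cong)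
  then have "(a - b) \<bullet> (a - b) = 0" by (simp add: inner_diff_right)
  then show ?thesis by simp
qed

lemma C_k_continuous: "C_k k f \<Longrightarrow> continuous_on UNIV f"
proof (cases k)
  case (Suc j)
  assume "C_k k f"
  then obtain G where "\<forall>x. GDERIV f x :> G x" using Suc by auto
  then show ?thesis
    by (auto simp: gderiv_def intro!: has_derivative_continuous_on[where f'="\<lambda>x h. h \<bullet> G x"])
qed simp

lemma C_k_SucD: "C_k (Suc k) f \<Longrightarrow> C_k k f"
proof (induction k arbitrary: f)
  case 0
  then show ?case using C_k_continuous[OF 0] by simp
next
  case (Suc k)
  from Suc.prems obtain G where "\<forall>x. GDERIV f x :> G x" "\<forall>b\<in>Basis. C_k (Suc k) (\<lambda>x. G x \<bullet> b)"
    by (subst (asm) C_k.simps) blast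
  then show ?case using Suc.IH by auto
qed

lemma C_k_const: "C_k k (\<lambda>_. c)"
proof (induction k arbitrary: c)
  case (Suc k)
  then show ?case by (auto intro!: exI[of _ "\<lambda>_. 0"] GDERIV_const)
qed simp

lemma C_k_add: "C_k k f \<Longrightarrow> C_k k g \<Longrightarrow> C_k k (\<lambda>x. f x + g x)"
proof (induction k arbitrary: f g)
  case (Suc k)
  then obtain F G where "\<forall>x. GDERIV f x :> F x" "\<forall>b\<in>Basis. C_k k (\<lambda>x. F x \<bullet> b)"
    "\<forall>x. GDERIV g x :> G x" "\<forall>b\<in>Basis. C_k k (\<lambda>x. G x \<bullet> b)" by auto
  then show ?case
    using Suc.IH by (auto intro!: exI[of _ "\<lambda>x. F x + G x"] GDERIV_add simp: inner_add_left)
qed (auto intro: continuous_on_add)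

lemma C_k_mult: "C_k k f \<Longrightarrow> C_k k g \<Longrightarrow> C_k k (\<lambda>x. f x * g x)"
proof (induction k arbitrary: f g)
  case (Suc k)
  then obtain F G where "\<forall>x. GDERIV f x :> F x" "\<forall>b\<in>Basis. C_k k (\<lambda>x. F x \<bullet> b)"
    "\<forall>x. GDERIV g x :> G x" "\<forall>b\<in>Basis. C_k k (\<lambda>x. G x \<bullet> b)" by auto
  moreover have "C_k k f" "C_k k g" using Suc.prems by (auto intro: C_k_SucD simp del: C_k.simps)
  ultimately show ?case
    using Suc.IH
    by (auto intro!: exI[of _ "\<lambda>x. f x *\<^sub>R G x + g x *\<^sub>R F x"] GDERIV_mult C_k_add simp: inner_add_left)
qed (auto intro: continuous_on_mult)

lemma C_k_exp: "C_k k f \<Longrightarrow> C_k k (\<lambda>x. exp (f x))"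
proof (induction k arbitrary: f)
  case (Suc k)
  then obtain F where F: "\<forall>x. GDERIV f x :> F x" "\<forall>b\<in>Basis. C_k k (\<lambda>x. F x \<bullet> b)" by auto
  have "C_k k f" using Suc.prems by (rule C_k_SucD)
  have "GDERIV (\<lambda>x. exp (f x)) x :> exp (f x) *\<^sub>R F x" for x
    using F(1) by (intro GDERIV_DERIV_compose[where g=exp] DERIV_exp) auto
  moreover have "C_k k (\<lambda>x. (exp (f x) *\<^sub>R F x) \<bullet> b)" if "b \<in> Basis" for b
    using C_k_mult[OF Suc.IH[OF \<open>C_k k f\<close>]] F(2) that by simp
  ultimately show ?case
    unfolding C_k.simps by (intro exI[of _ "\<lambda>x. exp (f x) *\<^sub>R F x"] conjI allI ballI)
qed (auto intro: continuous_on_exp)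

lemma C_k_sin_cos: "C_k k f \<Longrightarrow> C_k k (\<lambda>x. sin (f x)) \<and> C_k k (\<lambda>x. cos (f x))"
proof (induction k arbitrary: f)
  case (Suc k)
  then obtain F where F: "\<forall>x. GDERIV f x :> F x" "\<forall>b\<in>Basis. C_k k (\<lambda>x. F x \<bullet> b)" by auto
  have "C_k k f" using Suc.prems by (rule C_k_SucD)
  have d: "GDERIV (\<lambda>x. sin (f x)) x :> cos (f x) *\<^sub>R F x" "GDERIV (\<lambda>x. cos (f x)) x :> (- sin (f x)) *\<^sub>R F x" for x
    using F(1) GDERIV_DERIV_compose[OF _ DERIV_sin, of f x "F x"] GDERIV_DERIV_compose[OF _ DERIV_cos, of f x "F x"]
    by blast+
  have "C_k k (\<lambda>x. (cos (f x) *\<^sub>R F x) \<bullet> b)" if "b \<in> Basis" for b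
    using C_k_mult[OF conjunct2[OF Suc.IH[OF \<open>C_k k f\<close>]]] F(2) that by simp
  moreover have "C_k k (\<lambda>x. ((- sin (f x)) *\<^sub>R F x) \<bullet> b)" if "b \<in> Basis" for b
  proof -
    have "C_k k (\<lambda>x. (-1) * (sin (f x) * (F x \<bullet> b)))"
      by (rule C_k_mult[OF C_k_const C_k_mult[OF conjunct1[OF Suc.IH[OF \<open>C_k k f\<close>]] F(2)[rule_format, OF that]]])
    then show ?thesis by simp
  qed
  ultimately show ?case
    unfolding C_k.simps using d
    by (intro conjI exI[of _ "\<lambda>x. cos (f x) *\<^sub>R F x"] exI[of _ "\<lambda>x. (- sin (f x)) *\<^sub>R F x"] allI ballI)
qed (auto intro: continuous_on_sin continuous_on_cos)

lemma C_infinity_continuous: "C_infinity f \<Longrightarrow> continuous_on S f"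
proof -
  assume "C_infinity f"
  then have "C_k 0 f" unfolding C_infinity_def by (rule spec)
  from C_k_continuous[OF this] show "continuous_on S f" by (rule continuous_on_subset) (rule subset_UNIV)
qed

lemma C_infinity_gradient_continuous:
  assumes f: "C_infinity f" and G: "\<And>x. GDERIV f x :> G x"
  shows "continuous_on S G"
proof -
  have "C_k (Suc 0) f" using f by (simp add: C_infinity_def del: C_k.simps)
  then obtain H where H: "\<forall>x. GDERIV f x :> H x" "\<forall>b\<in>Basis. continuous_on UNIV (\<lambda>x. H x \<bullet> b)" by auto
  then have "H = G" using GDERIV_unique[OF _ G] by (auto simp: fun_eq_iff)
  then have "continuous_on UNIV G"
    using H(2) by (subst continuous_on_componentwise) auto
  then show ?thesis by (rule continuous_on_subset) simp
qed

lemma continuous_on_fix_fst: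
  assumes "continuous_on (A \<times> B) F" "x \<in> A"
  shows "continuous_on B (\<lambda>y. F (x, y))"
proof -
  have "continuous_on B (\<lambda>y. (x, y))"
    by (rule continuous_on_Pair[OF continuous_on_const continuous_on_id])
  moreover have "continuous_on ((\<lambda>y. (x, y)) ` B) F"
    using assms(2) by (intro continuous_on_subset[OF assms(1)]) blast
  ultimately have "continuous_on B (F \<circ> (\<lambda>y. (x, y)))"
    by (rule continuous_on_compose)
  then show ?thesis by (simp only: comp_def)
qed

text \<open>
  The error of the linear approximation is uniform in \<open>y\<close>, by the mean value inequality and the uniform
  continuity of the gradient on a compact neighbourhood.
\<close>
lemma GDERIV_sphere_integral:
  fixes F :: "'a::euclidean_space \<times> 'b::euclidean_space \<Rightarrow> real"
  assumes F: "\<And>p. GDERIV F p :> G p" and G: "continuous_on UNIV G"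
    and \<rho>: "continuous_on (sphere 0 1) \<rho>"
  shows "GDERIV (\<lambda>x. \<integral>y. F (x, y) * \<rho> y \<partial>sphere_measure) x :> (\<integral>y. \<rho> y *\<^sub>R fst (G (x, y)) \<partial>sphere_measure)"
proof -
  have Fc: "continuous_on UNIV F"
  proof (rule has_derivative_continuous_on)
    show "(F has_derivative (\<lambda>h. h \<bullet> G p)) (at p within UNIV)" for p
      using F[of p] by (simp only: gderiv_def)
  qed
  have Fx: "continuous_on (sphere 0 1) (\<lambda>y. F (x, y))" and Gx: "continuous_on (sphere 0 1) (\<lambda>y. G (x, y))" for x
    by (rule continuous_on_fix_fst[of UNIV], rule continuous_on_subset[OF Fc] continuous_on_subset[OF G], simp, simp)+
  have intF: "integrable sphere_measure (\<lambda>y. F (x, y) * \<rho> y)" for x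
    by (intro integrable_sphere_continuous continuous_on_mult \<rho> Fx)
  have intG: "integrable sphere_measure (\<lambda>y. \<rho> y *\<^sub>R fst (G (x, y)))" for x
    by (intro integrable_sphere_continuous continuous_on_scaleR \<rho> continuous_on_fst Gx)
  have "bounded (\<rho> ` sphere 0 1)"
    using \<rho> by (intro compact_imp_bounded compact_continuous_image) auto
  then obtain R where R: "R > 0" "\<And>y. y \<in> sphere 0 1 \<Longrightarrow> \<bar>\<rho> y\<bar> \<le> R"
    unfolding bounded_pos by auto
  define D where "D = (\<integral>y. \<rho> y *\<^sub>R fst (G (x, y)) \<partial>sphere_measure)"
  define I where "I x = (\<integral>y. F (x, y) * \<rho> y \<partial>sphere_measure)" for x
  have "(I has_derivative (\<lambda>h. h \<bullet> D)) (at x)"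
    unfolding has_derivative_at_alt
  proof (intro conjI allI impI)
    show "bounded_linear (\<lambda>h. h \<bullet> D)" by (rule bounded_linear_inner_left)
    fix \<epsilon> :: real assume "\<epsilon> > 0"
    define A where "A = sphere_area TYPE('b)"
    have A: "A > 0" by (simp add: A_def sphere_area_pos)
    define \<eta> where "\<eta> = \<epsilon> / (R * A)"
    have \<eta>: "\<eta> > 0" using \<open>\<epsilon> > 0\<close> R A by (simp add: \<eta>_def)
    have "uniformly_continuous_on (cball x 1 \<times> sphere 0 1) G"
      by (intro compact_uniformly_continuous continuous_on_subset[OF G] compact_Times) auto
    then obtain d0 where d0: "d0 > 0" "\<And>p q. p \<in> cball x 1 \<times> sphere 0 1 \<Longrightarrow> q \<in> cball x 1 \<times> sphere 0 1 \<Longrightarrow>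
        dist q p < d0 \<Longrightarrow> dist (G q) (G p) < \<eta>"
      using \<eta> unfolding uniformly_continuous_on_def by metis
    define d where "d = min d0 1"
    have d: "d > 0" using d0 by (simp add: d_def)
    have key: "\<bar>F (x', y) - F (x, y) - (x' - x) \<bullet> fst (G (x, y))\<bar> \<le> \<eta> * norm (x' - x)"
      if x': "x' \<in> ball x d" and y: "y \<in> sphere 0 1" for x' y
    proof -
      define \<phi> where "\<phi> z = F (z, y) - z \<bullet> fst (G (x, y))" for z
      have "norm (\<phi> x' - \<phi> x) \<le> \<eta> * norm (x' - x)"
      proof (rule differentiable_bound[of "ball x d" \<phi> "\<lambda>z h. h \<bullet> (fst (G (z, y)) - fst (G (x, y)))"])
        fix z assume z: "z \<in> ball x d"
        have "((\<lambda>z. F (z, y)) has_derivative (\<lambda>h. (h, 0) \<bullet> G (z, y))) (at z within ball x d)"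
          using F[of "(z, y)"] unfolding gderiv_def
          by (intro has_derivative_compose[where f="\<lambda>z. (z, y)" and g=F and f'="\<lambda>h. (h, 0)" and g'="\<lambda>h. h \<bullet> G (z, y)"])
             (auto intro!: derivative_eq_intros)
        then have "(\<phi> has_derivative (\<lambda>h. (h, 0) \<bullet> G (z, y) - h \<bullet> fst (G (x, y)))) (at z within ball x d)"
          unfolding \<phi>_def by (intro has_derivative_diff has_derivative_inner_left has_derivative_ident)
        moreover have "(\<lambda>h. (h, 0) \<bullet> G (z, y) - h \<bullet> fst (G (x, y))) = (\<lambda>h. h \<bullet> (fst (G (z, y)) - fst (G (x, y))))"
          by (auto simp: inner_prod_def inner_diff_right)
        ultimately show "(\<phi> has_derivative (\<lambda>h. h \<bullet> (fst (G (z, y)) - fst (G (x, y))))) (at z within ball x d)" by simp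
        have "dist (G (z, y)) (G (x, y)) < \<eta>"
          using z y d0(1) by (intro d0(2)) (auto simp: d_def dist_Pair_Pair dist_commute)
        then have "norm (fst (G (z, y)) - fst (G (x, y))) \<le> \<eta>"
          using dist_fst_le[of "G (z, y)" "G (x, y)"] by (simp add: dist_norm)
        then have "norm (h \<bullet> (fst (G (z, y)) - fst (G (x, y)))) \<le> \<eta> * norm h" for h
          using order.trans[OF Cauchy_Schwarz_ineq2 mult_left_mono, of "fst (G (z, y)) - fst (G (x, y))" \<eta> h]
          by (simp add: mult.commute)
        then show "onorm (\<lambda>h. h \<bullet> (fst (G (z, y)) - fst (G (x, y)))) \<le> \<eta>"
          by (rule onorm_bound[OF less_imp_le[OF \<eta>]])
      qed (use x' d in auto)
      then show ?thesis by (simp add: \<phi>_def algebra_simps inner_diff_left)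
    qed
    show "\<exists>d>0. \<forall>x'. norm (x' - x) < d \<longrightarrow> norm (I x' - I x - (x' - x) \<bullet> D) \<le> \<epsilon> * norm (x' - x)"
    proof (intro exI[of _ d] conjI allI impI d)
      fix x' assume "norm (x' - x) < d"
      then have x': "x' \<in> ball x d" by (simp add: dist_norm norm_minus_commute)
      have "(x' - x) \<bullet> D = (\<integral>y. (x' - x) \<bullet> (\<rho> y *\<^sub>R fst (G (x, y))) \<partial>sphere_measure)"
        unfolding D_def by (rule integral_inner_right[symmetric]) (rule intG)
      then have "I x' - I x - (x' - x) \<bullet> D = (\<integral>y. F (x', y) * \<rho> y - F (x, y) * \<rho> y
          - (x' - x) \<bullet> (\<rho> y *\<^sub>R fst (G (x, y))) \<partial>sphere_measure)"
        unfolding I_def using intF intG integrable_inner_right[OF intG] by simp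
      also have "\<dots> = (\<integral>y. (F (x', y) - F (x, y) - (x' - x) \<bullet> fst (G (x, y))) * \<rho> y \<partial>sphere_measure)"
        by (simp add: algebra_simps)
      finally have eq: "I x' - I x - (x' - x) \<bullet> D = \<dots>" .
      have "\<bar>(\<integral>y. (F (x', y) - F (x, y) - (x' - x) \<bullet> fst (G (x, y))) * \<rho> y \<partial>sphere_measure)\<bar>
          \<le> (\<eta> * norm (x' - x) * R) * A"
        unfolding A_def
      proof (rule abs_integral_sphere_le)
        fix y :: 'b assume y: "y \<in> sphere 0 1"
        show "\<bar>(F (x', y) - F (x, y) - (x' - x) \<bullet> fst (G (x, y))) * \<rho> y\<bar> \<le> \<eta> * norm (x' - x) * R"
          unfolding abs_mult using key[OF x' y] R(2)[OF y] \<eta> by (intro mult_mono) auto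
      qed (use \<eta> R in simp)
      also have "\<dots> = \<epsilon> * norm (x' - x)" using R A by (simp add: \<eta>_def)
      finally show "norm (I x' - I x - (x' - x) \<bullet> D) \<le> \<epsilon> * norm (x' - x)" unfolding eq by simp
    qed
  qed
  then show ?thesis by (simp add: gderiv_def I_def[abs_def] D_def)
qed

text \<open>
  The partial derivatives are again integrals of this form, so smoothness follows by induction.
\<close>
lemma C_k_sphere_integral:
  fixes F :: "'a::euclidean_space \<times> 'b::euclidean_space \<Rightarrow> real"
  assumes \<rho>: "continuous_on (sphere 0 1) \<rho>"
  shows "C_k k F \<Longrightarrow> C_k k (\<lambda>x. \<integral>y. F (x, y) * \<rho> y \<partial>sphere_measure)"
proof (induction k arbitrary: F)
  case 0
  then have F: "continuous_on UNIV F" by simp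
  have "continuous_on (UNIV \<times> sphere 0 1) (\<lambda>(x, y). F (x, y) * \<rho> y)"
    unfolding case_prod_unfold
  proof (rule continuous_on_mult)
    show "continuous_on (UNIV \<times> sphere 0 1) (\<lambda>p. F (fst p, snd p))"
      using continuous_on_subset[OF F] by simp
    show "continuous_on (UNIV \<times> sphere 0 1) (\<lambda>p. \<rho> (snd p))"
      by (rule continuous_on_compose2[OF \<rho>]) (auto intro!: continuous_on_snd continuous_on_id)
  qed
  then show ?case by (simp add: continuous_on_sphere_parametric_integral)
next
  case (Suc k)
  then obtain G where "\<forall>p. GDERIV F p :> G p" "\<forall>b\<in>Basis. C_k k (\<lambda>p. G p \<bullet> b)"
    unfolding C_k.simps by blast
  then have G: "\<And>p. GDERIV F p :> G p" "\<And>b. b \<in> Basis \<Longrightarrow> C_k k (\<lambda>p. G p \<bullet> b)" by blast+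
  have Gc: "continuous_on UNIV G"
    using C_k_continuous[OF G(2)] by (subst continuous_on_componentwise) auto
  have intG: "integrable sphere_measure (\<lambda>y. \<rho> y *\<^sub>R fst (G (x, y)))" for x
  proof (intro integrable_sphere_continuous continuous_on_scaleR \<rho> continuous_on_fst)
    show "continuous_on (sphere 0 1) (\<lambda>y. G (x, y))"
      by (rule continuous_on_fix_fst[of UNIV]) (auto intro: continuous_on_subset[OF Gc])
  qed
  have "C_k k (\<lambda>x. (\<integral>y. \<rho> y *\<^sub>R fst (G (x, y)) \<partial>sphere_measure) \<bullet> b)" if b: "b \<in> Basis" for b
  proof -
    have "(b, 0) \<in> (Basis :: ('a \<times> 'b) set)" using b by (simp add: Basis_prod_def)
    from Suc.IH[OF G(2)[OF this]]
    have "C_k k (\<lambda>x. \<integral>y. (G (x, y) \<bullet> (b, 0)) * \<rho> y \<partial>sphere_measure)" .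
    moreover have "(\<integral>y. (G (x, y) \<bullet> (b, 0)) * \<rho> y \<partial>sphere_measure) = (\<integral>y. \<rho> y *\<^sub>R fst (G (x, y)) \<partial>sphere_measure) \<bullet> b" for x
    proof -
      have "(\<integral>y. \<rho> y *\<^sub>R fst (G (x, y)) \<partial>sphere_measure) \<bullet> b = (\<integral>y. (\<rho> y *\<^sub>R fst (G (x, y))) \<bullet> b \<partial>sphere_measure)"
        by (rule integral_inner_left[symmetric]) (rule intG)
      then show ?thesis by (simp add: inner_prod_def mult.commute)
    qed
    ultimately show ?thesis by simp
  qed
  then show ?case
    unfolding C_k.simps using GDERIV_sphere_integral[OF G(1) Gc \<rho>]
    by (intro exI[of _ "\<lambda>x. \<integral>y. \<rho> y *\<^sub>R fst (G (x, y)) \<partial>sphere_measure"] conjI allI ballI)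
qed

section \<open>Square integrability of convolutions\<close>

lemma tendsto_0_dominated:
  fixes a b :: "nat \<Rightarrow> real"
  assumes "\<And>i. 0 \<le> a i" "\<And>i. a i \<le> b i" "b \<longlonglongrightarrow> 0"
  shows "a \<longlonglongrightarrow> 0"
  by (rule tendsto_sandwich[OF _ _ tendsto_const assms(3)]) (use assms in auto)

lemma integrable_norm_square_add:
  fixes f g :: "'x \<Rightarrow> 'c::euclidean_space"
  assumes [measurable]: "f \<in> borel_measurable M" "g \<in> borel_measurable M"
    and f: "integrable M (\<lambda>x. (norm (f x))\<^sup>2)" and g: "integrable M (\<lambda>x. (norm (g x))\<^sup>2)"
  shows "integrable M (\<lambda>x. (norm (f x + g x))\<^sup>2)"
    and "(\<integral>x. (norm (f x + g x))\<^sup>2 \<partial>M) \<le> 2 * (\<integral>x. (norm (f x))\<^sup>2 \<partial>M) + 2 * (\<integral>x. (norm (g x))\<^sup>2 \<partial>M)"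
proof -
  have le: "(norm (f x + g x))\<^sup>2 \<le> 2 * (norm (f x))\<^sup>2 + 2 * (norm (g x))\<^sup>2" for x
  proof -
    have "(norm (f x + g x))\<^sup>2 \<le> (norm (f x) + norm (g x))\<^sup>2"
      by (intro power_mono norm_triangle_ineq) auto
    also have "\<dots> \<le> 2 * (norm (f x))\<^sup>2 + 2 * (norm (g x))\<^sup>2"
      using zero_le_power2[of "norm (f x) - norm (g x)"] by (simp add: power2_diff power2_sum)
    finally show ?thesis .
  qed
  have i: "integrable M (\<lambda>x. 2 * (norm (f x))\<^sup>2 + 2 * (norm (g x))\<^sup>2)" using f g by simp
  show 1: "integrable M (\<lambda>x. (norm (f x + g x))\<^sup>2)"
    by (rule Bochner_Integration.integrable_bound[OF i]) (use le in \<open>auto intro: order.trans[OF le]\<close>)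
  show "(\<integral>x. (norm (f x + g x))\<^sup>2 \<partial>M) \<le> 2 * (\<integral>x. (norm (f x))\<^sup>2 \<partial>M) + 2 * (\<integral>x. (norm (g x))\<^sup>2 \<partial>M)"
    using integral_mono[OF 1 i le] f g by simp
qed

lemma integrable_norm_square_diff:
  fixes f g :: "'x \<Rightarrow> 'c::euclidean_space"
  assumes "f \<in> borel_measurable M" "g \<in> borel_measurable M"
    and "integrable M (\<lambda>x. (norm (f x))\<^sup>2)" and "integrable M (\<lambda>x. (norm (g x))\<^sup>2)"
  shows "integrable M (\<lambda>x. (norm (f x - g x))\<^sup>2)"
  using integrable_norm_square_add(1)[of f M "\<lambda>x. - g x"] assms by simp

lemma (in finite_measure) integrable_if_norm_square:
  fixes f :: "'a \<Rightarrow> 'c::euclidean_space"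
  assumes [measurable]: "f \<in> borel_measurable M" and f: "integrable M (\<lambda>x. (norm (f x))\<^sup>2)"
  shows "integrable M f"
proof (rule Bochner_Integration.integrable_bound[where f="\<lambda>x. 1 + (norm (f x))\<^sup>2"])
  show "integrable M (\<lambda>x. 1 + (norm (f x))\<^sup>2)" using f by simp
  have "norm (f x) \<le> 1 + (norm (f x))\<^sup>2" for x
  proof -
    have "2 * norm (f x) \<le> 1 + (norm (f x))\<^sup>2"
      using zero_le_power2[of "norm (f x) - 1"] by (simp add: power2_diff)
    then show ?thesis using norm_ge_zero[of "f x"] by linarith
  qed
  then show "AE x in M. norm (f x) \<le> norm (1 + (norm (f x))\<^sup>2)" by simp
qed measurable

lemma norm_sphere_integral_square_le:
  fixes f :: "'a::euclidean_space \<Rightarrow> 'c::euclidean_space"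
  assumes m: "f \<in> borel_measurable sphere_measure"
    and f: "integrable sphere_measure (\<lambda>x. (norm (f x))\<^sup>2)"
  shows "(norm (\<integral>x. f x \<partial>sphere_measure))\<^sup>2 \<le> sphere_area TYPE('a) * (\<integral>x. (norm (f x))\<^sup>2 \<partial>sphere_measure)"
proof -
  let ?A = "sphere_area TYPE('a)"
  have A: "?A > 0" by (rule sphere_area_pos)
  have i: "integrable sphere_measure (\<lambda>x. norm (f x))"
    using sphere_measure.integrable_if_norm_square[OF m f] by simp
  define c where "c = (\<integral>x. norm (f x) \<partial>sphere_measure) / ?A"
  have cA: "(\<integral>x. norm (f x) \<partial>sphere_measure) = c * ?A" using A by (simp add: c_def)
  have "0 \<le> (\<integral>x. (norm (f x) - c)\<^sup>2 \<partial>sphere_measure)" by simp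
  also have "(\<integral>x. (norm (f x) - c)\<^sup>2 \<partial>sphere_measure)
      = (\<integral>x. (norm (f x))\<^sup>2 - 2 * c * norm (f x) + c\<^sup>2 \<partial>sphere_measure)"
    by (simp add: power2_diff algebra_simps)
  also have "\<dots> = (\<integral>x. (norm (f x))\<^sup>2 \<partial>sphere_measure) - c\<^sup>2 * ?A"
    using f i by (simp add: cA sphere_area_def power2_eq_square algebra_simps)
  finally have le: "c\<^sup>2 * ?A \<le> (\<integral>x. (norm (f x))\<^sup>2 \<partial>sphere_measure)" by simp
  have "(norm (\<integral>x. f x \<partial>sphere_measure))\<^sup>2 \<le> (c * ?A)\<^sup>2"
    unfolding cA[symmetric] by (intro power_mono integral_norm_bound) auto
  also have "\<dots> = ?A * (c\<^sup>2 * ?A)" by (simp add: power2_eq_square)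
  also have "\<dots> \<le> ?A * (\<integral>x. (norm (f x))\<^sup>2 \<partial>sphere_measure)" using le A by simp
  finally show ?thesis .
qed

text \<open>
  The Cauchy--Schwarz inequality in \<open>y\<close> for almost every \<open>x\<close>: convolution with a bounded function maps \<open>L\<^sub>2\<close> of the
  product to \<open>L\<^sub>2\<close> of the sphere.
\<close>
lemma sphere_convolution_bound:
  fixes g :: "'a::euclidean_space \<times> 'b::euclidean_space \<Rightarrow> 'c::euclidean_space"
  assumes m: "g \<in> borel_measurable (sphere_measure \<Otimes>\<^sub>M sphere_measure)"
    and g: "integrable (sphere_measure \<Otimes>\<^sub>M sphere_measure) (\<lambda>p. (norm (g p))\<^sup>2)"
    and \<rho>: "continuous_on (sphere 0 1) \<rho>" and R: "\<forall>y\<in>sphere 0 1. \<bar>\<rho> y\<bar> \<le> R"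
  shows "(\<lambda>x. \<integral>y. \<rho> y *\<^sub>R g (x, y) \<partial>sphere_measure) \<in> borel_measurable sphere_measure"
    and "AE x in sphere_measure. integrable sphere_measure (\<lambda>y. \<rho> y *\<^sub>R g (x, y))"
    and "integrable sphere_measure (\<lambda>x. (norm (\<integral>y. \<rho> y *\<^sub>R g (x, y) \<partial>sphere_measure))\<^sup>2)"
    and "(\<integral>x. (norm (\<integral>y. \<rho> y *\<^sub>R g (x, y) \<partial>sphere_measure))\<^sup>2 \<partial>sphere_measure)
      \<le> sphere_area TYPE('b) * R\<^sup>2 * (\<integral>p. (norm (g p))\<^sup>2 \<partial>(sphere_measure \<Otimes>\<^sub>M sphere_measure))"
proof -
  let ?A = "sphere_area TYPE('b)"
  have m\<rho> [measurable]: "\<rho> \<in> borel_measurable sphere_measure" by (rule borel_measurable_sphere_continuous[OF \<rho>])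
  note m[measurable]
  show meas: "(\<lambda>x. \<integral>y. \<rho> y *\<^sub>R g (x, y) \<partial>sphere_measure) \<in> borel_measurable sphere_measure"
    by (rule sphere_measure.borel_measurable_lebesgue_integral) measurable
  have "AE x in sphere_measure. integrable sphere_measure (\<lambda>y. (norm (g (x, y)))\<^sup>2)"
    by (rule sphere_pair.AE_integrable_fst'[OF g])
  then have ae: "AE x in sphere_measure. integrable sphere_measure (\<lambda>y. \<rho> y *\<^sub>R g (x, y)) \<and>
     (norm (\<integral>y. \<rho> y *\<^sub>R g (x, y) \<partial>sphere_measure))\<^sup>2 \<le> ?A * R\<^sup>2 * (\<integral>y. (norm (g (x, y)))\<^sup>2 \<partial>sphere_measure)"
  proof (rule AE_mp[OF _ AE_I2], intro impI)
    fix x :: 'a assume x: "x \<in> space sphere_measure" and gx: "integrable sphere_measure (\<lambda>y. (norm (g (x, y)))\<^sup>2)"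
    have mx: "(\<lambda>y. g (x, y)) \<in> borel_measurable sphere_measure"
      using measurable_Pair2[OF m x] .
    then have mx': "(\<lambda>y. \<rho> y *\<^sub>R g (x, y)) \<in> borel_measurable sphere_measure"
      using m\<rho> by (rule borel_measurable_scaleR[rotated])
    have le: "(norm (\<rho> y *\<^sub>R g (x, y)))\<^sup>2 \<le> R\<^sup>2 * (norm (g (x, y)))\<^sup>2" if "y \<in> sphere 0 1" for y
    proof -
      have "(\<rho> y)\<^sup>2 \<le> R\<^sup>2" using power_mono[OF R[rule_format, OF that], of 2] by simp
      then show ?thesis by (simp add: power_mult_distrib mult_right_mono)
    qed
    have i2: "integrable sphere_measure (\<lambda>y. (norm (\<rho> y *\<^sub>R g (x, y)))\<^sup>2)"
    proof (rule Bochner_Integration.integrable_bound[where f="\<lambda>y. R\<^sup>2 * (norm (g (x, y)))\<^sup>2"])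
      show "integrable sphere_measure (\<lambda>y. R\<^sup>2 * (norm (g (x, y)))\<^sup>2)" using gx by simp
      show "(\<lambda>y. (norm (\<rho> y *\<^sub>R g (x, y)))\<^sup>2) \<in> borel_measurable sphere_measure"
        using mx' by measurable
      show "AE y in sphere_measure. norm ((norm (\<rho> y *\<^sub>R g (x, y)))\<^sup>2) \<le> norm (R\<^sup>2 * (norm (g (x, y)))\<^sup>2)"
        using le by (intro AE_I2) (simp add: abs_mult)
    qed
    have "(norm (\<integral>y. \<rho> y *\<^sub>R g (x, y) \<partial>sphere_measure))\<^sup>2 \<le> ?A * (\<integral>y. (norm (\<rho> y *\<^sub>R g (x, y)))\<^sup>2 \<partial>sphere_measure)"
      by (rule norm_sphere_integral_square_le[OF mx' i2])
    also have "\<dots> \<le> ?A * (\<integral>y. R\<^sup>2 * (norm (g (x, y)))\<^sup>2 \<partial>sphere_measure)"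
      using i2 gx le sphere_area_pos[where 'a='b] by (intro mult_left_mono integral_mono) auto
    finally show "integrable sphere_measure (\<lambda>y. \<rho> y *\<^sub>R g (x, y)) \<and>
       (norm (\<integral>y. \<rho> y *\<^sub>R g (x, y) \<partial>sphere_measure))\<^sup>2 \<le> ?A * R\<^sup>2 * (\<integral>y. (norm (g (x, y)))\<^sup>2 \<partial>sphere_measure)"
      using sphere_measure.integrable_if_norm_square[OF mx' i2] by (simp add: mult.assoc)
  qed
  then show "AE x in sphere_measure. integrable sphere_measure (\<lambda>y. \<rho> y *\<^sub>R g (x, y))" by eventually_elim simp
  have bi: "integrable sphere_measure (\<lambda>x. ?A * R\<^sup>2 * (\<integral>y. (norm (g (x, y)))\<^sup>2 \<partial>sphere_measure))"
    using sphere_pair.integrable_fst'[OF g] by simp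
  show int: "integrable sphere_measure (\<lambda>x. (norm (\<integral>y. \<rho> y *\<^sub>R g (x, y) \<partial>sphere_measure))\<^sup>2)"
  proof (rule Bochner_Integration.integrable_bound[OF bi])
    show "(\<lambda>x. (norm (\<integral>y. \<rho> y *\<^sub>R g (x, y) \<partial>sphere_measure))\<^sup>2) \<in> borel_measurable sphere_measure"
      using meas by measurable
    show "AE x in sphere_measure. norm ((norm (\<integral>y. \<rho> y *\<^sub>R g (x, y) \<partial>sphere_measure))\<^sup>2)
        \<le> norm (?A * R\<^sup>2 * (\<integral>y. (norm (g (x, y)))\<^sup>2 \<partial>sphere_measure))"
      using ae by eventually_elim (auto intro: order.trans[OF _ abs_ge_self])
  qed
  have "(\<integral>x. (norm (\<integral>y. \<rho> y *\<^sub>R g (x, y) \<partial>sphere_measure))\<^sup>2 \<partial>sphere_measure)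
     \<le> (\<integral>x. ?A * R\<^sup>2 * (\<integral>y. (norm (g (x, y)))\<^sup>2 \<partial>sphere_measure) \<partial>sphere_measure)"
    using ae by (intro integral_mono_AE int bi) (auto elim: AE_mp)
  also have "\<dots> = ?A * R\<^sup>2 * (\<integral>p. (norm (g p))\<^sup>2 \<partial>(sphere_measure \<Otimes>\<^sub>M sphere_measure))"
    using sphere_pair.integral_fst'[OF g] by simp
  finally show "(\<integral>x. (norm (\<integral>y. \<rho> y *\<^sub>R g (x, y) \<partial>sphere_measure))\<^sup>2 \<partial>sphere_measure)
      \<le> ?A * R\<^sup>2 * (\<integral>p. (norm (g p))\<^sup>2 \<partial>(sphere_measure \<Otimes>\<^sub>M sphere_measure))" .
qed

section \<open>Weak gradients on the sphere\<close>

lemma linear_tangent_proj: "linear (tangent_proj x)"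
  by (rule linearI) (simp_all add: tangent_proj_def inner_add_right algebra_simps)

lemma bounded_linear_tangent_proj: "bounded_linear (tangent_proj x)"
  using linear_tangent_proj linear_conv_bounded_linear by blast

lemma continuous_on_tangent_proj:
  assumes "continuous_on S f" "continuous_on S g"
  shows "continuous_on S (\<lambda>x. tangent_proj (f x) (g x))"
  unfolding tangent_proj_def by (intro continuous_intros assms)

lemma has_sphere_gradientI:
  assumes "u \<in> borel_measurable sphere_measure" "integrable sphere_measure (\<lambda>x. (u x)\<^sup>2)"
    "v \<in> borel_measurable sphere_measure" "integrable sphere_measure (\<lambda>x. (norm (v x))\<^sup>2)"
    "\<And>i. C_infinity (F i)" "\<And>i x. GDERIV (F i) x :> G i x"
    "(\<lambda>i::nat. \<integral>x. (F i x - u x)\<^sup>2 \<partial>sphere_measure) \<longlonglongrightarrow> 0"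
    "(\<lambda>i. \<integral>x. (norm (tangent_proj x (G i x) - v x))\<^sup>2 \<partial>sphere_measure) \<longlonglongrightarrow> 0"
  shows "has_sphere_gradient u v"
  unfolding has_sphere_gradient_def has_weak_gradient_def using assms by blast

lemma has_sphere_gradientE:
  assumes "has_sphere_gradient u v"
  obtains F G where "u \<in> borel_measurable sphere_measure" "integrable sphere_measure (\<lambda>x. (u x)\<^sup>2)"
    "v \<in> borel_measurable sphere_measure" "integrable sphere_measure (\<lambda>x. (norm (v x))\<^sup>2)"
    "\<And>i. C_infinity (F i)" "\<And>i x. GDERIV (F i) x :> G i x"
    "(\<lambda>i::nat. \<integral>x. (F i x - u x)\<^sup>2 \<partial>sphere_measure) \<longlonglongrightarrow> 0"
    "(\<lambda>i. \<integral>x. (norm (tangent_proj x (G i x) - v x))\<^sup>2 \<partial>sphere_measure) \<longlonglongrightarrow> 0"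
  using assms unfolding has_sphere_gradient_def has_weak_gradient_def by blast

lemma smooth_sphere_regular:
  assumes F: "C_infinity F" and G: "\<And>x. GDERIV F x :> G x"
  shows "F \<in> borel_measurable sphere_measure" "integrable sphere_measure (\<lambda>x. (F x)\<^sup>2)"
    "(\<lambda>x. tangent_proj x (G x)) \<in> borel_measurable sphere_measure"
    "integrable sphere_measure (\<lambda>x. (norm (tangent_proj x (G x)))\<^sup>2)"
proof -
  have c: "continuous_on (sphere 0 1) F" "continuous_on (sphere 0 1) (\<lambda>x. tangent_proj x (G x))"
    by (intro C_infinity_continuous F continuous_on_tangent_proj continuous_on_id C_infinity_gradient_continuous[OF F G])+
  show "F \<in> borel_measurable sphere_measure" "(\<lambda>x. tangent_proj x (G x)) \<in> borel_measurable sphere_measure"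
    using c by (auto intro: borel_measurable_sphere_continuous)
  show "integrable sphere_measure (\<lambda>x. (F x)\<^sup>2)" "integrable sphere_measure (\<lambda>x. (norm (tangent_proj x (G x)))\<^sup>2)"
    using c by (auto intro!: integrable_sphere_continuous continuous_on_power continuous_on_norm)
qed

text \<open>
  A diagonal choice among the smooth approximations of the members of the sequence.
\<close>
lemma has_sphere_gradient_closed:
  assumes uv: "\<And>j::nat. has_sphere_gradient (u j) (v j)"
    and u: "u' \<in> borel_measurable sphere_measure" "integrable sphere_measure (\<lambda>x. (u' x)\<^sup>2)"
    and v: "v' \<in> borel_measurable sphere_measure" "integrable sphere_measure (\<lambda>x. (norm (v' x))\<^sup>2)"
    and ulim: "(\<lambda>j. \<integral>x. (u j x - u' x)\<^sup>2 \<partial>sphere_measure) \<longlonglongrightarrow> 0"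
    and vlim: "(\<lambda>j. \<integral>x. (norm (v j x - v' x))\<^sup>2 \<partial>sphere_measure) \<longlonglongrightarrow> 0"
  shows "has_sphere_gradient u' v'"
proof -
  define P where "P j F G \<longleftrightarrow> C_infinity F \<and> (\<forall>x. GDERIV F x :> G x) \<and>
      (\<integral>x. (F x - u j x)\<^sup>2 \<partial>sphere_measure) < inverse (real (Suc j)) \<and>
      (\<integral>x. (norm (tangent_proj x (G x) - v j x))\<^sup>2 \<partial>sphere_measure) < inverse (real (Suc j))" for j F G
  have "\<exists>F G. P j F G" for j
  proof -
    obtain F G where *: "\<And>i. C_infinity (F i)" "\<And>i x. GDERIV (F i) x :> G i x"
      "(\<lambda>i::nat. \<integral>x. (F i x - u j x)\<^sup>2 \<partial>sphere_measure) \<longlonglongrightarrow> 0"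
      "(\<lambda>i. \<integral>x. (norm (tangent_proj x (G i x) - v j x))\<^sup>2 \<partial>sphere_measure) \<longlonglongrightarrow> 0"
      using uv[of j] unfolding has_sphere_gradient_def has_weak_gradient_def by blast
    have "\<forall>\<^sub>F i in sequentially. (\<integral>x. (F i x - u j x)\<^sup>2 \<partial>sphere_measure) < inverse (real (Suc j)) \<and>
        (\<integral>x. (norm (tangent_proj x (G i x) - v j x))\<^sup>2 \<partial>sphere_measure) < inverse (real (Suc j))"
      using order_tendstoD(2)[OF *(3), of "inverse (real (Suc j))"] order_tendstoD(2)[OF *(4), of "inverse (real (Suc j))"]
      by (intro eventually_conj) auto
    then obtain i where "(\<integral>x. (F i x - u j x)\<^sup>2 \<partial>sphere_measure) < inverse (real (Suc j)) \<and>
        (\<integral>x. (norm (tangent_proj x (G i x) - v j x))\<^sup>2 \<partial>sphere_measure) < inverse (real (Suc j))"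
      by (auto simp: eventually_sequentially)
    then show ?thesis using *(1,2) unfolding P_def by blast
  qed
  then obtain F G where "\<And>j. P j (F j) (G j)" by metis
  then have F: "\<And>j. C_infinity (F j)" "\<And>j x. GDERIV (F j) x :> G j x"
    and Fu: "\<And>j. (\<integral>x. (F j x - u j x)\<^sup>2 \<partial>sphere_measure) < inverse (real (Suc j))"
    and Gv: "\<And>j. (\<integral>x. (norm (tangent_proj x (G j x) - v j x))\<^sup>2 \<partial>sphere_measure) < inverse (real (Suc j))"
    unfolding P_def by blast+
  have uj: "u j \<in> borel_measurable sphere_measure" "integrable sphere_measure (\<lambda>x. (u j x)\<^sup>2)"
     "v j \<in> borel_measurable sphere_measure" "integrable sphere_measure (\<lambda>x. (norm (v j x))\<^sup>2)" for j
    by (rule has_sphere_gradientE[OF uv[of j]], assumption)+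
  note reg = smooth_sphere_regular[OF F(1) F(2)]
  show ?thesis
  proof (rule has_sphere_gradientI[OF u v F])
    have le: "(\<integral>x. (F j x - u' x)\<^sup>2 \<partial>sphere_measure)
       \<le> 2 * inverse (real (Suc j)) + 2 * (\<integral>x. (u j x - u' x)\<^sup>2 \<partial>sphere_measure)" for j
    proof -
      have "(\<integral>x. (norm ((F j x - u j x) + (u j x - u' x)))\<^sup>2 \<partial>sphere_measure)
         \<le> 2 * (\<integral>x. (norm (F j x - u j x))\<^sup>2 \<partial>sphere_measure) + 2 * (\<integral>x. (norm (u j x - u' x))\<^sup>2 \<partial>sphere_measure)"
        using reg[of j] uj[of j] u by (intro integrable_norm_square_add(2) borel_measurable_diff integrable_norm_square_diff) simp_all
      then show ?thesis using Fu[of j] by simp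
    qed
    have "(\<lambda>j. 2 * inverse (real (Suc j)) + 2 * (\<integral>x. (u j x - u' x)\<^sup>2 \<partial>sphere_measure)) \<longlonglongrightarrow> 2 * 0 + 2 * 0"
      by (intro tendsto_intros LIMSEQ_inverse_real_of_nat ulim)
    then show "(\<lambda>j. \<integral>x. (F j x - u' x)\<^sup>2 \<partial>sphere_measure) \<longlonglongrightarrow> 0"
      by (intro tendsto_0_dominated[OF _ le]) simp_all
    have le: "(\<integral>x. (norm (tangent_proj x (G j x) - v' x))\<^sup>2 \<partial>sphere_measure)
       \<le> 2 * inverse (real (Suc j)) + 2 * (\<integral>x. (norm (v j x - v' x))\<^sup>2 \<partial>sphere_measure)" for j
    proof -
      have "(\<integral>x. (norm ((tangent_proj x (G j x) - v j x) + (v j x - v' x)))\<^sup>2 \<partial>sphere_measure)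
         \<le> 2 * (\<integral>x. (norm (tangent_proj x (G j x) - v j x))\<^sup>2 \<partial>sphere_measure) + 2 * (\<integral>x. (norm (v j x - v' x))\<^sup>2 \<partial>sphere_measure)"
        using reg[of j] uj[of j] v by (intro integrable_norm_square_add(2) borel_measurable_diff integrable_norm_square_diff) simp_all
      then show ?thesis using Gv[of j] by simp
    qed
    have "(\<lambda>j. 2 * inverse (real (Suc j)) + 2 * (\<integral>x. (norm (v j x - v' x))\<^sup>2 \<partial>sphere_measure)) \<longlonglongrightarrow> 2 * 0 + 2 * 0"
      by (intro tendsto_intros LIMSEQ_inverse_real_of_nat vlim)
    then show "(\<lambda>j. \<integral>x. (norm (tangent_proj x (G j x) - v' x))\<^sup>2 \<partial>sphere_measure) \<longlonglongrightarrow> 0"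
      by (intro tendsto_0_dominated[OF _ le]) simp_all
  qed
qed

lemma norm_fst_le': "norm (fst p) \<le> norm p"
  using norm_fst_le[of "fst p" "snd p"] by simp

text \<open>
  Convolving the smooth approximations of \<open>W\<close> with \<open>\<rho>\<close> gives smooth functions on the sphere, and
  \<open>sphere_convolution_bound\<close> transfers the convergence of values and gradients.
\<close>
lemma has_sphere_gradient_convolution:
  fixes W :: "'a::euclidean_space \<times> 'a \<Rightarrow> real"
  assumes W: "has_sphere_product_gradient W DW" and Wc: "continuous_on (sphere 0 1 \<times> sphere 0 1) W"
    and \<rho>: "continuous_on (sphere 0 1) \<rho>"
  shows "has_sphere_gradient (\<lambda>x. \<integral>y. W (x, y) * \<rho> y \<partial>sphere_measure) (grad_conv DW \<rho>)"
proof -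
  let ?M = "sphere_measure \<Otimes>\<^sub>M sphere_measure :: ('a \<times> 'a) measure"
  let ?P = "\<lambda>(x, y) (a, b). (tangent_proj x a, tangent_proj y b :: 'a)"
  obtain F G where m: "DW \<in> borel_measurable ?M" and i: "integrable ?M (\<lambda>x. (norm (DW x))\<^sup>2)"
    and F: "\<And>i. C_infinity (F i)" and G: "\<And>i x. GDERIV (F i) x :> G i x"
    and Flim: "(\<lambda>i::nat. \<integral>p. (F i p - W p)\<^sup>2 \<partial>?M) \<longlonglongrightarrow> 0"
    and Glim: "(\<lambda>i. \<integral>p. (norm (?P p (G i p) - DW p))\<^sup>2 \<partial>?M) \<longlonglongrightarrow> 0"
    using W unfolding has_sphere_product_gradient_def has_weak_gradient_def by blast
  obtain R where "\<forall>y\<in>sphere 0 1. norm (\<rho> y) \<le> R"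
    by (rule continuous_on_sphere_bounded[OF \<rho>])
  then have R: "\<forall>y\<in>sphere 0 1. \<bar>\<rho> y\<bar> \<le> R" by simp
  define f where "f i x = (\<integral>y. F i (x, y) * \<rho> y \<partial>sphere_measure)" for i x
  define g where "g i x = (\<integral>y. \<rho> y *\<^sub>R fst (G i (x, y)) \<partial>sphere_measure)" for i x
  define b where "b x = (\<integral>y. W (x, y) * \<rho> y \<partial>sphere_measure)" for x
  have "continuous_on (sphere 0 1 \<times> sphere 0 1) (\<lambda>p. W p * \<rho> (snd p))"
    by (intro continuous_on_mult Wc continuous_on_compose2[OF \<rho>])
       (auto intro: continuous_on_snd continuous_on_id)
  then have bc: "continuous_on (sphere 0 1) b"
    unfolding b_def by (intro continuous_on_sphere_parametric_integral) (simp add: case_prod_unfold)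
  have fsm: "C_infinity (f i)" for i
    using F C_k_sphere_integral[OF \<rho>] unfolding C_infinity_def f_def[abs_def] by blast
  have Gc: "continuous_on S (G i)" for S i by (rule C_infinity_gradient_continuous[OF F G])
  have fg: "GDERIV (f i) x :> g i x" for i x
    unfolding f_def[abs_def] g_def by (rule GDERIV_sphere_integral[OF G Gc \<rho>])
  have C: "sphere_area TYPE('a) * R\<^sup>2 \<ge> 0" using sphere_area_pos[where 'a='a] by simp
  have fstDW: "(\<lambda>p. fst (DW p)) \<in> borel_measurable ?M"
    using m by (rule measurable_compose[OF _ borel_measurable_continuous_onI[OF continuous_on_fst[OF continuous_on_id]]])
  have fstDWi: "integrable ?M (\<lambda>p. (norm (fst (DW p)))\<^sup>2)"
  proof (rule Bochner_Integration.integrable_bound[OF i])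
    show "AE p in ?M. norm ((norm (fst (DW p)))\<^sup>2) \<le> norm ((norm (DW p))\<^sup>2)"
      by (intro AE_I2) (simp add: norm_fst_le' power_mono)
  qed (use fstDW in measurable)
  note v = sphere_convolution_bound[OF fstDW fstDWi \<rho> R]
  show ?thesis
    unfolding b_def[symmetric]
  proof (rule has_sphere_gradientI[of _ _ f g])
    show "b \<in> borel_measurable sphere_measure" by (rule borel_measurable_sphere_continuous[OF bc])
    show "integrable sphere_measure (\<lambda>x. (b x)\<^sup>2)"
      by (intro integrable_sphere_continuous continuous_on_power bc)
    show "grad_conv DW \<rho> \<in> borel_measurable sphere_measure"
      using v(1) by (simp add: grad_conv_def[abs_def])
    show "integrable sphere_measure (\<lambda>x. (norm (grad_conv DW \<rho> x))\<^sup>2)"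
      using v(3) by (simp add: grad_conv_def)
    show "C_infinity (f i)" "GDERIV (f i) x :> g i x" for i x by (rule fsm fg)+
    have le: "(\<integral>x. (f i x - b x)\<^sup>2 \<partial>sphere_measure) \<le> sphere_area TYPE('a) * R\<^sup>2 * (\<integral>p. (F i p - W p)\<^sup>2 \<partial>?M)" for i
    proof -
      have c: "continuous_on (sphere 0 1 \<times> sphere 0 1) (\<lambda>p. F i p - W p)"
        by (intro continuous_on_diff Wc C_infinity_continuous F)
      have "(\<integral>x. (f i x - b x)\<^sup>2 \<partial>sphere_measure)
          = (\<integral>x. (norm (\<integral>y. \<rho> y *\<^sub>R (F i (x, y) - W (x, y)) \<partial>sphere_measure))\<^sup>2 \<partial>sphere_measure)"
      proof (rule Bochner_Integration.integral_cong[OF refl])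
        fix x :: 'a assume "x \<in> space sphere_measure"
        then have x: "x \<in> sphere 0 1" by simp
        have iF: "integrable sphere_measure (\<lambda>y. F i (x, y) * \<rho> y)"
          by (intro integrable_sphere_continuous continuous_on_mult \<rho>)
             (rule continuous_on_fix_fst[OF C_infinity_continuous[OF F] UNIV_I])
        have iW: "integrable sphere_measure (\<lambda>y. W (x, y) * \<rho> y)"
          by (intro integrable_sphere_continuous continuous_on_mult \<rho>) (rule continuous_on_fix_fst[OF Wc x])
        have "f i x - b x = (\<integral>y. \<rho> y *\<^sub>R (F i (x, y) - W (x, y)) \<partial>sphere_measure)"
          unfolding f_def b_def
          by (subst Bochner_Integration.integral_diff[OF iF iW, symmetric]) (simp add: algebra_simps)
        then show "(f i x - b x)\<^sup>2 = (norm (\<integral>y. \<rho> y *\<^sub>R (F i (x, y) - W (x, y)) \<partial>sphere_measure))\<^sup>2" by simp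
      qed
      also have "\<dots> \<le> sphere_area TYPE('a) * R\<^sup>2 * (\<integral>p. (norm (F i p - W p))\<^sup>2 \<partial>?M)"
        by (rule sphere_convolution_bound(4)[OF borel_measurable_sphere_pair_continuous[OF c] _ \<rho> R])
           (intro integrable_sphere_pair_continuous continuous_on_power continuous_on_norm c)
      finally show ?thesis by simp
    qed
    have "(\<lambda>i. sphere_area TYPE('a) * R\<^sup>2 * (\<integral>p. (F i p - W p)\<^sup>2 \<partial>?M)) \<longlonglongrightarrow> sphere_area TYPE('a) * R\<^sup>2 * 0"
      by (intro tendsto_intros Flim)
    then show "(\<lambda>i. \<integral>x. (f i x - b x)\<^sup>2 \<partial>sphere_measure) \<longlonglongrightarrow> 0"
      by (intro tendsto_0_dominated[OF _ le]) simp_all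
    have le: "(\<integral>x. (norm (tangent_proj x (g i x) - grad_conv DW \<rho> x))\<^sup>2 \<partial>sphere_measure)
        \<le> sphere_area TYPE('a) * R\<^sup>2 * (\<integral>p. (norm (?P p (G i p) - DW p))\<^sup>2 \<partial>?M)" for i
    proof -
      have cP: "continuous_on (sphere 0 1 \<times> sphere 0 1) (\<lambda>p. ?P p (G i p))"
        unfolding case_prod_unfold
        by (intro continuous_on_Pair continuous_on_tangent_proj continuous_on_fst continuous_on_snd continuous_on_id Gc)
      have mH: "(\<lambda>p. ?P p (G i p) - DW p) \<in> borel_measurable ?M"
        by (intro borel_measurable_diff borel_measurable_sphere_pair_continuous[OF cP] m)
      have iH: "integrable ?M (\<lambda>p. (norm (?P p (G i p) - DW p))\<^sup>2)"
        by (intro integrable_norm_square_diff borel_measurable_sphere_pair_continuous[OF cP] m i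
            integrable_sphere_pair_continuous continuous_on_power continuous_on_norm cP)
      define H where "H p = fst (?P p (G i p) - DW p)" for p
      have mH': "H \<in> borel_measurable ?M"
        unfolding H_def
        using mH by (rule measurable_compose[OF _ borel_measurable_continuous_onI[OF continuous_on_fst[OF continuous_on_id]]])
      have Hle: "(norm (H p))\<^sup>2 \<le> (norm (?P p (G i p) - DW p))\<^sup>2" for p
        unfolding H_def by (intro power_mono norm_fst_le') auto
      have iH': "integrable ?M (\<lambda>p. (norm (H p))\<^sup>2)"
        by (rule Bochner_Integration.integrable_bound[OF iH]) (use mH' Hle in auto)
      have "AE x in sphere_measure. (norm (tangent_proj x (g i x) - grad_conv DW \<rho> x))\<^sup>2
          = (norm (\<integral>y. \<rho> y *\<^sub>R H (x, y) \<partial>sphere_measure))\<^sup>2"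
        using v(2)
      proof eventually_elim
        case (elim x)
        have "continuous_on (sphere 0 1) (\<lambda>y. G i (x, y))"
          by (rule continuous_on_fix_fst[OF Gc UNIV_I])
        then have iG: "integrable sphere_measure (\<lambda>y. \<rho> y *\<^sub>R fst (G i (x, y)))"
          by (intro integrable_sphere_continuous continuous_on_scaleR \<rho> continuous_on_fst)
        have "tangent_proj x (g i x) = (\<integral>y. tangent_proj x (\<rho> y *\<^sub>R fst (G i (x, y))) \<partial>sphere_measure)"
          unfolding g_def by (rule integral_bounded_linear[OF bounded_linear_tangent_proj iG, symmetric])
        also have "\<dots> - grad_conv DW \<rho> x = (\<integral>y. tangent_proj x (\<rho> y *\<^sub>R fst (G i (x, y))) - \<rho> y *\<^sub>R fst (DW (x, y)) \<partial>sphere_measure)"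
          unfolding grad_conv_def
          by (rule Bochner_Integration.integral_diff[symmetric, OF integrable_bounded_linear[OF bounded_linear_tangent_proj iG] elim])
        also have "(\<lambda>y. tangent_proj x (\<rho> y *\<^sub>R fst (G i (x, y))) - \<rho> y *\<^sub>R fst (DW (x, y))) = (\<lambda>y. \<rho> y *\<^sub>R H (x, y))"
          by (simp add: H_def linear_cmul[OF linear_tangent_proj] scaleR_diff_right case_prod_unfold)
        finally show ?case by simp
      qed
      then have "(\<integral>x. (norm (tangent_proj x (g i x) - grad_conv DW \<rho> x))\<^sup>2 \<partial>sphere_measure)
          = (\<integral>x. (norm (\<integral>y. \<rho> y *\<^sub>R H (x, y) \<partial>sphere_measure))\<^sup>2 \<partial>sphere_measure)"
      proof (rule integral_cong_AE[rotated 2])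
        have "(\<lambda>x. tangent_proj x (g i x)) \<in> borel_measurable sphere_measure"
          by (rule smooth_sphere_regular(3)[OF fsm fg])
        then have "(\<lambda>x. tangent_proj x (g i x) - grad_conv DW \<rho> x) \<in> borel_measurable sphere_measure"
          using v(1) by (intro borel_measurable_diff) (simp_all add: grad_conv_def[abs_def])
        then show "(\<lambda>x. (norm (tangent_proj x (g i x) - grad_conv DW \<rho> x))\<^sup>2) \<in> borel_measurable sphere_measure"
          by measurable
        show "(\<lambda>x. (norm (\<integral>y. \<rho> y *\<^sub>R H (x, y) \<partial>sphere_measure))\<^sup>2) \<in> borel_measurable sphere_measure"
          using sphere_convolution_bound(1)[OF mH' iH' \<rho> R] by measurable
      qed
      also have "\<dots> \<le> sphere_area TYPE('a) * R\<^sup>2 * (\<integral>p. (norm (H p))\<^sup>2 \<partial>?M)"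
        by (rule sphere_convolution_bound(4)[OF mH' iH' \<rho> R])
      also have "\<dots> \<le> sphere_area TYPE('a) * R\<^sup>2 * (\<integral>p. (norm (?P p (G i p) - DW p))\<^sup>2 \<partial>?M)"
        by (intro mult_left_mono[OF _ C] integral_mono[OF iH' iH] Hle)
      finally show ?thesis .
    qed
    have "(\<lambda>i. sphere_area TYPE('a) * R\<^sup>2 * (\<integral>p. (norm (?P p (G i p) - DW p))\<^sup>2 \<partial>?M)) \<longlonglongrightarrow> sphere_area TYPE('a) * R\<^sup>2 * 0"
      by (intro tendsto_intros Glim)
    then show "(\<lambda>i. \<integral>x. (norm (tangent_proj x (g i x) - grad_conv DW \<rho> x))\<^sup>2 \<partial>sphere_measure) \<longlonglongrightarrow> 0"
      by (intro tendsto_0_dominated[OF _ le]) simp_all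
  qed
qed

section \<open>The chain rule and Gibbs densities\<close>

lemma has_sphere_gradient_cong:
  assumes u: "has_sphere_gradient u v" and eq: "\<And>x. x \<in> sphere 0 1 \<Longrightarrow> u x = u' x"
  shows "has_sphere_gradient u' v"
proof -
  obtain F G where *: "u \<in> borel_measurable sphere_measure" "integrable sphere_measure (\<lambda>x. (u x)\<^sup>2)"
    "v \<in> borel_measurable sphere_measure" "integrable sphere_measure (\<lambda>x. (norm (v x))\<^sup>2)"
    "\<And>i. C_infinity (F i)" "\<And>i x. GDERIV (F i) x :> G i x"
    "(\<lambda>i::nat. \<integral>x. (F i x - u x)\<^sup>2 \<partial>sphere_measure) \<longlonglongrightarrow> 0"
    "(\<lambda>i. \<integral>x. (norm (tangent_proj x (G i x) - v x))\<^sup>2 \<partial>sphere_measure) \<longlonglongrightarrow> 0"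
    using u unfolding has_sphere_gradient_def has_weak_gradient_def by blast
  show ?thesis
  proof (rule has_sphere_gradientI[OF _ _ *(3,4,5,6) _ *(8)])
    show "u' \<in> borel_measurable sphere_measure"
      using *(1) by (rule measurable_cong[THEN iffD1, rotated]) (simp add: eq)
    show "integrable sphere_measure (\<lambda>x. (u' x)\<^sup>2)"
      using *(2) by (rule Bochner_Integration.integrable_cong[THEN iffD1, rotated -1]) (simp_all add: eq)
    have "(\<integral>x. (F i x - u' x)\<^sup>2 \<partial>sphere_measure) = (\<integral>x. (F i x - u x)\<^sup>2 \<partial>sphere_measure)" for i
      by (rule Bochner_Integration.integral_cong) (simp_all add: eq)
    then show "(\<lambda>i. \<integral>x. (F i x - u' x)\<^sup>2 \<partial>sphere_measure) \<longlonglongrightarrow> 0" using *(7) by simp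
  qed
qed

text \<open>
  The compositions with the smooth approximations of \<open>b\<close> approximate the composition with \<open>b\<close>. For the gradients
  this needs \<open>\<Theta>' (F n)\<close> to converge almost everywhere, which holds along a subsequence; the bound on \<open>\<Theta>'\<close> then
  allows dominated convergence.
\<close>
lemma has_sphere_gradient_compose:
  fixes \<Theta> \<Theta>' :: "real \<Rightarrow> real" and b :: "'a::euclidean_space \<Rightarrow> real"
  assumes bv: "has_sphere_gradient b v"
    and \<Theta>: "\<And>\<tau>. (\<Theta> has_real_derivative \<Theta>' \<tau>) (at \<tau>)" and \<Theta>'c: "continuous_on UNIV \<Theta>'"
    and bound: "\<And>\<tau>. \<bar>\<Theta> \<tau>\<bar> \<le> M" and bound': "\<And>\<tau>. \<bar>\<Theta>' \<tau>\<bar> \<le> M"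
    and smooth: "\<And>f. C_infinity f \<Longrightarrow> C_infinity (\<lambda>x::'a. \<Theta> (f x))"
  shows "has_sphere_gradient (\<lambda>x. \<Theta> (b x)) (\<lambda>x. \<Theta>' (b x) *\<^sub>R v x)"
proof -
  obtain F G where b: "b \<in> borel_measurable sphere_measure" "integrable sphere_measure (\<lambda>x. (b x)\<^sup>2)"
    and v: "v \<in> borel_measurable sphere_measure" "integrable sphere_measure (\<lambda>x. (norm (v x))\<^sup>2)"
    and F: "\<And>i. C_infinity (F i)" and G: "\<And>i x. GDERIV (F i) x :> G i x"
    and Flim: "(\<lambda>i::nat. \<integral>x. (F i x - b x)\<^sup>2 \<partial>sphere_measure) \<longlonglongrightarrow> 0"
    and Glim: "(\<lambda>i. \<integral>x. (norm (tangent_proj x (G i x) - v x))\<^sup>2 \<partial>sphere_measure) \<longlonglongrightarrow> 0"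
    using bv unfolding has_sphere_gradient_def has_weak_gradient_def by blast
  note reg = smooth_sphere_regular[OF F G]
  have M: "M \<ge> 0" using bound[of 0] by linarith
  have \<Theta>c: "continuous_on UNIV \<Theta>"
    by (rule DERIV_continuous_on) (rule \<Theta>[THEN has_field_derivative_at_within])
  have m\<Theta>: "\<Theta> \<in> borel_measurable borel" "\<Theta>' \<in> borel_measurable borel"
    using \<Theta>c \<Theta>'c by (auto intro: borel_measurable_continuous_onI)
  note m1 = measurable_compose[OF _ m\<Theta>(1)] and m2 = measurable_compose[OF _ m\<Theta>(2)]
  have iFb: "integrable sphere_measure (\<lambda>x. (F i x - b x)\<^sup>2)" for i
    using integrable_norm_square_diff[OF reg(1)[of i] b(1)] reg(2)[of i] b(2) by simp
  have "\<exists>r::nat\<Rightarrow>nat. strict_mono r \<and> (AE x in sphere_measure. (\<lambda>n. (F (r n) x - b x)\<^sup>2) \<longlonglongrightarrow> 0)"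
    by (rule tendsto_L1_AE_subseq) (use iFb Flim in simp_all)
  then obtain r :: "nat \<Rightarrow> nat" where r: "strict_mono r"
    and ae2: "AE x in sphere_measure. (\<lambda>n. (F (r n) x - b x)\<^sup>2) \<longlonglongrightarrow> 0" by blast
  have ae: "AE x in sphere_measure. (\<lambda>n. F (r n) x) \<longlonglongrightarrow> b x"
    using ae2
  proof eventually_elim
    case (elim x)
    from tendsto_real_sqrt[OF elim] have "(\<lambda>n. F (r n) x - b x) \<longlonglongrightarrow> 0"
      by (simp add: tendsto_rabs_zero_iff)
    then show ?case by (rule LIM_zero_cancel)
  qed
  have lip: "\<bar>\<Theta> s - \<Theta> t\<bar> \<le> M * \<bar>s - t\<bar>" for s t
  proof -
    have "norm (\<Theta> s - \<Theta> t) \<le> M * norm (s - t)"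
      by (rule field_differentiable_bound[of UNIV]) (use \<Theta> bound' in \<open>auto intro: has_field_derivative_at_within\<close>)
    then show ?thesis by simp
  qed
  show ?thesis
  proof (rule has_sphere_gradientI[where F="\<lambda>n x. \<Theta> (F (r n) x)" and G="\<lambda>n x. \<Theta>' (F (r n) x) *\<^sub>R G (r n) x"])
    show "(\<lambda>x. \<Theta> (b x)) \<in> borel_measurable sphere_measure" by (rule m1[OF b(1)])
    show "integrable sphere_measure (\<lambda>x. (\<Theta> (b x))\<^sup>2)"
    proof (rule integrable_sphere_bounded)
      show "(\<lambda>x. (\<Theta> (b x))\<^sup>2) \<in> borel_measurable sphere_measure"
        by (intro borel_measurable_power m1[OF b(1)])
      show "norm ((\<Theta> (b x))\<^sup>2) \<le> M\<^sup>2" for x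
        using power_mono[OF bound[of "b x"], of 2] by simp
    qed
    show mv: "(\<lambda>x. \<Theta>' (b x) *\<^sub>R v x) \<in> borel_measurable sphere_measure"
      by (intro borel_measurable_scaleR m2 b(1) v(1))
    have sc: "(norm (c *\<^sub>R w))\<^sup>2 \<le> K\<^sup>2 * (norm w)\<^sup>2" if "\<bar>c\<bar> \<le> K" for c K and w :: 'a
      using power_mono[OF that, of 2] by (simp add: power_mult_distrib mult_right_mono)
    show "integrable sphere_measure (\<lambda>x. (norm (\<Theta>' (b x) *\<^sub>R v x))\<^sup>2)"
    proof (rule Bochner_Integration.integrable_bound[where f="\<lambda>x. M\<^sup>2 * (norm (v x))\<^sup>2"])
      show "integrable sphere_measure (\<lambda>x. M\<^sup>2 * (norm (v x))\<^sup>2)" using v(2) by simp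
      show "AE x in sphere_measure. norm ((norm (\<Theta>' (b x) *\<^sub>R v x))\<^sup>2) \<le> norm (M\<^sup>2 * (norm (v x))\<^sup>2)"
        using sc[OF bound'] by (intro AE_I2) (simp add: abs_mult)
    qed (use mv in measurable)
    show "C_infinity (\<lambda>x. \<Theta> (F (r n) x))" for n by (rule smooth[OF F])
    show "GDERIV (\<lambda>x. \<Theta> (F (r n) x)) x :> \<Theta>' (F (r n) x) *\<^sub>R G (r n) x" for n x
      by (rule GDERIV_DERIV_compose[OF G \<Theta>])
    have le: "(\<integral>x. (\<Theta> (F (r n) x) - \<Theta> (b x))\<^sup>2 \<partial>sphere_measure) \<le> M\<^sup>2 * (\<integral>x. (F (r n) x - b x)\<^sup>2 \<partial>sphere_measure)" for n
    proof -
      have pw: "(\<Theta> (F (r n) x) - \<Theta> (b x))\<^sup>2 \<le> M\<^sup>2 * (F (r n) x - b x)\<^sup>2" for x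
        using power_mono[OF lip[of "F (r n) x" "b x"], of 2] by (simp add: power_mult_distrib)
      have i: "integrable sphere_measure (\<lambda>x. M\<^sup>2 * (F (r n) x - b x)\<^sup>2)" using iFb by simp
      have "integrable sphere_measure (\<lambda>x. (\<Theta> (F (r n) x) - \<Theta> (b x))\<^sup>2)"
        by (rule Bochner_Integration.integrable_bound[OF i])
           (use pw in \<open>auto intro!: borel_measurable_power borel_measurable_diff m1 b(1) reg(1) simp: abs_mult\<close>)
      then have "(\<integral>x. (\<Theta> (F (r n) x) - \<Theta> (b x))\<^sup>2 \<partial>sphere_measure) \<le> (\<integral>x. M\<^sup>2 * (F (r n) x - b x)\<^sup>2 \<partial>sphere_measure)"
        by (rule integral_mono[OF _ i pw])
      then show ?thesis by simp
    qed
    have "(\<lambda>n. M\<^sup>2 * (\<integral>x. (F (r n) x - b x)\<^sup>2 \<partial>sphere_measure)) \<longlonglongrightarrow> M\<^sup>2 * 0"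
      using LIMSEQ_subseq_LIMSEQ[OF Flim r] by (intro tendsto_intros) (simp add: comp_def)
    then show "(\<lambda>n. \<integral>x. (\<Theta> (F (r n) x) - \<Theta> (b x))\<^sup>2 \<partial>sphere_measure) \<longlonglongrightarrow> 0"
      by (intro tendsto_0_dominated[OF _ le]) simp_all
    define E where "E n x = tangent_proj x (G (r n) x) - v x" for n x
    have mE: "E n \<in> borel_measurable sphere_measure" for n
      unfolding E_def by (intro borel_measurable_diff reg(3) v(1))
    have iE: "integrable sphere_measure (\<lambda>x. (norm (E n x))\<^sup>2)" for n
      unfolding E_def by (intro integrable_norm_square_diff reg(3,4) v)
    define A where "A n x = \<Theta>' (F (r n) x) *\<^sub>R E n x" for n x
    define Q where "Q n x = (\<Theta>' (F (r n) x) - \<Theta>' (b x)) *\<^sub>R v x" for n x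
    have mA: "A n \<in> borel_measurable sphere_measure" for n
      unfolding A_def by (intro borel_measurable_scaleR m2 reg(1) mE)
    have mQ: "Q n \<in> borel_measurable sphere_measure" for n
      unfolding Q_def by (intro borel_measurable_scaleR borel_measurable_diff m2 reg(1) b(1) v(1))
    have iA': "integrable sphere_measure (\<lambda>x. M\<^sup>2 * (norm (E n x))\<^sup>2)" for n using iE by simp
    have iA: "integrable sphere_measure (\<lambda>x. (norm (A n x))\<^sup>2)" for n
    proof (rule Bochner_Integration.integrable_bound[OF iA'])
      show "(\<lambda>x. (norm (A n x))\<^sup>2) \<in> borel_measurable sphere_measure" using mA by measurable
      show "AE x in sphere_measure. norm ((norm (A n x))\<^sup>2) \<le> norm (M\<^sup>2 * (norm (E n x))\<^sup>2)"
        using sc[OF bound'] by (intro AE_I2) (simp add: A_def abs_mult del: norm_scaleR)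
    qed
    have Qle: "(norm (Q n x))\<^sup>2 \<le> (2 * M)\<^sup>2 * (norm (v x))\<^sup>2" for n x
    proof -
      have "\<bar>\<Theta>' (F (r n) x) - \<Theta>' (b x)\<bar> \<le> 2 * M" using bound'[of "F (r n) x"] bound'[of "b x"] by linarith
      from sc[OF this] show ?thesis by (simp only: Q_def)
    qed
    have iQ': "integrable sphere_measure (\<lambda>x. (2 * M)\<^sup>2 * (norm (v x))\<^sup>2)" using v(2) by simp
    have iQ: "integrable sphere_measure (\<lambda>x. (norm (Q n x))\<^sup>2)" for n
      by (rule Bochner_Integration.integrable_bound[OF iQ']) (use mQ Qle in \<open>auto simp: abs_mult\<close>)
    have Qlim: "(\<lambda>n. \<integral>x. (norm (Q n x))\<^sup>2 \<partial>sphere_measure) \<longlonglongrightarrow> (\<integral>x. 0 \<partial>(sphere_measure :: 'a measure))"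
    proof (rule integral_dominated_convergence[where w="\<lambda>x. (2 * M)\<^sup>2 * (norm (v x))\<^sup>2"])
      show "AE x in sphere_measure. (\<lambda>n. (norm (Q n x))\<^sup>2) \<longlonglongrightarrow> 0"
        using ae
      proof eventually_elim
        case (elim x)
        have "(\<lambda>n. \<Theta>' (F (r n) x)) \<longlonglongrightarrow> \<Theta>' (b x)"
          using continuous_on_tendsto_compose[OF \<Theta>'c elim] by simp
        then have "(\<lambda>n. (norm ((\<Theta>' (F (r n) x) - \<Theta>' (b x)) *\<^sub>R v x))\<^sup>2) \<longlonglongrightarrow> (norm ((\<Theta>' (b x) - \<Theta>' (b x)) *\<^sub>R v x))\<^sup>2"
          by (intro tendsto_intros)
        then show ?case by (simp add: Q_def)
      qed
      show "(\<lambda>x. (norm (Q n x))\<^sup>2) \<in> borel_measurable sphere_measure" for n using mQ by measurable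
      show "AE x in sphere_measure. norm ((norm (Q n x))\<^sup>2) \<le> (2 * M)\<^sup>2 * (norm (v x))\<^sup>2" for n
        using Qle by (intro AE_I2) simp
    qed (use iQ' in simp_all)
    have split: "tangent_proj x (\<Theta>' (F (r n) x) *\<^sub>R G (r n) x) - \<Theta>' (b x) *\<^sub>R v x = A n x + Q n x" for n x
      by (simp add: A_def Q_def E_def linear_cmul[OF linear_tangent_proj] algebra_simps)
    have le: "(\<integral>x. (norm (tangent_proj x (\<Theta>' (F (r n) x) *\<^sub>R G (r n) x) - \<Theta>' (b x) *\<^sub>R v x))\<^sup>2 \<partial>sphere_measure)
      \<le> 2 * (M\<^sup>2 * (\<integral>x. (norm (E n x))\<^sup>2 \<partial>sphere_measure)) + 2 * (\<integral>x. (norm (Q n x))\<^sup>2 \<partial>sphere_measure)" for n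
    proof -
      have "(\<integral>x. (norm (A n x + Q n x))\<^sup>2 \<partial>sphere_measure)
        \<le> 2 * (\<integral>x. (norm (A n x))\<^sup>2 \<partial>sphere_measure) + 2 * (\<integral>x. (norm (Q n x))\<^sup>2 \<partial>sphere_measure)"
        by (rule integrable_norm_square_add(2)[OF mA mQ iA iQ])
      moreover have "(\<integral>x. (norm (A n x))\<^sup>2 \<partial>sphere_measure) \<le> (\<integral>x. M\<^sup>2 * (norm (E n x))\<^sup>2 \<partial>sphere_measure)"
        by (rule integral_mono[OF iA iA']) (unfold A_def, rule sc[OF bound'])
      ultimately show ?thesis unfolding split by simp
    qed
    have "(\<lambda>n. 2 * (M\<^sup>2 * (\<integral>x. (norm (E n x))\<^sup>2 \<partial>sphere_measure)) + 2 * (\<integral>x. (norm (Q n x))\<^sup>2 \<partial>sphere_measure))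
       \<longlonglongrightarrow> 2 * (M\<^sup>2 * 0) + 2 * (\<integral>x. 0 \<partial>(sphere_measure :: 'a measure))"
      unfolding E_def using LIMSEQ_subseq_LIMSEQ[OF Glim r] by (intro tendsto_intros Qlim) (simp add: comp_def)
    then show "(\<lambda>n. \<integral>x. (norm (tangent_proj x (\<Theta>' (F (r n) x) *\<^sub>R G (r n) x) - \<Theta>' (b x) *\<^sub>R v x))\<^sup>2 \<partial>sphere_measure) \<longlonglongrightarrow> 0"
      by (intro tendsto_0_dominated[OF _ le]) simp_all
  qed
qed

lemma scaled_sin_tendsto: "(\<lambda>j. real (Suc j) * sin (\<tau> / real (Suc j))) \<longlonglongrightarrow> \<tau>"
proof (cases "\<tau> = 0")
  case False
  have lim: "(\<lambda>j. \<tau> / real (Suc j)) \<longlonglongrightarrow> 0"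
    using tendsto_mult_right_zero[OF LIMSEQ_inverse_real_of_nat, of \<tau>] by (simp add: divide_inverse)
  have "((\<lambda>h. sin h / h) \<longlongrightarrow> 1) (at (0::real))"
    using DERIV_sin[of "0::real"] by (simp add: DERIV_def)
  moreover have "filterlim (\<lambda>j. \<tau> / real (Suc j)) (at 0) sequentially"
    using lim False by (auto simp: filterlim_at)
  ultimately have "(\<lambda>j. sin (\<tau> / real (Suc j)) / (\<tau> / real (Suc j))) \<longlonglongrightarrow> 1"
    by (rule filterlim_compose)
  from tendsto_mult_left[OF this, of \<tau>] show ?thesis using False by (simp add: mult.commute)
qed simp

text \<open>
  The exponential is unbounded, and the smooth approximations of \<open>b\<close> need not be bounded uniformly, so the chain rule
  for bounded functions does not apply directly. It applies to \<open>c * exp (a L sin (\<tau> / L))\<close>, which is bounded together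
  with its derivative and tends to \<open>c * exp (a \<tau>)\<close> as \<open>L\<close> grows, boundedly on the range of \<open>b\<close>.
\<close>
lemma has_sphere_gradient_exp:
  assumes bv: "has_sphere_gradient b v" and B: "\<forall>x\<in>sphere 0 1. \<bar>b x\<bar> \<le> B"
  shows "has_sphere_gradient (\<lambda>x. c * exp (a * b x)) (\<lambda>x. (c * exp (a * b x) * a) *\<^sub>R v x)"
proof -
  have b: "b \<in> borel_measurable sphere_measure"
    and v: "v \<in> borel_measurable sphere_measure" "integrable sphere_measure (\<lambda>x. (norm (v x))\<^sup>2)"
    using bv unfolding has_sphere_gradient_def has_weak_gradient_def by blast+
  define L where "L j = real (Suc j)" for j
  have L: "L j > 0" for j by (simp add: L_def)
  define \<Theta> where "\<Theta> j \<tau> = c * exp (a * (L j * sin (\<tau> * (1 / L j))))" for j \<tau>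
  define \<Theta>' where "\<Theta>' j \<tau> = \<Theta> j \<tau> * (a * cos (\<tau> * (1 / L j)))" for j \<tau>
  have der: "(\<Theta> j has_real_derivative \<Theta>' j \<tau>) (at \<tau>)" for j \<tau>
    unfolding \<Theta>_def[abs_def] \<Theta>'_def using L[of j]
    by (auto intro!: derivative_eq_intros simp: \<Theta>_def)
  have cont: "continuous_on UNIV (\<Theta> j)" "continuous_on UNIV (\<Theta>' j)" for j
    unfolding \<Theta>_def[abs_def] \<Theta>'_def[abs_def] by (intro continuous_intros)+
  have small: "\<bar>\<Theta> j \<tau>\<bar> \<le> \<bar>c\<bar> * exp (\<bar>a\<bar> * K)" if "\<bar>L j * sin (\<tau> * (1 / L j))\<bar> \<le> K" for j \<tau> K
  proof -
    have "a * (L j * sin (\<tau> * (1 / L j))) \<le> \<bar>a\<bar> * K"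
      using mult_left_mono[OF that abs_ge_zero[of a]] abs_ge_self[of "a * (L j * sin (\<tau> * (1 / L j)))"]
      by (simp add: abs_mult)
    then show ?thesis by (simp add: \<Theta>_def abs_mult mult_left_mono)
  qed
  have small': "\<bar>\<Theta>' j \<tau>\<bar> \<le> \<bar>\<Theta> j \<tau>\<bar> * \<bar>a\<bar>" for j \<tau>
    unfolding \<Theta>'_def abs_mult using mult_left_mono[OF abs_cos_le_one, of "\<bar>a\<bar>" "\<tau> * (1 / L j)"]
    by (simp add: mult_left_mono)
  have step: "has_sphere_gradient (\<lambda>x. \<Theta> j (b x)) (\<lambda>x. \<Theta>' j (b x) *\<^sub>R v x)" for j
  proof -
    define M where "M = \<bar>c\<bar> * exp (\<bar>a\<bar> * L j) * (1 + \<bar>a\<bar>)"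
    have K: "\<bar>\<Theta> j \<tau>\<bar> \<le> \<bar>c\<bar> * exp (\<bar>a\<bar> * L j)" for \<tau>
      using L[of j] by (intro small) (simp add: abs_mult)
    have M: "\<bar>c\<bar> * exp (\<bar>a\<bar> * L j) \<le> M" "\<bar>c\<bar> * exp (\<bar>a\<bar> * L j) * \<bar>a\<bar> \<le> M"
      by (simp_all add: M_def distrib_left)
    show ?thesis
    proof (rule has_sphere_gradient_compose[OF bv der cont(2), of j M])
      show "\<bar>\<Theta> j \<tau>\<bar> \<le> M" for \<tau> using K[of \<tau>] M(1) by linarith
      show "\<bar>\<Theta>' j \<tau>\<bar> \<le> M" for \<tau>
        using small'[of j \<tau>] mult_right_mono[OF K[of \<tau>] abs_ge_zero[of a]] M(2) by linarith
      show "C_infinity (\<lambda>x. \<Theta> j (f x))" if "C_infinity f" for f :: "'a \<Rightarrow> real"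
        unfolding C_infinity_def \<Theta>_def
      proof
        fix k
        have "C_k k f" using that by (simp add: C_infinity_def)
        from C_k_sin_cos[OF C_k_mult[OF this C_k_const], THEN conjunct1]
        show "C_k k (\<lambda>x. c * exp (a * (L j * sin (f x * (1 / L j)))))"
          by (intro C_k_mult[OF C_k_const] C_k_exp)
      qed
    qed
  qed
  define U where "U x = c * exp (a * b x)" for x
  have mU: "U \<in> borel_measurable sphere_measure"
    unfolding U_def using b by measurable
  have Ub: "\<bar>U x\<bar> \<le> \<bar>c\<bar> * exp (\<bar>a\<bar> * B)" if "x \<in> sphere 0 1" for x
  proof -
    have "a * b x \<le> \<bar>a\<bar> * B"
      using mult_left_mono[OF B[rule_format, OF that] abs_ge_zero[of a]] abs_ge_self[of "a * b x"] by (simp add: abs_mult)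
    then show ?thesis by (simp add: U_def abs_mult mult_left_mono)
  qed
  define K where "K = \<bar>c\<bar> * exp (\<bar>a\<bar> * B)"
  have \<Theta>b: "\<bar>\<Theta> j (b x)\<bar> \<le> K" if "x \<in> sphere 0 1" for j x
  proof -
    have "\<bar>L j * sin (b x * (1 / L j))\<bar> \<le> L j * \<bar>b x * (1 / L j)\<bar>"
      unfolding abs_mult[of "L j"] abs_of_pos[OF L]
      by (rule mult_left_mono[OF abs_sin_x_le_abs_x less_imp_le[OF L]])
    also have "\<dots> = \<bar>b x\<bar>" using L[of j] by (simp add: abs_mult)
    also have "\<dots> \<le> B" by (rule B[rule_format, OF that])
    finally show ?thesis unfolding K_def by (rule small)
  qed
  have lim: "(\<lambda>j. \<Theta> j \<tau>) \<longlonglongrightarrow> c * exp (a * \<tau>)" for \<tau>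
    unfolding \<Theta>_def L_def using scaled_sin_tendsto[of \<tau>] by (intro tendsto_intros) simp
  have lim': "(\<lambda>j. \<Theta>' j \<tau>) \<longlonglongrightarrow> c * exp (a * \<tau>) * (a * 1)" for \<tau>
  proof -
    have "(\<lambda>j. \<tau> * (1 / L j)) \<longlonglongrightarrow> 0"
      using tendsto_mult_right_zero[OF LIMSEQ_inverse_real_of_nat, of \<tau>] by (simp add: divide_inverse L_def)
    from tendsto_cos[OF this] have "(\<lambda>j. cos (\<tau> * (1 / L j))) \<longlonglongrightarrow> 1" by simp
    then show ?thesis unfolding \<Theta>'_def by (intro tendsto_intros lim)
  qed
  have "has_sphere_gradient U (\<lambda>x. (U x * a) *\<^sub>R v x)"
  proof (rule has_sphere_gradient_closed[OF step mU])
    show "integrable sphere_measure (\<lambda>x. (U x)\<^sup>2)"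
    proof (rule integrable_sphere_bounded)
      show "(\<lambda>x. (U x)\<^sup>2) \<in> borel_measurable sphere_measure" by (intro borel_measurable_power mU)
      show "norm ((U x)\<^sup>2) \<le> K\<^sup>2" if "x \<in> sphere 0 1" for x
        using power_mono[OF Ub[OF that], of 2] by (simp add: K_def)
    qed
    show mUv: "(\<lambda>x. (U x * a) *\<^sub>R v x) \<in> borel_measurable sphere_measure"
      by (intro borel_measurable_scaleR borel_measurable_times mU v(1) borel_measurable_const)
    have sc: "(norm (s *\<^sub>R w))\<^sup>2 \<le> m\<^sup>2 * (norm w)\<^sup>2" if "\<bar>s\<bar> \<le> m" for s m and w :: 'a
      using power_mono[OF that, of 2] by (simp add: power_mult_distrib mult_right_mono)
    have Uab: "\<bar>U x * a\<bar> \<le> K * \<bar>a\<bar>" if "x \<in> sphere 0 1" for x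
      using Ub[OF that] by (simp add: abs_mult K_def mult_right_mono)
    show "integrable sphere_measure (\<lambda>x. (norm ((U x * a) *\<^sub>R v x))\<^sup>2)"
    proof (rule Bochner_Integration.integrable_bound[where f="\<lambda>x. (K * \<bar>a\<bar>)\<^sup>2 * (norm (v x))\<^sup>2"])
      show "integrable sphere_measure (\<lambda>x. (K * \<bar>a\<bar>)\<^sup>2 * (norm (v x))\<^sup>2)" using v(2) by simp
      show "AE x in sphere_measure. norm ((norm ((U x * a) *\<^sub>R v x))\<^sup>2) \<le> norm ((K * \<bar>a\<bar>)\<^sup>2 * (norm (v x))\<^sup>2)"
        using sc[OF Uab] by (intro AE_I2) (simp add: abs_mult del: norm_scaleR)
    qed (use mUv in measurable)
    have m\<Theta>: "(\<lambda>x. \<Theta> j (b x)) \<in> borel_measurable sphere_measure" "(\<lambda>x. \<Theta>' j (b x)) \<in> borel_measurable sphere_measure" for j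
      using measurable_compose[OF b borel_measurable_continuous_onI[OF cont(1)]]
        measurable_compose[OF b borel_measurable_continuous_onI[OF cont(2)]] by auto
    have "(\<lambda>j. \<integral>x. (\<Theta> j (b x) - U x)\<^sup>2 \<partial>sphere_measure) \<longlonglongrightarrow> (\<integral>x. 0 \<partial>(sphere_measure :: 'a measure))"
    proof (rule integral_dominated_convergence[where w="\<lambda>_. (2 * K)\<^sup>2"])
      show "AE x in sphere_measure. (\<lambda>j. (\<Theta> j (b x) - U x)\<^sup>2) \<longlonglongrightarrow> 0"
      proof (intro AE_I2)
        fix x
        have "(\<lambda>j. (\<Theta> j (b x) - U x)\<^sup>2) \<longlonglongrightarrow> (U x - U x)\<^sup>2"
          using lim[of "b x"] by (intro tendsto_intros) (simp add: U_def)
        then show "(\<lambda>j. (\<Theta> j (b x) - U x)\<^sup>2) \<longlonglongrightarrow> 0" by simp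
      qed
      show "AE x in sphere_measure. norm ((\<Theta> j (b x) - U x)\<^sup>2) \<le> (2 * K)\<^sup>2" for j
      proof (intro AE_I2)
        fix x :: 'a assume "x \<in> space sphere_measure"
        then have "\<bar>\<Theta> j (b x) - U x\<bar> \<le> 2 * K" using \<Theta>b[of x j] Ub[of x] by (simp add: K_def)
        from power_mono[OF this, of 2] show "norm ((\<Theta> j (b x) - U x)\<^sup>2) \<le> (2 * K)\<^sup>2" by simp
      qed
      show "(\<lambda>x. (\<Theta> j (b x) - U x)\<^sup>2) \<in> borel_measurable sphere_measure" for j
        by (intro borel_measurable_power borel_measurable_diff m\<Theta> mU)
    qed simp_all
    then show "(\<lambda>j. \<integral>x. (\<Theta> j (b x) - U x)\<^sup>2 \<partial>sphere_measure) \<longlonglongrightarrow> 0" by simp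
    have "(\<lambda>j. \<integral>x. (norm (\<Theta>' j (b x) *\<^sub>R v x - (U x * a) *\<^sub>R v x))\<^sup>2 \<partial>sphere_measure) \<longlonglongrightarrow> (\<integral>x. 0 \<partial>(sphere_measure :: 'a measure))"
    proof (rule integral_dominated_convergence[where w="\<lambda>x. (2 * (K * \<bar>a\<bar>))\<^sup>2 * (norm (v x))\<^sup>2"])
      show "AE x in sphere_measure. (\<lambda>j. (norm (\<Theta>' j (b x) *\<^sub>R v x - (U x * a) *\<^sub>R v x))\<^sup>2) \<longlonglongrightarrow> 0"
      proof (intro AE_I2)
        fix x
        have "(\<lambda>j. (norm (\<Theta>' j (b x) *\<^sub>R v x - (U x * a) *\<^sub>R v x))\<^sup>2) \<longlonglongrightarrow> (norm ((U x * a) *\<^sub>R v x - (U x * a) *\<^sub>R v x))\<^sup>2"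
          using lim'[of "b x"] by (intro tendsto_intros) (simp add: U_def)
        then show "(\<lambda>j. (norm (\<Theta>' j (b x) *\<^sub>R v x - (U x * a) *\<^sub>R v x))\<^sup>2) \<longlonglongrightarrow> 0" by simp
      qed
      show "AE x in sphere_measure. norm ((norm (\<Theta>' j (b x) *\<^sub>R v x - (U x * a) *\<^sub>R v x))\<^sup>2) \<le> (2 * (K * \<bar>a\<bar>))\<^sup>2 * (norm (v x))\<^sup>2" for j
      proof (intro AE_I2)
        fix x :: 'a assume "x \<in> space sphere_measure"
        then have x: "x \<in> sphere 0 1" by simp
        have "\<bar>\<Theta>' j (b x)\<bar> \<le> K * \<bar>a\<bar>"
          using small'[of j "b x"] mult_right_mono[OF \<Theta>b[OF x, of j] abs_ge_zero[of a]] by linarith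
        then have "\<bar>\<Theta>' j (b x) - U x * a\<bar> \<le> 2 * (K * \<bar>a\<bar>)" using Uab[OF x] by linarith
        from sc[OF this, of "v x"]
        show "norm ((norm (\<Theta>' j (b x) *\<^sub>R v x - (U x * a) *\<^sub>R v x))\<^sup>2) \<le> (2 * (K * \<bar>a\<bar>))\<^sup>2 * (norm (v x))\<^sup>2"
          by (simp add: scaleR_diff_left del: norm_scaleR)
      qed
      show "(\<lambda>x. (norm (\<Theta>' j (b x) *\<^sub>R v x - (U x * a) *\<^sub>R v x))\<^sup>2) \<in> borel_measurable sphere_measure" for j
        by (intro borel_measurable_power borel_measurable_norm[THEN measurable_compose[rotated]] borel_measurable_diff borel_measurable_scaleR m\<Theta> v(1) mUv)
    qed (use v(2) in simp_all)
    then show "(\<lambda>j. \<integral>x. (norm (\<Theta>' j (b x) *\<^sub>R v x - (U x * a) *\<^sub>R v x))\<^sup>2 \<partial>sphere_measure) \<longlonglongrightarrow> 0" by simp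
  qed
  then show ?thesis by (simp add: U_def[abs_def])
qed

text \<open>
  With \<open>b = W * \<rho>\<close> the chain rule gives the weak gradient \<open>- \<gamma> \<rho> \<nabla>b\<close> of \<open>\<rho>\<close>, so the weak equation holds already
  pointwise before integration.
\<close>
lemma weak_solution_gibbs:
  fixes W :: "'a::euclidean_space \<times> 'a \<Rightarrow> real"
  assumes W: "W \<in> Cb_sphere_product \<inter> H1_sphere_product" and \<gamma>: "\<gamma> \<noteq> 0" and c: "c > 0"
    and \<rho>c: "continuous_on (sphere 0 1) \<rho>" and mass: "(\<integral>x. \<rho> x \<partial>sphere_measure) = 1"
    and gibbs: "\<And>x. x \<in> sphere 0 1 \<Longrightarrow> \<rho> x = c * exp (- \<gamma> * (\<integral>y. W (x, y) * \<rho> y \<partial>sphere_measure))"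
  shows "weak_solution W \<gamma> \<rho>"
proof -
  have Wc: "continuous_on (sphere 0 1 \<times> sphere 0 1) W" using W by (simp add: Cb_sphere_product_def)
  obtain DW where DW: "has_sphere_product_gradient W DW" using W by (auto simp: H1_sphere_product_def)
  define b where "b x = (\<integral>y. W (x, y) * \<rho> y \<partial>sphere_measure)" for x
  define v where "v = grad_conv DW \<rho>"
  have bv: "has_sphere_gradient b v"
    unfolding b_def v_def by (rule has_sphere_gradient_convolution[OF DW Wc \<rho>c])
  have "continuous_on (sphere 0 1 \<times> sphere 0 1) (\<lambda>p. W p * \<rho> (snd p))"
    by (intro continuous_on_mult Wc continuous_on_compose2[OF \<rho>c])
       (auto intro: continuous_on_snd continuous_on_id)
  then have bc: "continuous_on (sphere 0 1) b"
    unfolding b_def by (intro continuous_on_sphere_parametric_integral) (simp add: case_prod_unfold)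
  then obtain B where "\<forall>x\<in>sphere 0 1. norm (b x) \<le> B"
    by (rule continuous_on_sphere_bounded)
  then have B: "\<forall>x\<in>sphere 0 1. \<bar>b x\<bar> \<le> B" by simp
  have \<rho>b: "\<rho> x = c * exp (- \<gamma> * b x)" if "x \<in> sphere 0 1" for x using gibbs[OF that] by (simp add: b_def)
  define D\<rho> where "D\<rho> x = (c * exp (- \<gamma> * b x) * (- \<gamma>)) *\<^sub>R v x" for x
  have grad: "has_sphere_gradient \<rho> D\<rho>"
    unfolding D\<rho>_def using has_sphere_gradient_exp[OF bv B, of c "- \<gamma>"]
    by (rule has_sphere_gradient_cong) (rule \<rho>b[symmetric])
  obtain R where "\<forall>x\<in>sphere 0 1. norm (\<rho> x) \<le> R"
    by (rule continuous_on_sphere_bounded[OF \<rho>c])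
  then have R: "\<bar>\<rho> x\<bar> \<le> R" if "x \<in> sphere 0 1" for x using that by simp
  have v: "v \<in> borel_measurable sphere_measure" "integrable sphere_measure (\<lambda>x. (norm (v x))\<^sup>2)"
    using bv unfolding has_sphere_gradient_def has_weak_gradient_def by blast+
  have test: "integrable sphere_measure (\<lambda>x. (\<rho> x *\<^sub>R D\<phi> x) \<bullet> v x) \<and>
      inverse \<gamma> * (\<integral>x. D\<rho> x \<bullet> D\<phi> x \<partial>sphere_measure) + (\<integral>x. (\<rho> x *\<^sub>R D\<phi> x) \<bullet> v x \<partial>sphere_measure) = 0"
    if "has_sphere_gradient \<phi> D\<phi>" for \<phi> D\<phi>
  proof
    have p: "D\<phi> \<in> borel_measurable sphere_measure" "integrable sphere_measure (\<lambda>x. (norm (D\<phi> x))\<^sup>2)"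
      using that unfolding has_sphere_gradient_def has_weak_gradient_def by blast+
    show "integrable sphere_measure (\<lambda>x. (\<rho> x *\<^sub>R D\<phi> x) \<bullet> v x)"
    proof (rule Bochner_Integration.integrable_bound[where f="\<lambda>x. R * ((norm (D\<phi> x))\<^sup>2 + (norm (v x))\<^sup>2)"])
      show "integrable sphere_measure (\<lambda>x. R * ((norm (D\<phi> x))\<^sup>2 + (norm (v x))\<^sup>2))" using p(2) v(2) by simp
      show "(\<lambda>x. (\<rho> x *\<^sub>R D\<phi> x) \<bullet> v x) \<in> borel_measurable sphere_measure"
        by (intro borel_measurable_inner borel_measurable_scaleR borel_measurable_sphere_continuous[OF \<rho>c] p(1) v(1))
      show "AE x in sphere_measure. norm ((\<rho> x *\<^sub>R D\<phi> x) \<bullet> v x) \<le> norm (R * ((norm (D\<phi> x))\<^sup>2 + (norm (v x))\<^sup>2))"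
      proof (intro AE_I2)
        fix x :: 'a assume "x \<in> space sphere_measure"
        then have Rx: "\<bar>\<rho> x\<bar> \<le> R" using R by simp
        have "\<bar>D\<phi> x \<bullet> v x\<bar> \<le> norm (D\<phi> x) * norm (v x)" by (rule Cauchy_Schwarz_ineq2)
        also have "\<dots> \<le> (norm (D\<phi> x))\<^sup>2 + (norm (v x))\<^sup>2"
        proof -
          have "2 * (norm (D\<phi> x) * norm (v x)) \<le> (norm (D\<phi> x))\<^sup>2 + (norm (v x))\<^sup>2"
            using zero_le_power2[of "norm (D\<phi> x) - norm (v x)"] by (simp add: power2_diff)
          moreover have "0 \<le> norm (D\<phi> x) * norm (v x)" by simp
          ultimately show ?thesis by linarith
        qed
        finally have "\<bar>\<rho> x\<bar> * \<bar>D\<phi> x \<bullet> v x\<bar> \<le> R * ((norm (D\<phi> x))\<^sup>2 + (norm (v x))\<^sup>2)"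
          using Rx by (intro mult_mono) auto
        moreover have "0 \<le> R" using Rx by linarith
        ultimately show "norm ((\<rho> x *\<^sub>R D\<phi> x) \<bullet> v x) \<le> norm (R * ((norm (D\<phi> x))\<^sup>2 + (norm (v x))\<^sup>2))"
          by (simp add: abs_mult)
      qed
    qed
    have "(\<integral>x. D\<rho> x \<bullet> D\<phi> x \<partial>sphere_measure) = (\<integral>x. - \<gamma> * ((\<rho> x *\<^sub>R D\<phi> x) \<bullet> v x) \<partial>sphere_measure)"
    proof (rule Bochner_Integration.integral_cong[OF refl])
      fix x :: 'a assume "x \<in> space sphere_measure"
      then have "\<rho> x = c * exp (- \<gamma> * b x)" by (intro \<rho>b) simp
      then show "D\<rho> x \<bullet> D\<phi> x = - \<gamma> * ((\<rho> x *\<^sub>R D\<phi> x) \<bullet> v x)"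
        by (simp add: D\<rho>_def inner_commute)
    qed
    also have "\<dots> = - \<gamma> * (\<integral>x. (\<rho> x *\<^sub>R D\<phi> x) \<bullet> v x \<partial>sphere_measure)" by simp
    finally show "inverse \<gamma> * (\<integral>x. D\<rho> x \<bullet> D\<phi> x \<partial>sphere_measure) + (\<integral>x. (\<rho> x *\<^sub>R D\<phi> x) \<bullet> v x \<partial>sphere_measure) = 0"
      using \<gamma> by simp
  qed
  have "AE x in sphere_measure. 0 \<le> \<rho> x"
    using c by (intro AE_I2) (simp add: \<rho>b)
  then show ?thesis
    unfolding weak_solution_def using \<gamma> mass grad DW test unfolding v_def by blast
qed

section \<open>The branch of stationary states\<close>

lemma L2_norm_le:
  fixes u :: "'a::euclidean_space \<Rightarrow> real"
  assumes "\<And>x. x \<in> sphere 0 1 \<Longrightarrow> \<bar>u x\<bar> \<le> B" "0 \<le> B"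
  shows "L2_norm u \<le> B"
proof -
  let ?A = "sphere_area TYPE('a)"
  have A: "?A > 0" by (rule sphere_area_pos)
  have "\<bar>(\<integral>x. (u x)\<^sup>2 \<partial>sphere_measure)\<bar> \<le> B\<^sup>2 * ?A"
    by (rule abs_integral_sphere_le) (use power_mono[OF assms(1), of _ 2] in auto)
  then have "1 / ?A * (\<integral>x. (u x)\<^sup>2 \<partial>sphere_measure) \<le> B\<^sup>2"
    using A by (simp add: pos_divide_le_eq)
  then have "sqrt (1 / ?A * (\<integral>x. (u x)\<^sup>2 \<partial>sphere_measure)) \<le> sqrt (B\<^sup>2)"
    by (rule real_sqrt_le_mono)
  then show ?thesis using assms(2) by (simp add: L2_norm_def)
qed

text \<open>
  The profile is the restriction of the kernel to a half meridian.
\<close>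
lemma rotationally_symmetric_profile_continuous:
  fixes W :: "'a::euclidean_space \<times> 'a \<Rightarrow> real"
  assumes "zonal_frame (e::'a) d lam area" and W: "W \<in> Cb_sphere_product" and w: "rotationally_symmetric W w"
  shows "continuous_on {-1..1} w"
proof -
  interpret zonal_frame e d lam area by fact
  have "continuous_on {-1..1} (\<lambda>t. W (e, meridian t))"
  proof (rule continuous_on_compose2[of "sphere 0 1 \<times> sphere 0 1" W])
    show "continuous_on (sphere 0 1 \<times> sphere 0 1) W" using W by (simp add: Cb_sphere_product_def)
    show "continuous_on {-1..1} (\<lambda>t. (e, meridian t))"
      by (intro continuous_on_Pair continuous_on_const continuous_on_meridian)
    show "(\<lambda>t. (e, meridian t)) ` {-1..1} \<subseteq> sphere 0 1 \<times> sphere 0 1"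
      using norm_meridian by auto
  qed
  moreover have "W (e, meridian t) = w t" if "t \<in> {-1..1}" for t
  proof -
    have "e \<in> sphere 0 1" "meridian t \<in> sphere 0 1" using norm_meridian[OF that] by simp_all
    then have "W (e, meridian t) = w (e \<bullet> meridian t)"
      using w unfolding rotationally_symmetric_def by blast
    also have "e \<bullet> meridian t = t" by (subst inner_commute) (rule meridian_inner(1))
    finally show ?thesis .
  qed
  ultimately show ?thesis by (rule continuous_on_eq)
qed

context zonal_frame
begin

lemma zonal_integral_const [simp]: "zonal_integral e (\<lambda>_. c) = c * area"
  by (simp add: zonal_integral_def area_def sphere_area_def mult.commute)

lemma zonal_integral_add:
  assumes "continuous_on {-1..1} f" "continuous_on {-1..1} g"
  shows "zonal_integral e (\<lambda>t. f t + g t) = zonal_integral e f + zonal_integral e g"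
  unfolding zonal_integral_def
  by (rule Bochner_Integration.integral_add[OF integrable_zonal[OF assms(1) norm_e] integrable_zonal[OF assms(2) norm_e]])

lemma zonal_integral_cmult: "zonal_integral e (\<lambda>t. c * f t) = c * zonal_integral e f"
  by (simp add: zonal_integral_def)

text \<open>
  Subtracting the constant \<open>harmonic_coeff n w 0\<close> from the profile moves the eigenvalue of the constant function to
  zero and leaves all others unchanged, because \<open>C k\<close> has mean zero for \<open>k \<ge> 1\<close>. So the coefficient of
  index zero cannot cause a resonance.
\<close>
lemma kernel_eigenvalue_normalised:
  assumes w: "continuous_on {-1..1} w"
  shows "kernel_eigenvalue (\<lambda>t. (harmonic_coeff DIM('a) w 0 - w t) / area) k
    = (if k = 0 then 0 else - harmonic_coeff DIM('a) w k)"
proof -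
  let ?c = "harmonic_coeff DIM('a) w 0"
  have cC: "continuous_on {-1..1} (poly (C k))" by (intro continuous_intros)
  have wC: "zonal_integral e (\<lambda>t. w t * poly (C k) t) = harmonic_coeff DIM('a) w k * poly (C k) 1 * area" for k
    using harmonic_coeff_eq_zonal_integral[OF dim e w, of k]
    by (simp add: poly_gegenbauer_poly lam_def[symmetric] area_def[symmetric])
  have "zonal_integral e (\<lambda>t. (?c - w t) / area * poly (C k) t)
     = zonal_integral e (\<lambda>t. ?c / area * poly (C k) t + (- (1 / area)) * (w t * poly (C k) t))"
    by (rule zonal_integral_cong) (simp add: diff_divide_distrib left_diff_distrib)
  also have "\<dots> = ?c / area * zonal_integral e (poly (C k)) + (- (1 / area)) * zonal_integral e (\<lambda>t. w t * poly (C k) t)"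
  proof -
    have c: "continuous_on {-1..1} (\<lambda>t. ?c / area * poly (C k) t)"
      "continuous_on {-1..1} (\<lambda>t. (- (1 / area)) * (w t * poly (C k) t))"
      by (intro continuous_on_mult continuous_on_const w cC)+
    show ?thesis unfolding zonal_integral_add[OF c] by (simp only: zonal_integral_cmult)
  qed
  also have "\<dots> = ?c / area * zonal_integral e (poly (C k)) - harmonic_coeff DIM('a) w k * poly (C k) 1"
    using area_pos by (simp add: wC)
  finally have eq: "kernel_eigenvalue (\<lambda>t. (?c - w t) / area) k
    = (?c / area * zonal_integral e (poly (C k)) - harmonic_coeff DIM('a) w k * poly (C k) 1) / poly (C k) 1"
    by (simp add: kernel_eigenvalue_def)
  show ?thesis
  proof (cases "k = 0")
    case True
    have "zonal_integral e (poly 1) = area" using zonal_integral_const[of 1] by (simp add: poly_1[abs_def])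
    then show ?thesis using eq True area_pos by simp
  next
    case False
    then have "zonal_integral e (poly (C k)) = 0" using L_C_pos_index[of k] by simp
    then show ?thesis using eq False C_1_pos[of k] by simp
  qed
qed

text \<open>
  The zonal fixed points \<open>1 + s (C k + z s)\<close> are positive with mean \<open>m s\<close>; divided by \<open>area * m s\<close> they are Gibbs
  densities for the parameter \<open>(\<kappa> + \<mu>0 s) * m s\<close>. Since \<open>m s = 1 + s * mean (z s)\<close> and \<open>z s\<close> tends to zero, the
  normalisation changes the density by \<open>o(s)\<close> only.
\<close>
theorem zonal_branch:
  fixes W :: "'a \<times> 'a \<Rightarrow> real"
  assumes W: "W \<in> Cb_sphere_product \<inter> H1_sphere_product" and w: "rotationally_symmetric W w"
    and k: "k \<ge> 1" and neg: "harmonic_coeff DIM('a) w k < 0"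
    and simple: "\<forall>j\<ge>1. j \<noteq> k \<longrightarrow> harmonic_coeff DIM('a) w j \<noteq> harmonic_coeff DIM('a) w k"
  obtains \<delta> :: real and \<mu> :: "real \<Rightarrow> real" and \<rho> :: "real \<Rightarrow> 'a \<Rightarrow> real"
  where "\<delta> > 0" "nontrivial_branch W \<delta> (\<lambda>t. - 1 / harmonic_coeff DIM('a) w k + \<mu> t) \<rho>"
    "continuous_on {-\<delta><..<\<delta>} \<mu>" "\<mu> 0 = 0"
    "(\<lambda>t. L2_norm (\<lambda>x. \<rho> t x - uniform_state x - t / area * poly (C k) (x \<bullet> e))) \<in> o[at 0](\<lambda>t. t)"
proof -
  define c where "c = harmonic_coeff DIM('a) w 0"
  define \<kappa> where "\<kappa> = - 1 / harmonic_coeff DIM('a) w k"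
  have \<kappa>: "\<kappa> > 0" using neg by (simp add: \<kappa>_def divide_pos_neg)
  have wc: "continuous_on {-1..1} w"
    using rotationally_symmetric_profile_continuous[OF zonal_frame_axioms _ w] W by blast
  define h where "h t = (c - w t) / area" for t
  have hc: "continuous_on {-1..1} h" unfolding h_def using area_pos by (intro continuous_intros wc) auto
  have ev: "kernel_eigenvalue h j = (if j = 0 then 0 else - harmonic_coeff DIM('a) w j)" for j
    unfolding h_def[abs_def] c_def by (rule kernel_eigenvalue_normalised[OF wc])
  have eig: "\<kappa> * kernel_eigenvalue h k = 1" using k neg by (simp add: ev \<kappa>_def)
  have nonresonant: "\<forall>j. j \<noteq> k \<longrightarrow> kernel_eigenvalue h j \<noteq> kernel_eigenvalue h k"
    using simple k neg by (auto simp: ev)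
  obtain \<delta>0 \<mu>0 z where \<delta>0: "\<delta>0 > 0" and \<mu>0: "continuous_on {-\<delta>0<..<\<delta>0} \<mu>0"
    and z: "continuous_on {-\<delta>0<..<\<delta>0} z" and \<mu>00: "\<mu>0 0 = 0" and z0: "z 0 = 0"
    and z_orth: "\<And>s. s \<in> {-\<delta>0<..<\<delta>0} \<Longrightarrow> gegenbauer_coef k (z s) = 0"
    and fixpoint: "\<And>s t. s \<in> {-\<delta>0<..<\<delta>0} \<Longrightarrow> t \<in> {-1..1} \<Longrightarrow> 1 + s * (poly (C k) t + z s t)
       = exp ((\<kappa> + \<mu>0 s) * zonal_conv h (\<lambda>t. s * (poly (C k) t + z s t)) t)"
    by (rule zonal_bifurcation[OF hc eig nonresonant])
       (rule that, assumption, assumption, assumption, assumption, assumption, blast, blast)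
  have nhd: "open {-\<delta>0<..<\<delta>0}" "0 \<in> {-\<delta>0<..<\<delta>0}" using \<delta>0 by auto
  have "isCont z 0" "isCont \<mu>0 0"
    using continuous_on_eq_continuous_at[OF nhd(1)] z \<mu>0 nhd(2) by blast+
  then have z_lim: "(z \<longlongrightarrow> 0) (at 0)" and \<mu>0_lim: "(\<mu>0 \<longlongrightarrow> 0) (at 0)"
    using z0 \<mu>00 by (simp_all add: isCont_def)
  \<comment> \<open>On a smaller interval the mean \<open>m s\<close> and the parameter \<open>\<kappa> + \<mu>0 s\<close> stay positive.\<close>
  have "\<forall>\<^sub>F s in at 0. norm (z s) < 1 / 2 \<and> \<bar>\<mu>0 s\<bar> < \<kappa>"
    using tendstoD[OF z_lim, of "1 / 2"] tendstoD[OF \<mu>0_lim \<kappa>] by (intro eventually_conj) (simp_all add: dist_norm)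
  then obtain \<delta>1 where \<delta>1: "\<delta>1 > 0" "\<And>s. s \<noteq> 0 \<Longrightarrow> \<bar>s\<bar> < \<delta>1 \<Longrightarrow> norm (z s) < 1 / 2 \<and> \<bar>\<mu>0 s\<bar> < \<kappa>"
    unfolding eventually_at by (auto simp: dist_norm)
  define \<delta> where "\<delta> = min 1 (min \<delta>0 \<delta>1)"
  define I where "I = {-\<delta><..<\<delta>}"
  have \<delta>: "\<delta> > 0" and I0: "s \<in> I \<Longrightarrow> s \<in> {-\<delta>0<..<\<delta>0}" and I1: "s \<in> I \<Longrightarrow> \<bar>s\<bar> \<le> 1" for s
    using \<delta>0 \<delta>1 by (auto simp: \<delta>_def I_def)
  have z_small: "norm (z s) \<le> 1 / 2" and \<mu>0_small: "\<kappa> + \<mu>0 s > 0" if "s \<in> I" for s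
  proof -
    have "\<bar>s\<bar> < \<delta>1" using that by (auto simp: I_def \<delta>_def)
    then show "norm (z s) \<le> 1 / 2" "\<kappa> + \<mu>0 s > 0"
      using \<delta>1(2)[of s] z0 \<mu>00 \<kappa> by (cases "s = 0"; force)+
  qed
  have zc: "continuous_on I z" and \<mu>0c: "continuous_on I \<mu>0"
    using I0 by (auto intro: continuous_on_subset[OF z] continuous_on_subset[OF \<mu>0])
  have int_C: "zonal_integral e (poly (C k)) = 0" using L_C_pos_index[OF k] .
  have cC: "continuous_on {-1..1} (poly (C k))" by (intro continuous_intros)
  define avg where "avg U = zonal_integral e (apply_bcontfun U) / area" for U
  have avg_le: "\<bar>avg U\<bar> \<le> norm U" for U
    using abs_zonal_integral_le[of "apply_bcontfun U" "norm U"] bcontfun_le_norm[of U] area_pos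
    by (simp add: avg_def pos_divide_le_eq)
  have avg_lin: "bounded_linear avg"
  proof (rule bounded_linear_intro[where K=1])
    show "avg (U + V) = avg U + avg V" for U V
      using zonal_integral_add[of "apply_bcontfun U" "apply_bcontfun V"] by (simp add: avg_def add_divide_distrib)
    show "avg (r *\<^sub>R U) = r *\<^sub>R avg U" for r U
      by (simp add: avg_def zonal_integral_cmult)
    show "norm (avg U) \<le> norm U * 1" for U using avg_le[of U] by simp
  qed
  define m where "m s = 1 + s * avg (z s)" for s
  have m_pos: "m s \<ge> 1 / 2" if "s \<in> I" for s
  proof -
    have "\<bar>s * avg (z s)\<bar> \<le> 1 * (1 / 2)"
      unfolding abs_mult using I1[OF that] avg_le[of "z s"] z_small[OF that] by (intro mult_mono) auto
    then show ?thesis unfolding m_def by linarith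
  qed
  have mc: "continuous_on I m"
    unfolding m_def[abs_def] by (intro continuous_intros bounded_linear.continuous_on[OF avg_lin] zc)
  define q where "q s = (1 / (area * m s)) *\<^sub>R (const_bcontfun 1 + s *\<^sub>R (gegenbauer_fun k + z s))" for s
  have q_apply: "apply_bcontfun (q s) t = (1 + s * (poly (C k) t + z s t)) / (area * m s)" if "t \<in> {-1..1}" for s t
    using that by (simp add: q_def const_bcontfun.rep_eq)
  have qc: "continuous_on I q"
    unfolding q_def[abs_def] using m_pos area_pos
    by (intro continuous_on_scaleR continuous_on_add continuous_on_divide continuous_on_mult continuous_on_const
        continuous_on_id mc zc) force
  define \<rho> where "\<rho> s x = apply_bcontfun (q s) (x \<bullet> e)" for s and x :: 'a
  define \<gamma> where "\<gamma> s = (\<kappa> + \<mu>0 s) * m s" for s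
  define \<mu> where "\<mu> s = \<gamma> s - \<kappa>" for s
  have mem: "x \<bullet> e \<in> {-1..1}" if "x \<in> sphere 0 1" for x :: 'a
    using inner_unit_le[of x e] that by simp
  have \<rho>_apply: "\<rho> s x = (1 + s * (poly (C k) (x \<bullet> e) + z s (x \<bullet> e))) / (area * m s)" if "x \<in> sphere 0 1" for s x
    unfolding \<rho>_def by (rule q_apply[OF mem[OF that]])
  have mean: "zonal_integral e (\<lambda>t. 1 + s * (poly (C k) t + z s t)) = area * m s" for s
  proof -
    have "zonal_integral e (\<lambda>t. 1 + s * (poly (C k) t + z s t))
       = area + s * (zonal_integral e (poly (C k)) + zonal_integral e (apply_bcontfun (z s)))"
    proof -
      have c: "continuous_on {-1..1} (apply_bcontfun (z s))" by (rule continuous_on_apply_bcontfun)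
      show ?thesis
        unfolding zonal_integral_add[OF continuous_on_const continuous_on_mult[OF continuous_on_const continuous_on_add[OF cC c]]]
          zonal_integral_cmult zonal_integral_add[OF cC c] by simp
    qed
    then show ?thesis using area_pos by (simp add: int_C m_def avg_def field_simps)
  qed
  have solution: "weak_solution W (\<gamma> s) (\<rho> s)" if s: "s \<in> I" for s
  proof (rule weak_solution_gibbs[OF W])
    define V where "V t = s * (poly (C k) t + z s t)" for t
    have Vc: "continuous_on {-1..1} V" unfolding V_def by (intro continuous_intros cC continuous_on_apply_bcontfun)
    have mpos: "m s > 0" using m_pos[OF s] by simp
    show "\<gamma> s \<noteq> 0" using \<mu>0_small[OF s] mpos by (simp add: \<gamma>_def)
    show "0 < exp ((\<kappa> + \<mu>0 s) * (c * m s)) / (area * m s)" using mpos area_pos by simp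
    show "continuous_on (sphere 0 1) (\<rho> s)"
      unfolding \<rho>_def by (rule continuous_on_sphere_zonal[OF continuous_on_apply_bcontfun norm_e])
    have "(\<integral>x. \<rho> s x \<partial>sphere_measure) = zonal_integral e (\<lambda>t. (1 / (area * m s)) * (1 + s * (poly (C k) t + z s t)))"
      unfolding zonal_integral_def by (rule Bochner_Integration.integral_cong) (simp_all add: \<rho>_apply)
    then show "(\<integral>x. \<rho> s x \<partial>sphere_measure) = 1"
      using mpos area_pos by (simp only: zonal_integral_cmult mean) simp
    fix x :: 'a assume x: "x \<in> sphere 0 1"
    then have nx: "norm x = 1" by simp
    let ?t = "x \<bullet> e"
    have t: "?t \<in> {-1..1}" by (rule mem[OF x])
    have conv_w: "(\<integral>y. W (x, y) * \<rho> s y \<partial>sphere_measure) = zonal_conv w (\<lambda>t. 1 + V t) ?t / (area * m s)"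
    proof -
      have "(\<integral>y. W (x, y) * \<rho> s y \<partial>sphere_measure) = (\<integral>y. (1 / (area * m s)) * (w (x \<bullet> y) * (1 + V (y \<bullet> e))) \<partial>sphere_measure)"
      proof (rule Bochner_Integration.integral_cong[OF refl])
        fix y :: 'a assume "y \<in> space sphere_measure"
        then have y: "y \<in> sphere 0 1" by simp
        have "W (x, y) = w (x \<bullet> y)" using w x y by (simp add: rotationally_symmetric_def)
        then show "W (x, y) * \<rho> s y = (1 / (area * m s)) * (w (x \<bullet> y) * (1 + V (y \<bullet> e)))"
          by (simp add: \<rho>_apply[OF y] V_def)
      qed
      also have "\<dots> = (1 / (area * m s)) * (\<integral>y. w (x \<bullet> y) * (1 + V (y \<bullet> e)) \<partial>sphere_measure)" by simp
      also have "(\<integral>y. w (x \<bullet> y) * (1 + V (y \<bullet> e)) \<partial>sphere_measure) = zonal_conv w (\<lambda>t. 1 + V t) ?t"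
        by (rule zonal_conv_eq[OF wc _ nx]) (intro continuous_intros Vc)
      finally show ?thesis by simp
    qed
    \<comment> \<open>As \<open>h\<close> annihilates constants, \<open>V\<close> may be replaced by the unnormalised density \<open>1 + V\<close>.\<close>
    have conv_h: "zonal_conv h V ?t = c * m s - zonal_conv w (\<lambda>t. 1 + V t) ?t / area"
    proof -
      have "zonal_conv h (poly (C 0)) ?t = 0" using funk_hecke[OF hc t, of 0] by (simp add: ev)
      then have "zonal_conv h (\<lambda>_. 1) ?t = 0" by (simp add: poly_1[abs_def])
      then have "zonal_conv h V ?t = zonal_conv h (\<lambda>t. 1 + V t) ?t"
        using zonal_conv_linear[OF hc continuous_on_const Vc t, of 1 1 1] by simp
      also have "\<dots> = (\<integral>y. c / area * (1 + V (y \<bullet> e)) - (1 / area) * (w (meridian ?t \<bullet> y) * (1 + V (y \<bullet> e))) \<partial>sphere_measure)"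
        unfolding zonal_conv_def h_def by (simp add: field_simps diff_divide_distrib)
      also have "\<dots> = c / area * zonal_integral e (\<lambda>t. 1 + V t) - (1 / area) * zonal_conv w (\<lambda>t. 1 + V t) ?t"
      proof -
        have c1: "continuous_on {-1..1} (\<lambda>t. 1 + V t)" by (intro continuous_intros Vc)
        show ?thesis
          unfolding zonal_integral_def zonal_conv_def
          using integrable_zonal[OF c1 norm_e] integrable_sphere_continuous[OF continuous_kernel[OF wc c1 norm_meridian[OF t]]]
          by (subst Bochner_Integration.integral_diff) (auto simp del: meridian_inner)
      qed
      also have "zonal_integral e (\<lambda>t. 1 + V t) = area * m s" unfolding V_def by (rule mean)
      finally show ?thesis using area_pos by simp
    qed
    have "1 + V ?t = exp ((\<kappa> + \<mu>0 s) * zonal_conv h V ?t)"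
      using fixpoint[OF I0[OF s] t] by (simp only: V_def[abs_def])
    also have "(\<kappa> + \<mu>0 s) * zonal_conv h V ?t
        = (\<kappa> + \<mu>0 s) * (c * m s) + (- \<gamma> s * (\<integral>y. W (x, y) * \<rho> s y \<partial>sphere_measure))"
      unfolding conv_h conv_w \<gamma>_def using mpos area_pos by (simp add: field_simps)
    also have "exp \<dots> = exp ((\<kappa> + \<mu>0 s) * (c * m s)) * exp (- \<gamma> s * (\<integral>y. W (x, y) * \<rho> s y \<partial>sphere_measure))"
      by (rule exp_add)
    finally show "\<rho> s x = exp ((\<kappa> + \<mu>0 s) * (c * m s)) / (area * m s) * exp (- \<gamma> s * (\<integral>y. W (x, y) * \<rho> s y \<partial>sphere_measure))"
      by (simp add: \<rho>_apply[OF x] V_def)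
  qed
  have cont: "((\<lambda>t. L2_norm (\<lambda>x. \<rho> t x - \<rho> s x)) \<longlongrightarrow> 0) (at s)" if s: "s \<in> I" for s
  proof (rule Lim_null_comparison)
    have "open I" by (simp add: I_def)
    then have "isCont q s" using qc s by (simp add: continuous_on_eq_continuous_at)
    then show "((\<lambda>t. norm (q t - q s)) \<longlongrightarrow> 0) (at s)"
      unfolding isCont_def by (simp add: tendsto_norm_zero_iff LIM_zero_iff)
    show "\<forall>\<^sub>F t in at s. norm (L2_norm (\<lambda>x. \<rho> t x - \<rho> s x)) \<le> norm (q t - q s)"
    proof (rule always_eventually, rule allI)
      fix t
      have "L2_norm (\<lambda>x. \<rho> t x - \<rho> s x) \<le> norm (q t - q s)"
      proof (rule L2_norm_le)
        show "\<bar>\<rho> t x - \<rho> s x\<bar> \<le> norm (q t - q s)" for x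
          using bcontfun_le_norm[of "q t - q s" "x \<bullet> e"] by (simp add: \<rho>_def)
      qed simp
      moreover have "L2_norm (\<lambda>x. \<rho> t x - \<rho> s x) \<ge> 0"
        using sphere_area_pos[where 'a='a] by (simp add: L2_norm_def less_imp_le)
      ultimately show "norm (L2_norm (\<lambda>x. \<rho> t x - \<rho> s x)) \<le> norm (q t - q s)" by simp
    qed
  qed
  \<comment> \<open>The Gegenbauer coefficient of index \<open>k\<close> distinguishes the density from the uniform state.\<close>
  have nontrivial: "\<not> (AE x in sphere_measure. \<rho> s x = uniform_state x)" if s: "s \<in> I" "s \<noteq> 0" for s
  proof
    assume ae: "AE x in sphere_measure. \<rho> s x = uniform_state x"
    have qm: "zonal_integral e (\<lambda>t. q s t * poly (C k) t) = zonal_integral e (\<lambda>t. (1 / area) * poly (C k) t)"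
      unfolding zonal_integral_def
    proof (rule integral_cong_AE)
      show "AE x in sphere_measure. q s (x \<bullet> e) * poly (C k) (x \<bullet> e) = (1 / area) * poly (C k) (x \<bullet> e)"
        using ae by eventually_elim (simp add: \<rho>_def uniform_state_def area_def)
      show "(\<lambda>x. q s (x \<bullet> e) * poly (C k) (x \<bullet> e)) \<in> borel_measurable sphere_measure"
        "(\<lambda>x. (1 / area) * poly (C k) (x \<bullet> e)) \<in> borel_measurable sphere_measure"
        by (intro borel_measurable_sphere_continuous continuous_on_mult continuous_on_const
            continuous_on_sphere_zonal[OF _ norm_e] cC continuous_on_apply_bcontfun)+
    qed
    have "gegenbauer_coef k (q s) = 0"
      unfolding gegenbauer_coef_def qm zonal_integral_cmult int_C by simp
    moreover have "gegenbauer_coef k (q s) = s / (area * m s)"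
    proof -
      interpret g: bounded_linear "gegenbauer_coef k" by (rule bounded_linear_gegenbauer_coef)
      have "gegenbauer_coef k (const_bcontfun 1) = 0"
        by (simp add: gegenbauer_coef_def const_bcontfun.rep_eq int_C)
      then show ?thesis
        by (simp add: q_def g.scaleR g.add gegenbauer_coef_fun z_orth[OF I0[OF s(1)]])
    qed
    ultimately show False using s m_pos[OF s(1)] area_pos by simp
  qed
  define K where "K = norm (gegenbauer_fun k)"
  have remainder: "L2_norm (\<lambda>x. \<rho> s x - uniform_state x - s / area * poly (C k) (x \<bullet> e)) \<le> 2 / area * (2 + K) * norm (z s) * \<bar>s\<bar>"
    if s: "s \<in> I" for s
  proof (rule L2_norm_le)
    fix x :: 'a assume x: "x \<in> sphere 0 1"
    define p where "p = poly (C k) (x \<bullet> e)"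
    define r where "r = apply_bcontfun (z s) (x \<bullet> e)"
    define M where "M = avg (z s)"
    have p: "\<bar>p\<bar> \<le> K" using bcontfun_le_norm[of "gegenbauer_fun k" "x \<bullet> e"] mem[OF x] by (simp add: p_def K_def)
    have r: "\<bar>r\<bar> \<le> norm (z s)" unfolding r_def by (rule bcontfun_le_norm)
    have M: "\<bar>M\<bar> \<le> norm (z s)" unfolding M_def by (rule avg_le)
    have mp: "m s \<ge> 1 / 2" by (rule m_pos[OF s])
    have "\<rho> s x - uniform_state x - s / area * p = (1 / area) * ((1 + s * (p + r)) / m s - 1 - s * p)"
      by (simp add: \<rho>_apply[OF x] p_def r_def uniform_state_def area_def[symmetric] right_diff_distrib)
    also have "(1 + s * (p + r)) / m s - 1 - s * p = s * (r - M - s * M * p) / m s"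
      using mp by (simp add: m_def M_def[symmetric] field_simps)
    finally have eq: "\<rho> s x - uniform_state x - s / area * p = (1 / area) * (s * (r - M - s * M * p) / m s)" .
    have "\<bar>s * M * p\<bar> \<le> 1 * norm (z s) * K"
      unfolding abs_mult using I1[OF s] M p by (intro mult_mono) auto
    then have "\<bar>r - M - s * M * p\<bar> \<le> (2 + K) * norm (z s)"
      using r M by (simp add: algebra_simps abs_le_iff)
    then have 1: "\<bar>s * (r - M - s * M * p)\<bar> \<le> \<bar>s\<bar> * ((2 + K) * norm (z s))"
      unfolding abs_mult by (rule mult_left_mono) simp
    have "\<bar>s * (r - M - s * M * p) / m s\<bar> \<le> 2 * (\<bar>s\<bar> * ((2 + K) * norm (z s)))"
    proof -
      have "\<bar>s * (r - M - s * M * p) / m s\<bar> = \<bar>s * (r - M - s * M * p)\<bar> * (1 / m s)"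
        using mp by (simp add: abs_mult)
      also have "\<dots> \<le> (\<bar>s\<bar> * ((2 + K) * norm (z s))) * 2"
        using 1 mp by (intro mult_mono) (auto simp: pos_divide_le_eq K_def)
      finally show ?thesis by simp
    qed
    then have "(1 / area) * \<bar>s * (r - M - s * M * p) / m s\<bar> \<le> (1 / area) * (2 * (\<bar>s\<bar> * ((2 + K) * norm (z s))))"
      using area_pos by (intro mult_left_mono) auto
    moreover have "(1 / area) * (2 * (\<bar>s\<bar> * ((2 + K) * norm (z s)))) = 2 / area * (2 + K) * norm (z s) * \<bar>s\<bar>"
      by (simp add: algebra_simps add_divide_distrib)
    moreover have "\<bar>1 / area\<bar> = 1 / area" using area_pos by simp
    ultimately show "\<bar>\<rho> s x - uniform_state x - s / area * poly (C k) (x \<bullet> e)\<bar> \<le> 2 / area * (2 + K) * norm (z s) * \<bar>s\<bar>"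
      unfolding p_def[symmetric] eq abs_mult[of "1 / area"] by (simp only:)
  qed (use area_pos in \<open>simp add: K_def\<close>)
  have little_o: "(\<lambda>t. L2_norm (\<lambda>x. \<rho> t x - uniform_state x - t / area * poly (C k) (x \<bullet> e))) \<in> o[at 0](\<lambda>t. t)"
  proof (rule landau_o.smallI)
    fix \<epsilon> :: real assume \<epsilon>: "\<epsilon> > 0"
    have "((\<lambda>s. 2 / area * (2 + K) * norm (z s)) \<longlongrightarrow> 2 / area * (2 + K) * 0) (at 0)"
      by (intro tendsto_intros tendsto_norm_zero z_lim)
    then have "\<forall>\<^sub>F s in at 0. 2 / area * (2 + K) * norm (z s) < \<epsilon>"
      using \<epsilon> by (intro order_tendstoD) simp_all
    moreover have "\<forall>\<^sub>F s in at 0. s \<in> I"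
      using \<delta> by (intro eventually_at_in_open') (auto simp: I_def)
    ultimately show "\<forall>\<^sub>F s in at 0. norm (L2_norm (\<lambda>x. \<rho> s x - uniform_state x - s / area * poly (C k) (x \<bullet> e))) \<le> \<epsilon> * norm s"
    proof eventually_elim
      case (elim s)
      have "2 / area * (2 + K) * norm (z s) * \<bar>s\<bar> \<le> \<epsilon> * \<bar>s\<bar>"
        using elim(1) by (intro mult_right_mono) auto
      moreover have "L2_norm (\<lambda>x. \<rho> s x - uniform_state x - s / area * poly (C k) (x \<bullet> e)) \<ge> 0"
        using sphere_area_pos[where 'a='a] by (simp add: L2_norm_def less_imp_le)
      ultimately show ?case using remainder[OF elim(2)] by simp
    qed
  qed
  show ?thesis
  proof (rule that[OF \<delta> _ _ _ little_o])
    show "nontrivial_branch W \<delta> (\<lambda>t. - 1 / harmonic_coeff DIM('a) w k + \<mu> t) \<rho>"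
      unfolding nontrivial_branch_def
    proof (intro conjI ballI allI impI)
      fix s assume "s \<in> {-\<delta><..<\<delta>}"
      then have s: "s \<in> I" by (simp add: I_def)
      have "- 1 / harmonic_coeff DIM('a) w k + \<mu> s = \<gamma> s" by (simp add: \<mu>_def \<kappa>_def)
      then show "weak_solution W (- 1 / harmonic_coeff DIM('a) w k + \<mu> s) (\<rho> s)" using solution[OF s] by simp
      show "((\<lambda>t. L2_norm (\<lambda>x. \<rho> t x - \<rho> s x)) \<longlongrightarrow> 0) (at s)" by (rule cont[OF s])
    next
      fix \<epsilon> :: real assume \<epsilon>: "\<epsilon> > 0"
      define s where "s = min \<delta> \<epsilon> / 2"
      have "s \<in> I" "s \<noteq> 0" "\<bar>s\<bar> < \<epsilon>" using \<delta> \<epsilon> by (auto simp: s_def I_def min_def)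
      then show "\<exists>t\<in>{-\<delta><..<\<delta>}. \<bar>t\<bar> < \<epsilon> \<and> \<not> (AE x in sphere_measure. \<rho> t x = uniform_state x)"
        using nontrivial unfolding I_def by blast
    qed
    show "continuous_on {-\<delta><..<\<delta>} \<mu>"
      unfolding I_def[symmetric] \<mu>_def[abs_def] \<gamma>_def by (intro continuous_intros \<mu>0c mc)
    show "\<mu> 0 = 0" by (simp add: \<mu>_def \<gamma>_def m_def \<mu>00)
  qed
qed

end

theorem theorem1p3:
  fixes W :: "(real^'n) \<times> (real^'n) \<Rightarrow> real" and w :: "real \<Rightarrow> real"
    and k :: nat and m :: "'n::finite"
  assumes "CARD('n) \<ge> 3"
    and "W \<in> Cb_sphere_product \<inter> H1_sphere_product"
    and "rotationally_symmetric W w"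
    and "k \<ge> 1"
    and "harmonic_coeff CARD('n) w k < 0"
    and "\<forall>j\<ge>1. j \<noteq> k \<longrightarrow> harmonic_coeff CARD('n) w j \<noteq> harmonic_coeff CARD('n) w k"
  shows "\<exists>(\<delta>::real) (\<gamma>::real \<Rightarrow> real) (\<rho>::real \<Rightarrow> real^'n \<Rightarrow> real) (f::real \<Rightarrow> real) (\<mu>::real \<Rightarrow> real).
      \<delta> > 0 \<and>
      nontrivial_branch W \<delta> \<gamma> \<rho> \<and>
      continuous_on {-\<delta><..<\<delta>} f \<and> f 0 = 0 \<and>
      continuous_on {-\<delta><..<\<delta>} \<mu> \<and> \<mu> 0 = 0 \<and>
      (\<forall>t\<in>{-\<delta><..<\<delta>}. \<gamma> t = - 1 / harmonic_coeff CARD('n) w k + \<mu> t) \<and>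
      (\<lambda>t. L2_norm (\<lambda>x. \<rho> t x - uniform_state x - f t * Y_zonal m k x)) \<in> o[at 0](f)"
proof -
  have "\<not> (UNIV :: 'n set) \<subseteq> {m}"
    using card_mono[of "{m}" "UNIV :: 'n set"] assms(1) by auto
  then obtain i :: 'n where i: "i \<noteq> m" by blast
  define e d :: "real^'n" where "e = axis m 1" and "d = axis i 1"
  have "e \<noteq> d" using i by (simp add: e_def d_def axis_eq_axis)
  define lam where "lam = (real DIM(real^'n) - 2) / 2"
  define area where "area = sphere_area TYPE(real^'n)"
  interpret zonal_frame e d lam area
    using assms(1) \<open>e \<noteq> d\<close> by unfold_locales (auto simp: e_def d_def lam_def area_def)
  have xe: "x \<bullet> e = x $ m" for x by (simp add: e_def inner_axis)
  have D: "DIM(real^'n) = CARD('n)" by simp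
  obtain \<delta> \<mu> \<rho> where *: "\<delta> > 0" "nontrivial_branch W \<delta> (\<lambda>t. - 1 / harmonic_coeff CARD('n) w k + \<mu> t) \<rho>"
    "continuous_on {-\<delta><..<\<delta>} \<mu>" "\<mu> 0 = 0"
    "(\<lambda>t. L2_norm (\<lambda>x. \<rho> t x - uniform_state x - t / area * poly (C k) (x \<bullet> e))) \<in> o[at 0](\<lambda>t. t)"
    using zonal_branch[of W w k] assms unfolding D by blast
  define A where "A = L2_norm (\<lambda>x::real^'n. gegenbauer k ((real CARD('n) - 2) / 2) (x $ m))"
  have lam: "(real CARD('n) - 2) / 2 = lam" by (simp add: lam_def)
  have gC: "gegenbauer k ((real CARD('n) - 2) / 2) (x $ m) = poly (C k) (x \<bullet> e)" for x
    by (simp add: poly_gegenbauer_poly lam xe)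
  have "A = sqrt (1 / area * sqnorm k)"
  proof -
    have "sqnorm k = (\<integral>x. (poly (C k) (x \<bullet> e))\<^sup>2 \<partial>sphere_measure)"
      unfolding sqnorm_def by (simp add: zonal_integral_def power2_eq_square)
    then show ?thesis unfolding A_def L2_norm_def gC by (simp only: area_def)
  qed
  then have A: "A > 0" using sqnorm_pos[of k] area_pos by simp
  \<comment> \<open>The branch is parametrised by the multiple of \<open>C k\<close>, whereas \<open>Y_zonal\<close> is \<open>C k\<close> divided by its norm \<open>A\<close>.\<close>
  define f where "f t = t * (A / area)" for t
  have fY: "f t * Y_zonal m k x = t / area * poly (C k) (x \<bullet> e)" for t x
    using A by (simp add: f_def Y_zonal_def Y_const_def gC A_def[unfolded gC, symmetric])
  have "(\<lambda>t. L2_norm (\<lambda>x. \<rho> t x - uniform_state x - f t * Y_zonal m k x)) \<in> o[at 0](\<lambda>t. t)"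
    unfolding fY by (rule *(5))
  then have "(\<lambda>t. L2_norm (\<lambda>x. \<rho> t x - uniform_state x - f t * Y_zonal m k x)) \<in> o[at 0](f)"
    unfolding f_def[abs_def] using A area_pos by (simp add: landau_o.small.cmult')
  moreover have "continuous_on {-\<delta><..<\<delta>} f" "f 0 = 0"
    unfolding f_def[abs_def] by (intro continuous_intros) simp_all
  ultimately show ?thesis using *(1-4) by blast
qed

end
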